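(* Let $\epsilon_1,\epsilon_2>0$ with $\epsilon_1<\min(\epsilon_1^*,1/K_m)$ and $\epsilon_2<\min(\epsilon_2^*,1/K_m)$. Then $\mathcal{A}_1$ generates a $C_0$-semigroup of contractions on the Hilbert space $(\mathcal{H},\langle\cdot,\cdot\rangle_{\mathcal{H},2})$. Furthermore, $D(\mathcal{A}_1)$ is dense in $\mathcal{H}$ endowed with either $\langle\cdot,\cdot\rangle_{\mathcal{H},1}$ or $\langle\cdot,\cdot\rangle_{\mathcal{H},2}$.
   Context: Let $l>0$. For a Lebesgue measurable $f:(0,l)\to\mathbb{R}$, $\overline{f}$ and $\underline{f}$ denote its essential supremum and essential infimum on $(0,l)$ (so e.g. $\underline{\eta_\omega EI}$ is the essential infimum of the product $\eta_\omega EI$). Let $\rho, I_w, EI, GJ, \eta_\omega, \eta_\phi \in L^\infty(0,l)$ with $\underline{\rho},\underline{I_w},\underline{EI},\underline{GJ},\underline{\eta_\omega},\underline{\eta_\phi}>0$, and let $k_1,k_2\ge 0$. Elements of $H^1(0,l)$ are identified with their absolutely continuous representatives. $\mathcal{H}=\{(f,g,h,z)\in H^2(0,l)\times L^2(0,l)\times H^1(0,l)\times L^2(0,l): f(0)=f'(0)=0,\ h(0)=0\}$, $\langle (f_1,g_1,h_1,z_1),(f_2,g_2,h_2,z_2)\rangle_{\mathcal{H},1}=\int_0^l [EI f_1''f_2''+\rho g_1g_2+GJ h_1'h_2'+I_w z_1z_2]\,\mathrm{d}y$, and $\langle X_1,X_2\rangle_{\mathcal{H},2}=\langle X_1,X_2\rangle_{\mathcal{H},1}+\epsilon_1\int_0^l\rho(f_1g_2+g_1f_2)\,\mathrm{d}y+\epsilon_2\int_0^l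 I_w(h_1z_2+z_1h_2)\,\mathrm{d}y$ for $X_i=(f_i,g_i,h_i,z_i)$. $K_m=\max\big(\sqrt{\overline{\rho}},\ \tfrac{16l^4\sqrt{\overline{\rho}}}{\pi^4\underline{EI}},\ \sqrt{\overline{I_w}},\ \tfrac{4l^2\sqrt{\overline{I_w}}}{\pi^2\underline{GJ}}\big)$, $\epsilon_1^*=\dfrac{4\pi^4\underline{\eta_\omega EI}}{64l^4\overline{\rho}+\pi^4\overline{\eta_\omega}\,\underline{\eta_\omega EI}}$, $\epsilon_2^*=\dfrac{4\pi^2\underline{\eta_\phi GJ}}{16l^2\overline{I_w}+\pi^2\overline{\eta_\phi}\,\underline{\eta_\phi GJ}}$. $D(\mathcal{A}_1)$ is the set of $(f,g,h,z)\in\mathcal{H}$ with $g\in H^2(0,l)$, $z\in H^1(0,l)$, $EIf''+\eta_\omega EI g''\in H^2(0,l)$, $GJh'+\eta_\phi GJ z'\in H^1(0,l)$, $g(0)=g'(0)=0$, $z(0)=0$, $(EIf''+\eta_\omega EI g'')(l)=0$, $(EIf''+\eta_\omega EIg'')'(l)=k_1(g(l)+\epsilon_1 f(l))$, $(GJh'+\eta_\phi GJ z')(l)=-k_2(z(l)+\epsilon_2 h(l))$; and $\mathcal{A}_1(f,g,h,z)=\big(g,\,-\tfrac{1}{\rho}(EIf''+\eta_\omega EIg'')'',\,z,\,\tfrac{1}{I_w}(GJh'+\eta_\phi GJ z')'\big)$. *)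

theory Defs
  imports "HOL-Analysis.Analysis" "HOL-Probability.Essential_Supremum"
begin

definition L2 :: "real \<Rightarrow> (real \<Rightarrow> real) \<Rightarrow> bool" where
  "L2 l f \<longleftrightarrow> f \<in> borel_measurable (lebesgue_on {0..l}) \<and>
     integrable (lebesgue_on {0..l}) (\<lambda>y. (f y)^2)"

definition Linf :: "real \<Rightarrow> (real \<Rightarrow> real) \<Rightarrow> bool" where
  "Linf l f \<longleftrightarrow> f \<in> borel_measurable (lebesgue_on {0..l}) \<and>
     (\<exists>M. AE y in lebesgue_on {0..l}. \<bar>f y\<bar> \<le> M)"

definition ess_sup :: "real \<Rightarrow> (real \<Rightarrow> real) \<Rightarrow> real" where
  "ess_sup l f = real_of_ereal (esssup (lebesgue_on {0..l}) (\<lambda>y. ereal (f y)))"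

definition ess_inf :: "real \<Rightarrow> (real \<Rightarrow> real) \<Rightarrow> real" where
  "ess_inf l f = - ess_sup l (\<lambda>y. - f y)"

text \<open>g is a (weak) derivative of f on [0,l], with f its absolutely continuous representative\<close>
definition wderiv :: "real \<Rightarrow> (real \<Rightarrow> real) \<Rightarrow> (real \<Rightarrow> real) \<Rightarrow> bool" where
  "wderiv l f g \<longleftrightarrow> L2 l g \<and>
     (\<forall>x\<in>{0..l}. f x = f 0 + integral\<^sup>L (lebesgue_on {0..x}) g)"

definition H1 :: "real \<Rightarrow> (real \<Rightarrow> real) \<Rightarrow> bool" where
  "H1 l f \<longleftrightarrow> (\<exists>g. wderiv l f g)"

definition H2 :: "real \<Rightarrow> (real \<Rightarrow> real) \<Rightarrow> bool" where
  "H2 l f \<longleftrightarrow> (\<exists>g. wderiv l f g \<and> H1 l g)"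

text \<open>first derivative (absolutely continuous representative when one exists)\<close>
definition d1 :: "real \<Rightarrow> (real \<Rightarrow> real) \<Rightarrow> (real \<Rightarrow> real)" where
  "d1 l f = (if \<exists>g. wderiv l f g \<and> H1 l g then (SOME g. wderiv l f g \<and> H1 l g)
             else (SOME g. wderiv l f g))"

definition d2 :: "real \<Rightarrow> (real \<Rightarrow> real) \<Rightarrow> (real \<Rightarrow> real)" where
  "d2 l f = d1 l (d1 l f)"

type_synonym st = "(real \<Rightarrow> real) \<times> (real \<Rightarrow> real) \<times> (real \<Rightarrow> real) \<times> (real \<Rightarrow> real)"

definition sadd :: "st \<Rightarrow> st \<Rightarrow> st" where
  "sadd X Y = (case X of (f1,g1,h1,z1) \<Rightarrow> case Y of (f2,g2,h2,z2) \<Rightarrow>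
     (\<lambda>y. f1 y + f2 y, \<lambda>y. g1 y + g2 y, \<lambda>y. h1 y + h2 y, \<lambda>y. z1 y + z2 y))"

definition sscale :: "real \<Rightarrow> st \<Rightarrow> st" where
  "sscale a X = (case X of (f,g,h,z) \<Rightarrow>
     (\<lambda>y. a * f y, \<lambda>y. a * g y, \<lambda>y. a * h y, \<lambda>y. a * z y))"

definition sdiff :: "st \<Rightarrow> st \<Rightarrow> st" where
  "sdiff X Y = sadd X (sscale (-1) Y)"

definition HH :: "real \<Rightarrow> st set" where
  "HH l = {(f,g,h,z). H2 l f \<and> L2 l g \<and> H1 l h \<and> L2 l z \<and>
                      f 0 = 0 \<and> d1 l f 0 = 0 \<and> h 0 = 0}"

definition ip1 :: "real \<Rightarrow> (real \<Rightarrow> real) \<Rightarrow> (real \<Rightarrow> real) \<Rightarrow> (real \<Rightarrow> real) \<Rightarrow> (real \<Rightarrow> real)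
                   \<Rightarrow> st \<Rightarrow> st \<Rightarrow> real" where
  "ip1 l EI \<rho> GJ Iw X Y = (case X of (f1,g1,h1,z1) \<Rightarrow> case Y of (f2,g2,h2,z2) \<Rightarrow>
     integral\<^sup>L (lebesgue_on {0..l}) (\<lambda>y. EI y * d2 l f1 y * d2 l f2 y + \<rho> y * g1 y * g2 y
        + GJ y * d1 l h1 y * d1 l h2 y + Iw y * z1 y * z2 y))"

definition ip2 :: "real \<Rightarrow> (real \<Rightarrow> real) \<Rightarrow> (real \<Rightarrow> real) \<Rightarrow> (real \<Rightarrow> real) \<Rightarrow> (real \<Rightarrow> real)
                   \<Rightarrow> real \<Rightarrow> real \<Rightarrow> st \<Rightarrow> st \<Rightarrow> real" where
  "ip2 l EI \<rho> GJ Iw \<epsilon>1 \<epsilon>2 X Y = ip1 l EI \<rho> GJ Iw X Y +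
     (case X of (f1,g1,h1,z1) \<Rightarrow> case Y of (f2,g2,h2,z2) \<Rightarrow>
       \<epsilon>1 * integral\<^sup>L (lebesgue_on {0..l}) (\<lambda>y. \<rho> y * (f1 y * g2 y + g1 y * f2 y))
     + \<epsilon>2 * integral\<^sup>L (lebesgue_on {0..l}) (\<lambda>y. Iw y * (h1 y * z2 y + z1 y * h2 y)))"

definition Km :: "real \<Rightarrow> (real \<Rightarrow> real) \<Rightarrow> (real \<Rightarrow> real) \<Rightarrow> (real \<Rightarrow> real) \<Rightarrow> (real \<Rightarrow> real) \<Rightarrow> real" where
  "Km l \<rho> EI Iw GJ = Max {sqrt (ess_sup l \<rho>),
      16 * l^4 * sqrt (ess_sup l \<rho>) / (pi^4 * ess_inf l EI),
      sqrt (ess_sup l Iw),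
      4 * l^2 * sqrt (ess_sup l Iw) / (pi^2 * ess_inf l GJ)}"

definition eps1_star :: "real \<Rightarrow> (real \<Rightarrow> real) \<Rightarrow> (real \<Rightarrow> real) \<Rightarrow> (real \<Rightarrow> real) \<Rightarrow> real" where
  "eps1_star l \<rho> \<eta>\<omega> EI = 4 * pi^4 * ess_inf l (\<lambda>y. \<eta>\<omega> y * EI y) /
      (64 * l^4 * ess_sup l \<rho> + pi^4 * ess_sup l \<eta>\<omega> * ess_inf l (\<lambda>y. \<eta>\<omega> y * EI y))"

definition eps2_star :: "real \<Rightarrow> (real \<Rightarrow> real) \<Rightarrow> (real \<Rightarrow> real) \<Rightarrow> (real \<Rightarrow> real) \<Rightarrow> real" where
  "eps2_star l Iw \<eta>\<phi> GJ = 4 * pi^2 * ess_inf l (\<lambda>y. \<eta>\<phi> y * GJ y) /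
      (16 * l^2 * ess_sup l Iw + pi^2 * ess_sup l \<eta>\<phi> * ess_inf l (\<lambda>y. \<eta>\<phi> y * GJ y))"

text \<open>Witnesses: g', z' are the regular representatives of g, z; M = EI f'' + eta_omega EI g'',
  Q = GJ h' + eta_phi GJ z' (regular representatives).\<close>
definition DA1_wit :: "real \<Rightarrow> (real \<Rightarrow> real) \<Rightarrow> (real \<Rightarrow> real) \<Rightarrow> (real \<Rightarrow> real) \<Rightarrow> (real \<Rightarrow> real)
    \<Rightarrow> real \<Rightarrow> real \<Rightarrow> real \<Rightarrow> real \<Rightarrow> st \<Rightarrow> st \<Rightarrow> bool" where
  "DA1_wit l EI GJ \<eta>\<omega> \<eta>\<phi> k1 k2 \<epsilon>1 \<epsilon>2 X W \<longleftrightarrow> X \<in> HH l \<and>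
     (case X of (f,g,h,z) \<Rightarrow> case W of (g',z',M,Q) \<Rightarrow>
       (AE y in lebesgue_on {0..l}. g' y = g y) \<and>
       (AE y in lebesgue_on {0..l}. z' y = z y) \<and>
       H2 l g' \<and> H1 l z' \<and> H2 l M \<and> H1 l Q \<and>
       (AE y in lebesgue_on {0..l}. M y = EI y * d2 l f y + \<eta>\<omega> y * EI y * d2 l g' y) \<and>
       (AE y in lebesgue_on {0..l}. Q y = GJ y * d1 l h y + \<eta>\<phi> y * GJ y * d1 l z' y) \<and>
       g' 0 = 0 \<and> d1 l g' 0 = 0 \<and> z' 0 = 0 \<and>
       M l = 0 \<and> d1 l M l = k1 * (g' l + \<epsilon>1 * f l) \<and>
       Q l = - k2 * (z' l + \<epsilon>2 * h l))"

definition DA1 :: "real \<Rightarrow> (real \<Rightarrow> real) \<Rightarrow> (real \<Rightarrow> real) \<Rightarrow> (real \<Rightarrow> real) \<Rightarrow> (real \<Rightarrow> real)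
    \<Rightarrow> real \<Rightarrow> real \<Rightarrow> real \<Rightarrow> real \<Rightarrow> st set" where
  "DA1 l EI GJ \<eta>\<omega> \<eta>\<phi> k1 k2 \<epsilon>1 \<epsilon>2 = {X. \<exists>W. DA1_wit l EI GJ \<eta>\<omega> \<eta>\<phi> k1 k2 \<epsilon>1 \<epsilon>2 X W}"

definition A1 :: "real \<Rightarrow> (real \<Rightarrow> real) \<Rightarrow> (real \<Rightarrow> real) \<Rightarrow> (real \<Rightarrow> real) \<Rightarrow> (real \<Rightarrow> real)
    \<Rightarrow> (real \<Rightarrow> real) \<Rightarrow> (real \<Rightarrow> real)
    \<Rightarrow> real \<Rightarrow> real \<Rightarrow> real \<Rightarrow> real \<Rightarrow> st \<Rightarrow> st" where
  "A1 l \<rho> Iw EI GJ \<eta>\<omega> \<eta>\<phi> k1 k2 \<epsilon>1 \<epsilon>2 X =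
     (case (SOME W. DA1_wit l EI GJ \<eta>\<omega> \<eta>\<phi> k1 k2 \<epsilon>1 \<epsilon>2 X W) of (g',z',M,Q) \<Rightarrow>
        (g', \<lambda>y. - d2 l M y / \<rho> y, z', \<lambda>y. d1 l Q y / Iw y))"

section \<open>C_0-semigroups of contractions (on a space of representatives, N a seminorm)\<close>

definition generates_C0_contraction_semigroup ::
    "st set \<Rightarrow> (st \<Rightarrow> st \<Rightarrow> real) \<Rightarrow> st set \<Rightarrow> (st \<Rightarrow> st) \<Rightarrow> bool" where
  "generates_C0_contraction_semigroup H ip D A \<longleftrightarrow>
    (let N = (\<lambda>X. sqrt (ip X X)) in
     \<exists>T :: real \<Rightarrow> st \<Rightarrow> st.
       (\<forall>t\<ge>0. \<forall>X\<in>H. T t X \<in> H) \<and>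
       (\<forall>t\<ge>0. \<forall>X\<in>H. \<forall>Y\<in>H. \<forall>a b.
           N (sdiff (T t (sadd (sscale a X) (sscale b Y))) (sadd (sscale a (T t X)) (sscale b (T t Y)))) = 0) \<and>
       (\<forall>X\<in>H. N (sdiff (T 0 X) X) = 0) \<and>
       (\<forall>s\<ge>0. \<forall>t\<ge>0. \<forall>X\<in>H. N (sdiff (T (s + t) X) (T s (T t X))) = 0) \<and>
       (\<forall>X\<in>H. ((\<lambda>t. N (sdiff (T t X) X)) \<longlongrightarrow> 0) (at_right 0)) \<and>
       (\<forall>t\<ge>0. \<forall>X\<in>H. N (T t X) \<le> N X) \<and>
       D \<subseteq> H \<and> (\<forall>X\<in>D. A X \<in> H) \<and>
       (\<forall>X\<in>H. X \<in> D \<longleftrightarrow>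
          (\<exists>Y\<in>H. ((\<lambda>t. N (sdiff (sscale (1/t) (sdiff (T t X) X)) Y)) \<longlongrightarrow> 0) (at_right 0))) \<and>
       (\<forall>X\<in>D. ((\<lambda>t. N (sdiff (sscale (1/t) (sdiff (T t X) X)) (A X))) \<longlongrightarrow> 0) (at_right 0)))"

definition dense_in_wrt :: "st set \<Rightarrow> st set \<Rightarrow> (st \<Rightarrow> st \<Rightarrow> real) \<Rightarrow> bool" where
  "dense_in_wrt D H ip \<longleftrightarrow> D \<subseteq> H \<and>
     (\<forall>X\<in>H. \<forall>e>0. \<exists>Y\<in>D. sqrt (ip (sdiff X Y) (sdiff X Y)) < e)"

end

theory Submission
  imports Defs "HOL-Library.Function_Algebras"
begin

text \<open>Bending and torsion decouple and have the same shape: with a suitable spatial derivative \<open>Dv\<close>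
  (order two, resp. one) the system is \<open>f' = g\<close>, \<open>r g' = m\<close>, where \<open>m\<close> is the (negative) divergence of the
  stress \<open>a (Dv f + \<eta> Dv g)\<close>. The sharp Poincare inequality makes the perturbed inner product equivalent to the
  energy when \<open>\<epsilon> < 1 / K\<^sub>m\<close>, and the operator dissipative when \<open>\<epsilon> < \<epsilon>\<^sup>*\<close>. Eliminating \<open>f\<close>, the resolvent
  equation becomes a bounded symmetric coercive equation for \<open>Dv g\<close> in \<open>L\<^sup>2\<close>. A dissipative operator whose
  resolvent equations are all solvable is densely defined in a Hilbert space and generates a contraction semigroup,
  namely the limit of the backward Euler iterates \<open>J\<^sub>1\<^sub>/\<^sub>n\<close> composed \<open>\<lfloor>t n\<rfloor>\<close> times, which converge
  by Kobayashi's inequality. Everything is done with representatives and a semi-inner product, so identities hold up to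
  vectors of norm zero and operators are treated as relations.\<close>

text \<open>The damping makes only the combined stress regular: \<open>Dv f\<close> and
  \<open>Dv g\<close> taken separately are merely L2. Every estimate therefore goes through one weak
  identity, the stress tested against an element of \<open>V\<close>. The \<epsilon>-terms in the
  boundary conditions are what turns the boundary work, measured in the perturbed inner product,
  into minus a perfect square. Taking \<open>w = Dv g\<close> as the unknown keeps the resolvent
  equation inside L2: its leading coefficient \<open>t * a + \<eta> * a\<close> is bounded below by
  a positive constant, while inertia and boundary feedback become bounded nonnegative forms in
  \<open>w\<close>. The same argument works for each step size, which matters because the Euler
  scheme calls for resolvents of arbitrarily small step. The derivatives \<open>d1\<close> and
  \<open>d2\<close> and the operator itself are defined by choice and are determined only up to null
  sets; hence the relation has to be invariant under null changes and single-valued at 0, and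
  density of the domain rests on the latter.\<close>

instantiation "fun" :: (type, scaleR) scaleR
begin
definition scaleR_fun_def: "c *\<^sub>R f = (\<lambda>x. c *\<^sub>R f x)"
instance ..
end

instance "fun" :: (type, real_vector) real_vector
  by standard (simp_all add: scaleR_fun_def fun_eq_iff scaleR_add_right scaleR_add_left)

lemma scaleR_fun_apply [simp]: "(c *\<^sub>R f) x = c *\<^sub>R f x"
  by (simp add: scaleR_fun_def)

section \<open>Semi-inner product spaces\<close>

locale semi_inner =
  fixes H :: "'a::real_vector set" and ip :: "'a \<Rightarrow> 'a \<Rightarrow> real"
  assumes H_subspace: "subspace H"
    and ip_sym: "x \<in> H \<Longrightarrow> y \<in> H \<Longrightarrow> ip x y = ip y x"
    and ip_add_left: "x \<in> H \<Longrightarrow> y \<in> H \<Longrightarrow> z \<in> H \<Longrightarrow> ip (x + y) z = ip x z + ip y z"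
    and ip_scale_left: "x \<in> H \<Longrightarrow> z \<in> H \<Longrightarrow> ip (c *\<^sub>R x) z = c * ip x z"
    and ip_nonneg: "x \<in> H \<Longrightarrow> 0 \<le> ip x x"
begin

definition N :: "'a \<Rightarrow> real" where "N x = sqrt (ip x x)"

lemma H_zero [simp]: "0 \<in> H" using H_subspace subspace_0 by blast
lemma H_add [simp]: "x \<in> H \<Longrightarrow> y \<in> H \<Longrightarrow> x + y \<in> H" using H_subspace subspace_add by blast
lemma H_scale [simp]: "x \<in> H \<Longrightarrow> c *\<^sub>R x \<in> H" using H_subspace subspace_scale by blast
lemma H_diff [simp]: "x \<in> H \<Longrightarrow> y \<in> H \<Longrightarrow> x - y \<in> H" using H_subspace subspace_diff by blast
lemma H_minus [simp]: "x \<in> H \<Longrightarrow> - x \<in> H" using H_subspace subspace_neg by blast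

lemma ip_add_right: "x \<in> H \<Longrightarrow> y \<in> H \<Longrightarrow> z \<in> H \<Longrightarrow> ip z (x + y) = ip z x + ip z y"
  by (metis H_add ip_add_left ip_sym)
lemma ip_scale_right: "x \<in> H \<Longrightarrow> z \<in> H \<Longrightarrow> ip z (c *\<^sub>R x) = c * ip z x"
  by (metis H_scale ip_scale_left ip_sym)
lemma ip_minus_left: "x \<in> H \<Longrightarrow> z \<in> H \<Longrightarrow> ip (- x) z = - ip x z"
  using ip_scale_left[of x z "-1"] by simp
lemma ip_minus_right: "x \<in> H \<Longrightarrow> z \<in> H \<Longrightarrow> ip z (- x) = - ip z x"
  using ip_scale_right[of x z "-1"] by simp
lemma ip_diff_left: "x \<in> H \<Longrightarrow> y \<in> H \<Longrightarrow> z \<in> H \<Longrightarrow> ip (x - y) z = ip x z - ip y z"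
  using ip_add_left[of x "- y" z] by (simp add: ip_minus_left)
lemma ip_diff_right: "x \<in> H \<Longrightarrow> y \<in> H \<Longrightarrow> z \<in> H \<Longrightarrow> ip z (x - y) = ip z x - ip z y"
  using ip_add_right[of x "- y" z] by (simp add: ip_minus_right)
lemmas ip_simps = ip_add_left ip_add_right ip_scale_left ip_scale_right
  ip_minus_left ip_minus_right ip_diff_left ip_diff_right

lemma N_nonneg [simp]: "x \<in> H \<Longrightarrow> 0 \<le> N x"
  by (simp add: N_def ip_nonneg)
lemma N_sq: "x \<in> H \<Longrightarrow> (N x)^2 = ip x x"
  by (simp add: N_def ip_nonneg)

lemma N_le_zero_iff [simp]: "x \<in> H \<Longrightarrow> N x \<le> 0 \<longleftrightarrow> N x = 0"
  using N_nonneg[of x] by linarith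

lemma N_zero [simp]: "N 0 = 0"
  using ip_scale_left[of 0 0 0] by (simp add: N_def)

lemma N_scale: "x \<in> H \<Longrightarrow> N (c *\<^sub>R x) = \<bar>c\<bar> * N x"
  by (simp add: N_def ip_simps real_sqrt_mult flip: mult.assoc)
lemma N_minus: "x \<in> H \<Longrightarrow> N (- x) = N x"
  using N_scale[of x "-1"] by simp
lemma N_diff_commute: "x \<in> H \<Longrightarrow> y \<in> H \<Longrightarrow> N (x - y) = N (y - x)"
  using N_minus[of "x - y"] by simp

text \<open>The usual discriminant argument, with a separate case because a vector of norm zero need
  not be zero.\<close>

lemma Cauchy_Schwarz:
  assumes "x \<in> H" "y \<in> H"
  shows "\<bar>ip x y\<bar> \<le> N x * N y"
proof -
  have pos: "0 \<le> ip x x + 2 * t * ip x y + t^2 * ip y y" for t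
    using ip_nonneg[of "x + t *\<^sub>R y"] assms
    by (simp add: ip_simps ip_sym[of y x] power2_eq_square algebra_simps)
  have "(ip x y)^2 \<le> ip x x * ip y y"
  proof (cases "ip y y = 0")
    case True
    have "ip x y = 0"
    proof (rule ccontr)
      assume "ip x y \<noteq> 0"
      \<comment> \<open>With \<open>ip y y = 0\<close> the quadratic is affine in \<open>t\<close>,
        and this \<open>t\<close> gives it the value -1.\<close>
      then show False
        using pos[of "- (ip x x + 1) / (2 * ip x y)"] True by (simp add: field_simps)
    qed
    then show ?thesis using True by simp
  next
    case False
    then have "0 < ip y y" using ip_nonneg[OF assms(2)] by simp
    then show ?thesis
      using pos[of "- ip x y / ip y y"] by (simp add: power2_eq_square field_simps)
  qed
  then have "(ip x y)^2 \<le> (N x * N y)^2"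
    by (simp add: power_mult_distrib N_sq assms)
  then show ?thesis
    using abs_le_square_iff[of "ip x y" "N x * N y"] assms by simp
qed

lemma N_triangle:
  assumes "x \<in> H" "y \<in> H"
  shows "N (x + y) \<le> N x + N y"
proof -
  have "(N (x + y))^2 = (N x)^2 + 2 * ip x y + (N y)^2"
    using assms by (simp add: N_sq ip_simps ip_sym[of y x])
  also have "\<dots> \<le> (N x + N y)^2"
    using Cauchy_Schwarz[OF assms] by (simp add: power2_sum)
  finally show ?thesis
    using assms by (meson N_nonneg add_nonneg_nonneg power2_le_imp_le)
qed

lemma N_triangle_diff: "x \<in> H \<Longrightarrow> y \<in> H \<Longrightarrow> N (x - y) \<le> N x + N y"
  using N_triangle[of x "- y"] by (simp add: N_minus)

lemma N_triangle3:
  assumes "x \<in> H" "y \<in> H" "z \<in> H"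
  shows "N (x - z) \<le> N (x - y) + N (y - z)"
  using N_triangle[of "x - y" "y - z"] assms by simp

lemma N_rev_triangle:
  assumes "x \<in> H" "y \<in> H"
  shows "\<bar>N x - N y\<bar> \<le> N (x - y)"
  using N_triangle[of "x - y" y] N_triangle[of "y - x" x] assms N_diff_commute[of x y] by simp

lemma N_sq_diff_scale:
  assumes "x \<in> H" "y \<in> H"
  shows "(N (x - c *\<^sub>R y))^2 = (N x)^2 - 2 * c * ip y x + c^2 * (N y)^2"
  using assms ip_sym[OF assms] by (simp add: N_sq ip_simps power2_eq_square[of c] algebra_simps)

lemma N_cong: "x \<in> H \<Longrightarrow> y \<in> H \<Longrightarrow> N (x - y) = 0 \<Longrightarrow> N x = N y"
  using N_rev_triangle[of x y] by simp

text \<open>Cauchy-Schwarz, then cancel one factor \<open>N x\<close>. Dissipativity always delivers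
  its norm bounds in this shape.\<close>

lemma N_le_of_ip:
  assumes "x \<in> H" "y \<in> H" "ip x x \<le> ip y x"
  shows "N x \<le> N y"
proof -
  have "N x * N x \<le> N y * N x"
    using Cauchy_Schwarz[OF assms(2,1)] assms(3) N_sq[OF assms(1)] by (simp add: power2_eq_square)
  then show ?thesis
    using assms(1,2) N_nonneg[OF assms(1)] N_nonneg[OF assms(2)]
    by (cases "N x = 0") (auto simp: mult_le_cancel_right)
qed

lemma N_tendsto_unique:
  assumes "x \<in> H" "y \<in> H" "F \<noteq> bot" "\<And>i. X i \<in> H"
    and "((\<lambda>i. N (X i - x)) \<longlongrightarrow> 0) F" "((\<lambda>i. N (X i - y)) \<longlongrightarrow> 0) F"
  shows "N (x - y) = 0"
proof -
  have "((\<lambda>i. N (X i - x) + N (X i - y)) \<longlongrightarrow> 0 + 0) F"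
    by (intro tendsto_add assms)
  moreover have "N (x - y) \<le> N (X i - x) + N (X i - y)" for i
    using N_triangle3[of x "X i" y] N_diff_commute[of x "X i"] assms by simp
  ultimately have "N (x - y) \<le> 0"
    using assms(3) by (intro tendsto_lowerbound[where F = F]) auto
  then show ?thesis using assms by (simp add: order_antisym)
qed

lemma N_tendsto:
  assumes "x \<in> H" "\<And>i. X i \<in> H" "((\<lambda>i. N (X i - x)) \<longlongrightarrow> 0) F"
  shows "((\<lambda>i. N (X i)) \<longlongrightarrow> N x) F"
proof -
  have "((\<lambda>i. N (X i) - N x) \<longlongrightarrow> 0) F"
    by (rule Lim_null_comparison[OF _ assms(3)]) (use N_rev_triangle assms in "auto intro!: always_eventually")
  then show ?thesis by (simp add: LIM_zero_iff)
qed

end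

section \<open>Completeness: orthogonal residuals and coercive equations\<close>

locale semi_hilbert = semi_inner +
  assumes complete: "(\<And>n. X n \<in> H) \<Longrightarrow>
      (\<And>e. e > 0 \<Longrightarrow> \<exists>M. \<forall>m\<ge>M. \<forall>n\<ge>M. N (X m - X n) < e) \<Longrightarrow>
      \<exists>L\<in>H. (\<lambda>n::nat. N (X n - L)) \<longlonglongrightarrow> 0"
begin

text \<open>A minimising sequence for the distance from \<open>y\<close> to \<open>D\<close> is Cauchy by the parallelogram law.\<close>

lemma orthogonal_residual:
  assumes D: "subspace D" "D \<subseteq> H" and y: "y \<in> H"
  obtains p W where "p \<in> H" "\<And>n. W n \<in> D" "(\<lambda>n::nat. N (W n - p)) \<longlonglongrightarrow> 0"
    "\<And>v. v \<in> D \<Longrightarrow> ip (y - p) v = 0"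
proof -
  define d where "d = (INF w\<in>D. (N (y - w))^2)"
  have ne: "D \<noteq> {}" using D(1) subspace_0 by blast
  have bdd: "bdd_below ((\<lambda>w. (N (y - w))^2) ` D)" by (rule bdd_belowI[of _ 0]) auto
  have d_le: "d \<le> (N (y - w))^2" if "w \<in> D" for w
    unfolding d_def using bdd that by (rule cINF_lower)
  have "\<exists>w\<in>D. (N (y - w))^2 < d + e" if "e > 0" for e
    using cINF_less_iff[OF ne bdd, of "d + e"] that unfolding d_def by simp
  then have "\<forall>n::nat. \<exists>w\<in>D. (N (y - w))^2 < d + inverse (real (Suc n))" by simp
  then obtain W where W: "\<And>n. W n \<in> D" "\<And>n. (N (y - W n))^2 < d + inverse (real (Suc n))" by metis
  have WH [simp]: "W n \<in> H" for n using W(1) D(2) by blast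
  \<comment> \<open>The midpoint \<open>q\<close> lies in \<open>D\<close>, so its distance to
    \<open>y\<close> is at least the infimum; the parallelogram law then leaves only the two
    excesses.\<close>
  have par: "(N (W m - W n))^2 \<le> 2 * inverse (real (Suc m)) + 2 * inverse (real (Suc n))" for m n
  proof -
    define q where "q = (1/2) *\<^sub>R (W m + W n)"
    have qD: "q \<in> D" unfolding q_def using D(1) W(1) by (simp add: subspace_add subspace_scale)
    have qH: "q \<in> H" using qD D(2) by blast
    have "(N (W m - W n))^2 + 4 * (N (y - q))^2 = 2 * (N (y - W m))^2 + 2 * (N (y - W n))^2"
      using y qH unfolding q_def
      by (simp add: N_sq ip_simps ip_sym[of "W m" y] ip_sym[of "W n" y] ip_sym[of "W m" "W n"] algebra_simps)
    then show ?thesis using d_le[OF qD] W(2)[of m] W(2)[of n] by simp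
  qed
  have "\<exists>M. \<forall>m\<ge>M. \<forall>n\<ge>M. N (W m - W n) < e" if "e > 0" for e
  proof -
    obtain M where M: "inverse (real (Suc M)) < e^2 / 4"
      using reals_Archimedean[of "e^2/4"] \<open>e > 0\<close> by auto
    have "N (W m - W n) < e" if "m \<ge> M" "n \<ge> M" for m n
    proof -
      have "inverse (real (Suc m)) \<le> inverse (real (Suc M))" "inverse (real (Suc n)) \<le> inverse (real (Suc M))"
        using that by (auto intro!: le_imp_inverse_le)
      then have "(N (W m - W n))^2 < e^2" using par[of m n] M by linarith
      then show ?thesis using \<open>e > 0\<close> by (simp add: power_less_imp_less_base)
    qed
    then show ?thesis by blast
  qed
  then obtain p where p: "p \<in> H" "(\<lambda>n. N (W n - p)) \<longlonglongrightarrow> 0"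
    using complete[of W] by auto
  have "ip (y - p) v = 0" if v: "v \<in> D" for v
  proof -
    have vH: "v \<in> H" using v D(2) by blast
    have lim: "(\<lambda>n. N (y - W n)) \<longlonglongrightarrow> N (y - p)"
      using N_tendsto[of "y - p" "\<lambda>n. y - W n" sequentially] p y N_diff_commute[of p] by simp
    have "d + inverse (real (Suc n)) \<ge> (N (y - W n))^2" for n using W(2)[of n] by simp
    then have "(N (y - p))^2 \<le> d + 0"
      by (intro LIMSEQ_le[OF tendsto_power[OF lim] tendsto_add[OF tendsto_const LIMSEQ_inverse_real_of_nat]]) auto
    \<comment> \<open>The limit \<open>p\<close> need not lie in \<open>D\<close>; minimality is
      tested at \<open>W n + t *\<^sub>R v\<close>, which does, and passed to the limit.\<close>
    moreover have "d \<le> (N (y - p - t *\<^sub>R v))^2" for t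
    proof -
      have "(\<lambda>n. N (y - (W n + t *\<^sub>R v))) \<longlonglongrightarrow> N (y - p - t *\<^sub>R v)"
        using N_tendsto[of "y - p - t *\<^sub>R v" "\<lambda>n. y - (W n + t *\<^sub>R v)" sequentially] p y vH N_diff_commute[of p] by simp
      then show ?thesis
        by (intro LIMSEQ_le[OF tendsto_const tendsto_power])
          (use d_le D(1) W(1) v in "auto simp: subspace_add subspace_scale")
    qed
    ultimately have ineq: "0 \<le> - 2 * t * ip (y - p) v + t^2 * ip v v" for t
    proof -
      have "(N (y - p))^2 \<le> (N (y - p - t *\<^sub>R v))^2"
        using \<open>(N (y - p))^2 \<le> d + 0\<close> \<open>\<And>t. d \<le> (N (y - p - t *\<^sub>R v))^2\<close>[of t] by simp
      then show ?thesis
        using N_sq_diff_scale[of "y - p" v t] y p(1) vH ip_sym[of v "y - p"] N_sq[OF vH] by simp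
    qed
    \<comment> \<open>First-order condition. If \<open>v\<close> is null, the inequality is linear
      in \<open>t\<close> and both signs are used; otherwise \<open>t\<close> is the minimiser of
      the quadratic.\<close>
    show ?thesis
    proof (cases "ip v v = 0")
      case True
      then show ?thesis using ineq[of 1] ineq[of "-1"] by simp
    next
      case False
      then have "0 < ip v v" using ip_nonneg[OF vH] by simp
      then have "(ip (y - p) v)^2 \<le> 0"
        using ineq[of "ip (y - p) v / ip v v"] by (simp add: power2_eq_square field_simps)
      then show ?thesis by simp
    qed
  qed
  then show ?thesis using that p W(1) by blast
qed

text \<open>Lax--Milgram: \<open>u \<mapsto> u - \<tau> (S u - r)\<close> is a strict contraction for small \<open>\<tau>\<close>.\<close>

lemma coercive_surj:
  assumes S_H: "\<And>u. u \<in> H \<Longrightarrow> S u \<in> H"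
    and S_diff: "\<And>u v. u \<in> H \<Longrightarrow> v \<in> H \<Longrightarrow> N (S u - S v - S (u - v)) = 0"
    and bnd: "\<And>u. u \<in> H \<Longrightarrow> N (S u) \<le> C * N u"
    and coer: "\<And>u. u \<in> H \<Longrightarrow> a * (N u)^2 \<le> ip (S u) u" and "a > 0"
    and r: "r \<in> H"
  obtains u where "u \<in> H" "N (S u - r) = 0"
proof -
  \<comment> \<open>Enlarging the bound forces \<open>a < C'\<close>, so that the contraction factor
    below is the root of a positive number.\<close>
  define C' where "C' = max C (a + 1)"
  have C': "C' > 0" "a < C'"
    using \<open>a > 0\<close> by (auto simp: C'_def)
  have bnd': "N (S u) \<le> C' * N u" if "u \<in> H" for u
    by (rule order_trans[OF bnd[OF that] mult_right_mono]) (use that in "auto simp: C'_def")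
  \<comment> \<open>This \<open>\<tau>\<close> minimises
    \<open>1 - 2 * \<tau> * a + \<tau>^2 * C'^2\<close>, the bound for the squared contraction
    factor; the minimum is \<open>1 - a^2 / C'^2\<close>.\<close>
  define \<tau> where "\<tau> = a / C'^2"
  have \<tau>: "\<tau> \<ge> 0" using \<open>a > 0\<close> by (simp add: \<tau>_def)
  define q where "q = sqrt (1 - a^2 / C'^2)"
  have "a^2 < C'^2" using C' \<open>a > 0\<close> by (simp add: power_strict_mono)
  then have q: "0 \<le> q" "q < 1" "q^2 = 1 - a^2 / C'^2"
    unfolding q_def using C' \<open>a > 0\<close> by (auto simp: field_simps)
  define \<Phi> where "\<Phi> u = u - \<tau> *\<^sub>R (S u - r)" for u
  have \<Phi>H [simp]: "\<Phi> u \<in> H" if "u \<in> H" for u using that S_H r by (simp add: \<Phi>_def)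
  have contr: "N (\<Phi> u - \<Phi> v) \<le> q * N (u - v)" if uv: "u \<in> H" "v \<in> H" for u v
  proof -
    define w where "w = u - v"
    have w: "w \<in> H" using uv by (simp add: w_def)
    \<comment> \<open>\<open>S\<close> respects differences only up to a null vector, so the two
      expressions have equal norm without being equal.\<close>
    have "N ((\<Phi> u - \<Phi> v) - (w - \<tau> *\<^sub>R S w)) = 0"
    proof -
      have "(\<Phi> u - \<Phi> v) - (w - \<tau> *\<^sub>R S w) = (- \<tau>) *\<^sub>R (S u - S v - S (u - v))"
        by (simp add: \<Phi>_def w_def algebra_simps)
      moreover have "S u - S v - S (u - v) \<in> H" using S_H uv by (intro H_diff) auto
      ultimately show ?thesis using N_scale[of "S u - S v - S (u - v)" "- \<tau>"] S_diff[OF uv] by simp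
    qed
    then have eq: "N (\<Phi> u - \<Phi> v) = N (w - \<tau> *\<^sub>R S w)"
      by (intro N_cong) (use uv w S_H in auto)
    have "(N (w - \<tau> *\<^sub>R S w))^2 = (N w)^2 - 2 * \<tau> * ip (S w) w + \<tau>^2 * (N (S w))^2"
      by (rule N_sq_diff_scale[OF w S_H[OF w]])
    also have "\<dots> \<le> (N w)^2 - 2 * \<tau> * (a * (N w)^2) + \<tau>^2 * (C' * N w)^2"
    proof -
      have "2 * \<tau> * (a * (N w)^2) \<le> 2 * \<tau> * ip (S w) w"
        using coer[OF w] \<tau> by (intro mult_left_mono) auto
      moreover have "\<tau>^2 * (N (S w))^2 \<le> \<tau>^2 * (C' * N w)^2"
        using bnd'[OF w] S_H[OF w] by (intro mult_left_mono power_mono) auto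
      ultimately show ?thesis by linarith
    qed
    also have "\<dots> = (q * N w)^2"
      unfolding power_mult_distrib q(3) using C'(1) by (simp add: \<tau>_def power2_eq_square field_simps)
    finally show ?thesis unfolding eq w_def[symmetric]
      by (rule power2_le_imp_le) (use q w in auto)
  qed
  define U where "U n = (\<Phi> ^^ n) 0" for n :: nat
  have U_Suc: "U (Suc n) = \<Phi> (U n)" for n by (simp add: U_def)
  have UH [simp]: "U n \<in> H" for n by (induction n) (auto simp: U_Suc, simp add: U_def)
  define k where "k = N (U 1 - U 0)"
  have step: "N (U (Suc n) - U n) \<le> q ^ n * k" for n
  proof (induction n)
    case 0 then show ?case by (simp add: k_def)
  next
    case (Suc n)
    have "N (U (Suc (Suc n)) - U (Suc n)) \<le> q * N (U (Suc n) - U n)"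
      unfolding U_Suc[of "Suc n"] U_Suc[of n] by (rule contr) (simp_all flip: U_Suc)
    also have "\<dots> \<le> q * (q ^ n * k)" using Suc q by (intro mult_left_mono)
    finally show ?case by simp
  qed
  have tail: "N (U (n + j) - U n) \<le> q ^ n * k / (1 - q)" for n j
  proof -
    have "N (U (n + j) - U n) \<le> (\<Sum>i<j. q ^ (n + i) * k)"
    proof (induction j)
      case (Suc j)
      have "N (U (n + Suc j) - U n) \<le> N (U (Suc (n + j)) - U (n + j)) + N (U (n + j) - U n)"
        using N_triangle3[of "U (n + Suc j)" "U (n + j)" "U n"] by simp
      then show ?case using Suc step[of "n + j"] by simp
    qed simp
    also have "\<dots> = q ^ n * k * (\<Sum>i<j. q ^ i)" by (simp add: power_add sum_distrib_left mult_ac)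
    also have "\<dots> \<le> q ^ n * k * (1 / (1 - q))"
    proof (intro mult_left_mono)
      show "(\<Sum>i<j. q ^ i) \<le> 1 / (1 - q)" using q by (simp add: sum_gp_strict divide_right_mono)
      show "0 \<le> q ^ n * k" using q UH by (simp add: k_def)
    qed
    finally show ?thesis by simp
  qed
  have "(\<lambda>n. q ^ n * k / (1 - q)) \<longlonglongrightarrow> 0 * k / (1 - q)"
    using q by (intro tendsto_intros LIMSEQ_power_zero) auto
  then have lim0: "(\<lambda>n. q ^ n * k / (1 - q)) \<longlonglongrightarrow> 0" by simp
  have "\<exists>M. \<forall>m\<ge>M. \<forall>n\<ge>M. N (U m - U n) < e" if "e > 0" for e
  proof -
    obtain M where M: "q ^ M * k / (1 - q) < e / 2"
      using order_tendstoD(2)[OF lim0, of "e / 2"] \<open>e > 0\<close> by (auto simp: eventually_sequentially)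
    have "N (U m - U n) < e" if "m \<ge> M" "n \<ge> M" for m n
      using N_triangle3[of "U m" "U M" "U n", OF UH UH UH] tail[of M "m - M"] tail[of M "n - M"] that M
        N_diff_commute[of "U M" "U n", OF UH UH] unfolding le_add_diff_inverse[OF that(1)] le_add_diff_inverse[OF that(2)]
      by linarith
    then show ?thesis by blast
  qed
  then obtain u where u: "u \<in> H" "(\<lambda>n. N (U n - u)) \<longlonglongrightarrow> 0"
    using complete[of U] by auto
  have "(\<lambda>n. q * N (U n - u)) \<longlonglongrightarrow> 0" using tendsto_mult_right_zero[OF u(2)] by simp
  then have "(\<lambda>n. N (U (Suc n) - \<Phi> u)) \<longlonglongrightarrow> 0"
    by (rule Lim_null_comparison[rotated]) (use contr u N_nonneg in "auto simp: U_Suc")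
  moreover have "(\<lambda>n. N (U (Suc n) - u)) \<longlonglongrightarrow> 0" using u(2) by (rule LIMSEQ_Suc)
  ultimately have "N (u - \<Phi> u) = 0"
    using N_tendsto_unique[of u "\<Phi> u" sequentially "\<lambda>n. U (Suc n)"] u by simp
  then have "\<tau> * N (S u - r) = 0"
    using u r S_H \<open>a > 0\<close> C'(1) by (simp add: \<Phi>_def N_scale \<tau>_def)
  then show ?thesis using that u(1) \<open>a > 0\<close> C'(1) by (auto simp: \<tau>_def)
qed

end

lemma tendsto_0_squeeze:
  fixes f g :: "'b \<Rightarrow> real"
  assumes "(g \<longlongrightarrow> c) F" "\<And>n. f n \<le> g n" "c = 0" "\<And>n. 0 \<le> f n"
  shows "(f \<longlongrightarrow> 0) F"
  by (rule tendsto_sandwich[OF _ _ tendsto_const]) (use assms in auto)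

section \<open>Contraction semigroups of maximal dissipative relations\<close>

text \<open>Concavity of the square root with weights \<mu> and \<open>h\<close>; the defect in the
  squares is the variance term \<open>h * \<mu> * (sqrt a - sqrt b)^2\<close>. It closes the
  induction in \<open>kobayashi\<close>.\<close>

lemma two_point_sqrt_concave:
  fixes a b c h \<mu> :: real
  assumes "h > 0" "\<mu> > 0" "a \<ge> 0" "b \<ge> 0" "\<mu> * a + h * b = (h + \<mu>) * c"
  shows "\<mu> * sqrt a + h * sqrt b \<le> (h + \<mu>) * sqrt c"
proof -
  have "0 \<le> (h + \<mu>) * c" using assms by (metis add_nonneg_nonneg less_imp_le mult_nonneg_nonneg)
  then have c: "c \<ge> 0" using assms by (simp add: zero_le_mult_iff)
  have "(\<mu> * sqrt a + h * sqrt b)^2 + h * \<mu> * (sqrt a - sqrt b)^2 = (h + \<mu>) * (\<mu> * (sqrt a)^2 + h * (sqrt b)^2)"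
    by (simp add: power2_eq_square algebra_simps)
  also have "\<dots> = ((h + \<mu>) * sqrt c)^2" using assms c by (simp add: power_mult_distrib power2_eq_square)
  finally have "(\<mu> * sqrt a + h * sqrt b)^2 \<le> ((h + \<mu>) * sqrt c)^2"
    using assms by (smt (verit) mult_nonneg_nonneg zero_le_power2)
  then show ?thesis by (rule power2_le_imp_le) (use assms c in auto)
qed

text \<open>The relation \<open>G x y\<close> plays the role of \<open>y = A x\<close>, up to vectors of norm zero.\<close>

locale m_dissipative = semi_hilbert H ip for H :: "'a::real_vector set" and ip +
  fixes G :: "'a \<Rightarrow> 'a \<Rightarrow> bool"
  assumes G_H: "G x y \<Longrightarrow> x \<in> H \<and> y \<in> H"
    and G_lin: "G x y \<Longrightarrow> G x' y' \<Longrightarrow> G (a *\<^sub>R x + b *\<^sub>R x') (a *\<^sub>R y + b *\<^sub>R y')"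
    and G_cong: "G x y \<Longrightarrow> x' \<in> H \<Longrightarrow> y' \<in> H \<Longrightarrow> N (x - x') = 0 \<Longrightarrow> N (y - y') = 0 \<Longrightarrow> G x' y'"
    and G_single: "G 0 y \<Longrightarrow> N y = 0"
    and G_diss: "G x y \<Longrightarrow> ip y x \<le> 0"
    and G_range: "h > 0 \<Longrightarrow> y \<in> H \<Longrightarrow> \<exists>x. G x ((1 / h) *\<^sub>R (x - y))"
begin

section \<open>Resolvents and their iterates\<close>

lemma G_add: "G x y \<Longrightarrow> G x' y' \<Longrightarrow> G (x + x') (y + y')"
  using G_lin[of x y x' y' 1 1] by simp

lemma G_diff: "G x y \<Longrightarrow> G x' y' \<Longrightarrow> G (x - x') (y - y')"
  using G_lin[of x y x' y' 1 "-1"] by simp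

lemma G_scale: "G x y \<Longrightarrow> G (c *\<^sub>R x) (c *\<^sub>R y)"
  using G_lin[of x y x y c 0] by simp

text \<open>The resolvent of the relation, that is one backward Euler step of size \<open>h\<close>:
  the new state minus \<open>h\<close> times its image is \<open>y\<close>. It is fixed only up to a
  null vector.\<close>

definition J :: "real \<Rightarrow> 'a \<Rightarrow> 'a" where "J h y = (SOME x. G x ((1 / h) *\<^sub>R (x - y)))"

lemma J_G: "h > 0 \<Longrightarrow> y \<in> H \<Longrightarrow> G (J h y) ((1 / h) *\<^sub>R (J h y - y))"
  unfolding J_def by (rule someI_ex) (rule G_range)

lemma J_H [simp]: "h > 0 \<Longrightarrow> y \<in> H \<Longrightarrow> J h y \<in> H"
  using J_G G_H by blast

text \<open>Dissipativity, paired with the solution \<open>x\<close>, says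
  \<open>ip x x \<le> ip y x\<close>. Contractivity, uniqueness and the step estimate all come from
  applying this to suitable differences.\<close>

lemma resolvent_bound:
  assumes "G x ((1 / h) *\<^sub>R (x - y))" "h > 0" "y \<in> H"
  shows "N x \<le> N y"
proof -
  have x: "x \<in> H" using G_H assms(1) by blast
  have "(1 / h) * (ip x x - ip y x) \<le> 0"
    using G_diss[OF assms(1)] x assms(3) by (simp add: ip_simps)
  then show ?thesis using x assms by (intro N_le_of_ip) (auto simp: field_simps)
qed

lemma J_contr:
  assumes "h > 0" "y \<in> H" "y' \<in> H"
  shows "N (J h y - J h y') \<le> N (y - y')"
proof (rule resolvent_bound[OF _ assms(1)])
  show "G (J h y - J h y') ((1 / h) *\<^sub>R (J h y - J h y' - (y - y')))"
    using G_diff[OF J_G J_G, OF assms(1,2) assms(1,3)] by (simp add: algebra_simps)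
qed (use assms in auto)

text \<open>The difference of two solutions solves the resolvent equation with datum 0.\<close>

lemma J_unique:
  assumes "h > 0" "y \<in> H" "G x ((1 / h) *\<^sub>R (x - y))"
  shows "N (J h y - x) = 0"
proof -
  have "N (J h y - x) \<le> N 0"
  proof (rule resolvent_bound[OF _ assms(1)])
    show "G (J h y - x) ((1 / h) *\<^sub>R (J h y - x - 0))"
      using G_diff[OF J_G assms(3), OF assms(1,2)] by (simp add: algebra_simps)
  qed simp
  then show ?thesis using N_nonneg[of "J h y - x"] assms G_H[OF assms(3)] by simp
qed

lemma J_lin:
  assumes "h > 0" "x \<in> H" "y \<in> H"
  shows "N (J h (a *\<^sub>R x + b *\<^sub>R y) - (a *\<^sub>R J h x + b *\<^sub>R J h y)) = 0"
proof (rule J_unique[OF assms(1)])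
  have "(1 / h) *\<^sub>R (a *\<^sub>R J h x + b *\<^sub>R J h y - (a *\<^sub>R x + b *\<^sub>R y)) =
    a *\<^sub>R ((1 / h) *\<^sub>R (J h x - x)) + b *\<^sub>R ((1 / h) *\<^sub>R (J h y - y))"
    by (simp add: algebra_simps)
  then show "G (a *\<^sub>R J h x + b *\<^sub>R J h y) ((1 / h) *\<^sub>R (a *\<^sub>R J h x + b *\<^sub>R J h y - (a *\<^sub>R x + b *\<^sub>R y)))"
    using G_lin[OF J_G J_G, OF assms(1,2) assms(1,3), of a b] by simp
qed (use assms in auto)

abbreviation P :: "real \<Rightarrow> nat \<Rightarrow> 'a \<Rightarrow> 'a" where "P h k \<equiv> J h ^^ k"

lemma P_H [simp]: "h > 0 \<Longrightarrow> y \<in> H \<Longrightarrow> P h k y \<in> H"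
  by (induction k) auto

lemma P_contr:
  assumes "h > 0" "y \<in> H" "y' \<in> H"
  shows "N (P h k y - P h k y') \<le> N (y - y')"
proof (induction k)
  case (Suc k)
  then show ?case using J_contr[OF assms(1), of "P h k y" "P h k y'"] assms by simp
qed simp

lemma P_lin:
  assumes "h > 0" "x \<in> H" "y \<in> H"
  shows "N (P h k (a *\<^sub>R x + b *\<^sub>R y) - (a *\<^sub>R P h k x + b *\<^sub>R P h k y)) = 0"
proof (induction k)
  case (Suc k)
  let ?u = "P h k (a *\<^sub>R x + b *\<^sub>R y)" and ?v = "a *\<^sub>R P h k x + b *\<^sub>R P h k y"
  let ?w = "a *\<^sub>R P h (Suc k) x + b *\<^sub>R P h (Suc k) y"
  have H: "?u \<in> H" "?v \<in> H" "?w \<in> H" using assms by (auto simp del: funpow.simps)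
  have "N (J h ?u - J h ?v) \<le> N (?u - ?v)" using J_contr assms H by blast
  moreover have "N (J h ?v - ?w) = 0" using J_lin[of h "P h k x" "P h k y"] assms by simp
  ultimately have "N (J h ?u - ?w) \<le> 0"
    using N_triangle3[of "J h ?u" "J h ?v" ?w] H assms Suc by simp
  then show ?case using N_nonneg[of "J h ?u - ?w"] H assms by simp
qed simp

text \<open>The increment \<open>J h x - x\<close> itself solves the resolvent equation, with datum
  \<open>h *\<^sub>R w\<close>, so \<open>resolvent_bound\<close> applies to it.\<close>

lemma J_step:
  assumes "h > 0" "G x w"
  shows "N (J h x - x) \<le> h * N w"
proof -
  have H: "x \<in> H" "w \<in> H" using G_H assms by auto
  have "(1 / h) *\<^sub>R (J h x - x) - w = (1 / h) *\<^sub>R (J h x - x - h *\<^sub>R w)"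
    using assms by (simp add: algebra_simps)
  then have "G (J h x - x) ((1 / h) *\<^sub>R (J h x - x - h *\<^sub>R w))"
    using G_diff[OF J_G[OF assms(1) H(1)] assms(2)] by simp
  then have "N (J h x - x) \<le> N (h *\<^sub>R w)"
    by (rule resolvent_bound) (use assms H in auto)
  then show ?thesis using H assms by (simp add: N_scale)
qed

lemma P_Suc_step:
  assumes "h > 0" "x \<in> H"
  shows "N (P h (Suc k) x - P h k x) \<le> N (J h x - x)"
  using P_contr[of h "J h x" x k] assms by (simp add: funpow_swap1)

lemma P_step:
  assumes "h > 0" "G x w"
  shows "N (P h k x - x) \<le> k * h * N w"
proof (induction k)
  case (Suc k)
  have x: "x \<in> H" using G_H assms by auto
  show ?case
    using Suc N_triangle3[of "P h (Suc k) x" "P h k x" x] P_Suc_step[OF assms(1) x, of k] J_step[OF assms] assms x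
    by (simp add: algebra_simps)
qed simp

text \<open>Kobayashi's inequality, by double induction: the radicand at \<open>(i + 1, j + 1)\<close> is exactly the convex combination,
  with weights \<open>\<mu>\<close> and \<open>h\<close>, of the radicands at \<open>(i, j + 1)\<close> and \<open>(i + 1, j)\<close>.\<close>

lemma kobayashi:
  assumes "h > 0" "\<mu> > 0" "G x w"
  shows "N (P h i x - P \<mu> j x) \<le> N w * sqrt ((real i * h - real j * \<mu>)^2 + real i * h^2 + real j * \<mu>^2)"
proof -
  let ?b = "\<lambda>k \<nu>. sqrt ((real k * \<nu>)^2 + real k * \<nu>^2)"
    and ?s = "\<lambda>i j. sqrt ((real i * h - real j * \<mu>)^2 + real i * h^2 + real j * \<mu>^2)"
  have H: "x \<in> H" "w \<in> H" using G_H assms by auto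
  have bd: "N (P \<nu> k x - x) \<le> N w * ?b k \<nu>" if "\<nu> > 0" for \<nu> k
  proof -
    have "real k * \<nu> \<le> ?b k \<nu>"
      by (rule real_le_rsqrt) simp
    then have "N w * (real k * \<nu>) \<le> N w * ?b k \<nu>"
      using H by (intro mult_left_mono) auto
    then show ?thesis using P_step[OF that assms(3), of k] by (simp add: mult_ac)
  qed
  show ?thesis
  proof (induction i arbitrary: j)
    case 0
    then show ?case using bd[OF assms(2), of j] N_diff_commute[of x "P \<mu> j x"] H assms by simp
  next
    case (Suc i)
    note IHi = Suc
    show ?case
    proof (induction j)
      case 0
      then show ?case using bd[OF assms(1), of "Suc i"] by simp
    next
      case (Suc j)
      define u where "u = P h i x" define u' where "u' = P h (Suc i) x"
      define v where "v = P \<mu> j x" define v' where "v' = P \<mu> (Suc j) x"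
      let ?d = "(h + \<mu>) *\<^sub>R (u' - v')" and ?m = "\<mu> *\<^sub>R (u - v') + h *\<^sub>R (u' - v)"
      have uv: "u \<in> H" "u' \<in> H" "v \<in> H" "v' \<in> H"
        unfolding u_def u'_def v_def v'_def using H assms by (auto intro!: P_H simp del: funpow.simps)
      have "G u' ((1 / h) *\<^sub>R (u' - u))" "G v' ((1 / \<mu>) *\<^sub>R (v' - v))"
        using J_G[of h u] J_G[of \<mu> v] uv assms by (simp_all add: u_def u'_def v_def v'_def)
      \<comment> \<open>Subtract the two Euler steps and pair with \<open>u' - v'\<close>. Cleared
        of denominators, this compares the last pair \<open>(u', v')\<close> with the two pairs in
        which one scheme is a step behind, with weights \<mu> and \<open>h\<close>.\<close>
      from G_diss[OF G_diff[OF this]]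
      have "(1 / h) * ip (u' - u) (u' - v') - (1 / \<mu>) * ip (v' - v) (u' - v') \<le> 0"
        using uv by (simp only: ip_scale_left ip_diff_left H_diff H_scale)
      moreover have "ip (u' - u) (u' - v') = ip (u' - v') (u' - v') - ip (u - v') (u' - v')"
        using uv by (simp add: ip_simps)
      moreover have "ip (v' - v) (u' - v') = ip (u' - v) (u' - v') - ip (u' - v') (u' - v')"
        using uv by (simp add: ip_simps)
      ultimately have "(h + \<mu>) * ip (u' - v') (u' - v') \<le> \<mu> * ip (u - v') (u' - v') + h * ip (u' - v) (u' - v')"
        using assms(1,2) by (simp add: field_simps)
      also have "\<dots> = ip ?m (u' - v')"
        using uv by (simp add: ip_simps algebra_simps)
      also have "(h + \<mu>) * ip (u' - v') (u' - v') = (1 / (h + \<mu>)) * ip ?d ?d"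
        using uv assms by (simp only: ip_scale_left ip_scale_right H_diff H_scale) (simp add: field_simps)
      finally have "ip ?d ?d \<le> ip ?m ?d"
        using uv assms by (simp only: ip_scale_right H_diff H_scale H_add) (simp add: field_simps)
      then have "N ?d \<le> N ?m"
        using uv by (intro N_le_of_ip) auto
      also have "\<dots> \<le> \<mu> * N (u - v') + h * N (u' - v)"
        using N_triangle[of "\<mu> *\<^sub>R (u - v')" "h *\<^sub>R (u' - v)"] uv assms by (simp only: N_scale H_diff H_scale) simp
      also have "\<dots> \<le> \<mu> * (N w * ?s i (Suc j))
        + h * (N w * ?s (Suc i) j)"
        using IHi[of "Suc j"] Suc assms unfolding u_def u'_def v_def v'_def
        by (intro add_mono mult_left_mono) simp_all
      also have "\<dots> = N w * (\<mu> * ?s i (Suc j)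
        + h * ?s (Suc i) j)"
        by (simp add: algebra_simps)
      also have "\<dots> \<le> N w * ((h + \<mu>) * ?s (Suc i) (Suc j))"
        using assms(1,2) H
        apply (intro mult_left_mono two_point_sqrt_concave)
             apply simp_all[2]
           apply (auto intro!: add_nonneg_nonneg mult_nonneg_nonneg zero_le_power2 simp del: of_nat_Suc)[2]
         apply (simp add: power2_eq_square algebra_simps)
        apply simp
        done
      also have "N ?d = (h + \<mu>) * N (u' - v')"
        using uv assms by (simp add: N_scale)
      finally show ?case using assms(1,2) unfolding u'_def v'_def
        by (simp only: mult.left_commute[of "N w"] mult_le_cancel_left_pos[OF add_pos_pos])
    qed
  qed
qed

section \<open>Density of the domain\<close>

definition D :: "'a set" where "D = {x. \<exists>y. G x y}"

lemma D_subspace: "subspace D" and D_sub: "D \<subseteq> H"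
proof -
  obtain x where "G x ((1 / 1) *\<^sub>R (x - 0))" using G_range[of 1 0] by auto
  then have "G (0 *\<^sub>R x) (0 *\<^sub>R x)" using G_scale by fastforce
  then have "0 \<in> D" by (auto simp: D_def)
  moreover have "u + v \<in> D" if "u \<in> D" "v \<in> D" for u v
    using that by (auto simp: D_def dest: G_add)
  moreover have "c *\<^sub>R u \<in> D" if "u \<in> D" for u c
    using that by (auto simp: D_def dest: G_scale)
  ultimately show "subspace D" by (rule subspaceI)
  show "D \<subseteq> H" using G_H by (auto simp: D_def)
qed

text \<open>Let \<open>x - p\<close> be the residual orthogonal to \<open>D\<close>, and solve the
  resolvent equation with step 1 and datum \<open>x - p\<close>. The solution \<open>q\<close> lies
  in \<open>D\<close>, so dissipativity gives \<open>ip q q \<le> ip (x - p) q = 0\<close>. Thus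
  \<open>q\<close> is null, the relation takes 0 to \<open>q - (x - p)\<close>, and
  single-valuedness at 0 makes the residual null.\<close>

lemma D_dense:
  assumes "x \<in> H" "e > 0"
  shows "\<exists>v\<in>D. N (x - v) < e"
proof -
  obtain p W where p: "p \<in> H" "\<And>n. W n \<in> D" "(\<lambda>n::nat. N (W n - p)) \<longlonglongrightarrow> 0"
    "\<And>v. v \<in> D \<Longrightarrow> ip (x - p) v = 0"
    using orthogonal_residual[OF D_subspace D_sub assms(1)] by blast
  obtain q where q: "G q ((1 / 1) *\<^sub>R (q - (x - p)))" using G_range[of 1 "x - p"] assms p by auto
  have qH: "q \<in> H" using q G_H by blast
  have "ip q q \<le> 0"
  proof -
    have "q \<in> D" using q by (auto simp: D_def)
    then show ?thesis using G_diss[OF q] p(4)[of q] qH assms p(1) by (simp add: ip_simps)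
  qed
  then have q0: "N (q - 0) = 0" using ip_nonneg[OF qH] by (simp add: N_def)
  have "G 0 (q - (x - p))"
    using G_cong[OF q _ _ q0] qH assms p(1) by simp
  then have "N (q - (x - p)) = 0" by (rule G_single)
  then have xp: "N (x - p) = 0"
    using N_triangle_diff[of q "q - (x - p)"] q0 qH assms p(1) N_nonneg[of "x - p"] by simp
  obtain n where n: "N (W n - p) < e"
    using order_tendstoD(2)[OF p(3) assms(2)] by (auto simp: eventually_sequentially)
  have "W n \<in> H" using p(2) D_sub by blast
  then have "N (x - W n) < e"
    using N_triangle3[of x p "W n"] xp n N_diff_commute[of p "W n"] assms p(1) by simp
  then show ?thesis using p(2) by blast
qed

text \<open>Approximate \<open>x\<close> from \<open>D\<close>, where the deviation from the
  identity has rate \<open>d n\<close>, and transfer it by contractivity. The filter is general so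
  that it covers both \<open>J (\<tau> n)\<close> for growing \<open>n\<close> and
  \<open>T t\<close> for \<open>t\<close> tending to 0 from the right.\<close>

lemma approx_id:
  assumes "x \<in> H" "(d \<longlongrightarrow> 0) F"
    and "\<forall>\<^sub>F n in F. (\<forall>y\<in>H. S n y \<in> H \<and> N (S n x - S n y) \<le> N (x - y)) \<and> (\<forall>v w. G v w \<longrightarrow> N (S n v - v) \<le> d n * N w)"
  shows "((\<lambda>n. N (S n x - x)) \<longlongrightarrow> 0) F"
proof (rule tendstoI)
  fix e :: real assume "e > 0"
  then obtain v w where v: "G v w" "N (x - v) < e / 4"
    using D_dense[OF assms(1), of "e / 4"] by (auto simp: D_def)
  have H: "x \<in> H" "v \<in> H" using v G_H assms(1) by auto
  have "((\<lambda>n. d n * N w) \<longlongrightarrow> 0) F" using tendsto_mult_left_zero[OF assms(2)] .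
  then have "\<forall>\<^sub>F n in F. d n * N w < e / 4" using \<open>e > 0\<close> by (intro order_tendstoD(2)) auto
  with assms(3) show "\<forall>\<^sub>F n in F. dist (N (S n x - x)) 0 < e"
  proof eventually_elim
    case (elim n)
    then have S: "S n x \<in> H" "S n v \<in> H" "N (S n x - S n v) \<le> N (x - v)" "N (S n v - v) \<le> d n * N w"
      using H v(1) by auto
    have "N (S n x - x) < e"
      using N_triangle3[OF S(1,2) H(1)] N_triangle3[OF S(2) H(2,1)] S(3,4) elim(2) v(2) N_diff_commute[OF H] \<open>e > 0\<close>
      by linarith
    then show ?case using S(1) H(1) by simp
  qed
qed

section \<open>Limit of the backward Euler iterates\<close>

abbreviation \<tau> :: "nat \<Rightarrow> real" where "\<tau> n \<equiv> inverse (real (Suc n))"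

abbreviation steps :: "real \<Rightarrow> nat \<Rightarrow> nat" where "steps t n \<equiv> nat \<lfloor>t * real (Suc n)\<rfloor>"

definition U :: "nat \<Rightarrow> real \<Rightarrow> 'a \<Rightarrow> 'a"
  where "U n t x = P (\<tau> n) (steps t n) x"

lemma U_H [simp]: "x \<in> H \<Longrightarrow> U n t x \<in> H"
  by (simp add: U_def del: of_nat_Suc)

lemma U_contr: "x \<in> H \<Longrightarrow> y \<in> H \<Longrightarrow> N (U n t x - U n t y) \<le> N (x - y)"
  unfolding U_def by (intro P_contr) auto

lemma U_lin: "x \<in> H \<Longrightarrow> y \<in> H \<Longrightarrow> N (U n t (a *\<^sub>R x + b *\<^sub>R y) - (a *\<^sub>R U n t x + b *\<^sub>R U n t y)) = 0"
  unfolding U_def by (intro P_lin) auto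

lemma U_time:
  assumes "t \<ge> 0"
  shows "real (steps t n) * \<tau> n \<le> t"
    and "t - \<tau> n \<le> real (steps t n) * \<tau> n"
proof -
  have k: "real (steps t n) = of_int \<lfloor>t * real (Suc n)\<rfloor>" using assms by (simp del: of_nat_Suc)
  have "of_int \<lfloor>t * real (Suc n)\<rfloor> \<le> t * real (Suc n)" "t * real (Suc n) - 1 \<le> of_int \<lfloor>t * real (Suc n)\<rfloor>"
    by linarith+
  note this[THEN mult_right_mono[of _ _ "\<tau> n"]]
  then show "real (steps t n) * \<tau> n \<le> t"
    "t - \<tau> n \<le> real (steps t n) * \<tau> n"
    unfolding k by (simp_all add: left_diff_distrib mult.assoc right_inverse del: of_nat_Suc)
qed

text \<open>In Kobayashi's bound both discrete times lie in \<open>[t - \<tau> n, t]\<close>, so the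
  squared time difference is at most \<open>(\<tau> n)^2\<close>; each of the remaining two terms is
  a discrete time multiplied by a step, hence at most \<open>t * \<tau> n\<close>.\<close>

lemma U_Cauchy_D:
  assumes "G x w" "t \<ge> 0" "n \<le> m"
  shows "N (U m t x - U n t x) \<le> N w * sqrt ((\<tau> n)^2 + 2 * t * \<tau> n)"
proof -
  let ?k = "\<lambda>n. real (steps t n)"
  have h: "0 < \<tau> k" "0 < \<tau> n" "\<tau> m \<le> \<tau> n" for k using assms by (auto intro!: le_imp_inverse_le)
  have "N (U m t x - U n t x) \<le> N w * sqrt ((?k m * \<tau> m - ?k n * \<tau> n)^2 + ?k m * (\<tau> m)^2 + ?k n * (\<tau> n)^2)"
    unfolding U_def by (rule kobayashi[OF _ _ assms(1)]) auto
  also have "\<dots> \<le> N w * sqrt ((\<tau> n)^2 + 2 * t * \<tau> n)"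
  proof (intro mult_left_mono real_sqrt_le_mono)
    note tm = U_time[OF assms(2), of m] and tn = U_time[OF assms(2), of n]
    have "(?k m * \<tau> m - ?k n * \<tau> n)^2 \<le> (\<tau> n)^2"
    proof (rule abs_le_square_iff[THEN iffD1])
      show "\<bar>?k m * \<tau> m - ?k n * \<tau> n\<bar> \<le> \<bar>\<tau> n\<bar>" using tm tn h by linarith
    qed
    moreover have "?k m * (\<tau> m)^2 \<le> t * \<tau> n"
      unfolding power2_eq_square mult.assoc[symmetric] using tm(1) h assms(2)
      by (intro mult_mono) (auto simp del: of_nat_Suc)
    moreover have "?k n * (\<tau> n)^2 \<le> t * \<tau> n"
      unfolding power2_eq_square mult.assoc[symmetric] using tn(1) h
      by (intro mult_right_mono) (auto simp del: of_nat_Suc)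
    ultimately show "(?k m * \<tau> m - ?k n * \<tau> n)^2 + ?k m * (\<tau> m)^2 + ?k n * (\<tau> n)^2 \<le> (\<tau> n)^2 + 2 * t * \<tau> n"
      by linarith
  qed (use assms G_H in auto)
  finally show ?thesis .
qed

lemma U_limit:
  assumes "x \<in> H" "t \<ge> 0"
  shows "\<exists>L\<in>H. (\<lambda>n. N (U n t x - L)) \<longlonglongrightarrow> 0"
proof (rule complete)
  fix e :: real assume "e > 0"
  then obtain v w where v: "G v w" "N (x - v) < e / 6"
    using D_dense[OF assms(1), of "e / 6"] by (auto simp: D_def)
  have vH: "v \<in> H" using v G_H by blast
  have "(\<lambda>n. N w * sqrt ((\<tau> n)^2 + 2 * t * \<tau> n)) \<longlonglongrightarrow> N w * sqrt (0^2 + 2 * t * 0)"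
    by (intro tendsto_intros LIMSEQ_inverse_real_of_nat)
  then have "(\<lambda>n. N w * sqrt ((\<tau> n)^2 + 2 * t * \<tau> n)) \<longlonglongrightarrow> 0" by simp
  then obtain M where M: "N w * sqrt ((\<tau> M)^2 + 2 * t * \<tau> M) < e / 6"
    using order_tendstoD(2)[of _ 0 _ "e / 6"] \<open>e > 0\<close> by (force simp: eventually_sequentially)
  \<comment> \<open>\<open>U_Cauchy_D\<close> needs ordered indices, so every late iterate is
    compared with the single vector \<open>U M t v\<close>.\<close>
  have near: "N (U m t x - U M t v) < e / 3" if "m \<ge> M" for m
    using N_triangle3[of "U m t x" "U m t v" "U M t v"] U_contr[OF assms(1) vH, of m t]
      U_Cauchy_D[OF v(1) assms(2) that] M v(2) assms(1) vH by simp
  have "N (U m t x - U n t x) < e" if "m \<ge> M" "n \<ge> M" for m n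
    using N_triangle3[of "U m t x" "U M t v" "U n t x"] near[OF that(1)] near[OF that(2)]
      N_diff_commute[of "U M t v" "U n t x"] assms(1) vH \<open>e > 0\<close> by simp
  then show "\<exists>M. \<forall>m\<ge>M. \<forall>n\<ge>M. N (U m t x - U n t x) < e" by blast
qed (use assms in simp)

definition T :: "real \<Rightarrow> 'a \<Rightarrow> 'a"
  where "T t x = (SOME L. L \<in> H \<and> (\<lambda>n. N (U n t x - L)) \<longlonglongrightarrow> 0)"

lemma
  assumes "x \<in> H" "t \<ge> 0"
  shows T_H [simp]: "T t x \<in> H" and T_lim: "(\<lambda>n. N (U n t x - T t x)) \<longlonglongrightarrow> 0"
  using someI_ex[of "\<lambda>L. L \<in> H \<and> (\<lambda>n. N (U n t x - L)) \<longlonglongrightarrow> 0"] U_limit[OF assms]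
  unfolding T_def by auto

lemma T_unique:
  assumes "x \<in> H" "t \<ge> 0" "y \<in> H" "(\<lambda>n. N (U n t x - y)) \<longlonglongrightarrow> 0"
  shows "N (T t x - y) = 0"
  using N_tendsto_unique[of "T t x" y sequentially "\<lambda>n. U n t x"] T_lim assms by simp

lemma T_norm_le:
  assumes "x \<in> H" "t \<ge> 0" "y \<in> H" "\<And>n. N (U n t x - y) \<le> C"
  shows "N (T t x - y) \<le> C"
proof (rule LIMSEQ_le_const2)
  show "(\<lambda>n. N (U n t x - y)) \<longlonglongrightarrow> N (T t x - y)"
    using N_tendsto[of "T t x - y" "\<lambda>n. U n t x - y" sequentially] T_lim assms by simp
qed (use assms in auto)

lemma T_lin:
  assumes "x \<in> H" "y \<in> H" "t \<ge> 0"
  shows "N (T t (a *\<^sub>R x + b *\<^sub>R y) - (a *\<^sub>R T t x + b *\<^sub>R T t y)) = 0"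
proof (rule T_unique)
  let ?z = "a *\<^sub>R x + b *\<^sub>R y" and ?L = "a *\<^sub>R T t x + b *\<^sub>R T t y" and ?u = "\<lambda>n. a *\<^sub>R U n t x + b *\<^sub>R U n t y"
  have "(\<lambda>n. \<bar>a\<bar> * N (U n t x - T t x) + \<bar>b\<bar> * N (U n t y - T t y)) \<longlonglongrightarrow> \<bar>a\<bar> * 0 + \<bar>b\<bar> * 0"
    by (intro tendsto_intros T_lim assms)
  then show "(\<lambda>n. N (U n t ?z - ?L)) \<longlonglongrightarrow> 0"
  proof (rule tendsto_0_squeeze)
    fix n
    have "?u n - ?L = a *\<^sub>R (U n t x - T t x) + b *\<^sub>R (U n t y - T t y)"
      by (simp add: algebra_simps)
    then have "N (?u n - ?L) \<le> \<bar>a\<bar> * N (U n t x - T t x) + \<bar>b\<bar> * N (U n t y - T t y)"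
      using N_triangle[of "a *\<^sub>R (U n t x - T t x)" "b *\<^sub>R (U n t y - T t y)"] assms
      by (simp only: N_scale H_diff U_H T_H H_scale)
    then show "N (U n t ?z - ?L) \<le> \<bar>a\<bar> * N (U n t x - T t x) + \<bar>b\<bar> * N (U n t y - T t y)"
      using N_triangle3[of "U n t ?z" "?u n" ?L] U_lin[of x y n t a b] assms by simp
  qed (use assms in auto)
qed (use assms in auto)

lemma T_N_le:
  assumes "x \<in> H" "t \<ge> 0"
  shows "N (T t x) \<le> N x"
proof -
  have "N (U n t 0) = 0" for n using U_lin[of 0 0 n t 0 0] by simp
  then have "N (U n t x - 0) \<le> N x" for n
    using U_contr[OF assms(1) H_zero, of n t] N_triangle[of "U n t x - U n t 0" "U n t 0"] assms by simp
  then show ?thesis using T_norm_le[OF assms H_zero] by simp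
qed

lemma T_contr:
  assumes "x \<in> H" "y \<in> H" "t \<ge> 0"
  shows "N (T t x - T t y) \<le> N (x - y)"
proof -
  have "N (T t x - T t y) = N (T t (x - y))"
    using N_cong[of "T t (x - y)" "T t x - T t y"] T_lin[of x y t 1 "-1"] assms by simp
  then show ?thesis using T_N_le[of "x - y"] assms by simp
qed

lemma T_zero: "x \<in> H \<Longrightarrow> N (T 0 x - x) = 0"
  by (rule T_unique) (auto simp: U_def)

lemma J_tendsto:
  assumes "x \<in> H"
  shows "(\<lambda>n. N (J (\<tau> n) x - x)) \<longlonglongrightarrow> 0"
  by (rule approx_id[OF assms LIMSEQ_inverse_real_of_nat])
    (use assms J_contr J_step in \<open>auto intro!: always_eventually\<close>)

text \<open>The number of steps for \<open>s + t\<close> is the sum of the numbers for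
  \<open>s\<close> and \<open>t\<close>, or one more because of rounding. The extra step costs at
  most \<open>N (J (\<tau> n) x - x)\<close>, which tends to 0.\<close>

lemma T_semigroup:
  assumes "x \<in> H" "s \<ge> 0" "t \<ge> 0"
  shows "N (T (s + t) x - T s (T t x)) = 0"
proof (rule T_unique)
  have "(\<lambda>n. N (J (\<tau> n) x - x) + (N (U n t x - T t x) + N (U n s (T t x) - T s (T t x)))) \<longlonglongrightarrow> 0 + (0 + 0)"
    by (intro tendsto_add T_lim J_tendsto assms T_H)
  then show "(\<lambda>n. N (U n (s + t) x - T s (T t x))) \<longlonglongrightarrow> 0"
  proof (rule tendsto_0_squeeze)
    show "N (U n (s + t) x - T s (T t x)) \<le> N (J (\<tau> n) x - x) + (N (U n t x - T t x) + N (U n s (T t x) - T s (T t x)))" for n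
    proof -
      define a where "a = steps s n"
      define b where "b = steps t n"
      define c where "c = steps (s + t) n"
      have "0 \<le> \<lfloor>s * real (Suc n)\<rfloor>" "0 \<le> \<lfloor>t * real (Suc n)\<rfloor>" using assms by (simp_all del: of_nat_Suc)
      then have c: "c = a + b \<or> c = Suc (a + b)"
        unfolding a_def b_def c_def distrib_right by linarith
      have h: "\<tau> n > 0" by simp
      have "N (P (\<tau> n) c x - P (\<tau> n) (a + b) x) \<le> N (J (\<tau> n) x - x)"
        using c P_Suc_step[OF h assms(1), of "a + b"] J_H[OF h assms(1)] assms(1) by auto
      moreover have "P (\<tau> n) (a + b) x = U n s (U n t x)"
        unfolding U_def a_def b_def funpow_add by simp
      ultimately have 1: "N (U n (s + t) x - U n s (U n t x)) \<le> N (J (\<tau> n) x - x)"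
        unfolding c_def U_def by simp
      show ?thesis
        using 1 U_contr[of "U n t x" "T t x" n s] assms
          N_triangle3[of "U n (s + t) x" "U n s (U n t x)" "T s (T t x)"]
          N_triangle3[of "U n s (U n t x)" "U n s (T t x)" "T s (T t x)"] by simp
    qed
  qed (use assms in auto)
qed (use assms in auto)

section \<open>Small times and the generator of the semigroup\<close>

lemma T_Lipschitz_D:
  assumes "G x w" "t \<ge> 0"
  shows "N (T t x - x) \<le> t * N w"
proof (rule T_norm_le)
  have H: "x \<in> H" "w \<in> H" using G_H assms by auto
  then show "x \<in> H" "x \<in> H" by auto
  show "N (U n t x - x) \<le> t * N w" for n
    using P_step[OF _ assms(1), of "\<tau> n" "steps t n"]
      mult_right_mono[OF U_time(1)[OF assms(2), of n] N_nonneg[OF H(2)]]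
    unfolding U_def by simp
qed (use assms in auto)

lemma T_continuous:
  assumes "x \<in> H"
  shows "((\<lambda>t. N (T t x - x)) \<longlongrightarrow> 0) (at_right 0)"
proof (rule approx_id[OF assms tendsto_ident_at])
  show "\<forall>\<^sub>F t in at_right 0. (\<forall>y\<in>H. T t y \<in> H \<and> N (T t x - T t y) \<le> N (x - y)) \<and> (\<forall>v w. G v w \<longrightarrow> N (T t v - v) \<le> t * N w)"
    using eventually_at_right_less[of "0::real"]
    by eventually_elim (use assms T_contr T_Lipschitz_D in auto)
qed

text \<open>The operator commutes with its resolvent: the difference quotient \<open>q\<close> of
  one step is the image of \<open>J h x\<close>, and applying the relation once more shows that
  \<open>q\<close> solves the equation defining \<open>J h w\<close>. The remaining steps carry this
  over by linearity and contractivity.\<close>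

lemma P_difference:
  assumes "h > 0" "G x w"
  shows "N (P h (Suc k) x - P h k x - h *\<^sub>R P h (Suc k) w) = 0"
proof -
  have H: "x \<in> H" "w \<in> H" using G_H assms by auto
  define q where "q = (1 / h) *\<^sub>R (J h x - x)"
  have q: "q \<in> H" "G (J h x) q" using J_G[OF assms(1) H(1)] H assms unfolding q_def by auto
  have "(1 / h) *\<^sub>R (J h x - x) = q" by (simp add: q_def)
  then have "G q ((1 / h) *\<^sub>R (q - w))"
    using G_scale[OF G_diff[OF q(2) assms(2)], of "1 / h"] by simp
  then have "N (J h w - q) = 0" by (rule J_unique[OF assms(1) H(2)])
  moreover have "J h x - (x + h *\<^sub>R J h w) = (-h) *\<^sub>R (J h w - q)" using assms by (simp add: q_def algebra_simps)
  ultimately have "N (J h x - (x + h *\<^sub>R J h w)) = 0" using N_scale[of "J h w - q" "-h"] H q assms by simp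
  then have "N (P h k (J h x) - P h k (x + h *\<^sub>R J h w)) \<le> 0"
    using P_contr[of h "J h x" "x + h *\<^sub>R J h w" k] H assms by simp
  moreover have "N (P h k (x + h *\<^sub>R J h w) - (P h k x + h *\<^sub>R P h k (J h w))) = 0"
    using P_lin[of h x "J h w" k 1 h] H assms by simp
  ultimately have "N (P h k (J h x) - (P h k x + h *\<^sub>R P h k (J h w))) \<le> 0"
    using N_triangle3[of "P h k (J h x)" "P h k (x + h *\<^sub>R J h w)" "P h k x + h *\<^sub>R P h k (J h w)"] H assms by simp
  then show ?thesis using H assms by (simp add: funpow_swap1 diff_diff_eq)
qed

text \<open>By \<open>P_difference\<close>, \<open>P h k x - x\<close> is \<open>h\<close> times the
  sum of the iterates of \<open>w\<close>. Each of these is compared with \<open>w\<close>; as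
  \<open>w\<close> need not be in the domain, the comparison goes through a domain element
  \<open>v\<close>, at the price of \<open>2 * N (w - v)\<close>.\<close>

lemma P_expansion:
  assumes "h > 0" "G x w" "G v v'"
  shows "N (P h k x - x - (real k * h) *\<^sub>R w) \<le> real k * h * (2 * N (w - v) + real k * h * N v')"
proof (induction k)
  case (Suc k)
  have H: "x \<in> H" "w \<in> H" "v \<in> H" "v' \<in> H" using G_H assms by auto
  let ?p = "P h (Suc k)"
  have "N (?p w - w) \<le> N (?p w - ?p v) + (N (?p v - v) + N (v - w))"
    using N_triangle3[of "?p w" "?p v" w] N_triangle3[of "?p v" v w] H assms(1) P_H[of h _ "Suc k"] by fastforce
  also have "\<dots> \<le> 2 * N (w - v) + real (Suc k) * h * N v'"
    using P_contr[OF assms(1) H(2,3), of "Suc k"] P_step[OF assms(1,3), of "Suc k"] N_diff_commute[OF H(2,3)] by linarith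
  finally have 1: "N (h *\<^sub>R (?p w - w)) \<le> h * (2 * N (w - v) + real (Suc k) * h * N v')"
    using N_scale[of "?p w - w" h] H assms(1) by (simp del: funpow.simps of_nat_Suc)
  define a where "a = P h k x - x - (real k * h) *\<^sub>R w"
  define b where "b = ?p x - P h k x - h *\<^sub>R ?p w"
  define c where "c = h *\<^sub>R (?p w - w)"
  have abc: "a \<in> H" "b \<in> H" "c \<in> H" using H assms(1) unfolding a_def b_def c_def by (auto intro!: P_H H_diff H_scale simp del: funpow.simps)
  have "N (a + b + c) \<le> N a + N b + N c" using N_triangle[of "a + b" c] N_triangle[of a b] abc by simp
  also have "\<dots> \<le> real k * h * (2 * N (w - v) + real k * h * N v') + 0 + h * (2 * N (w - v) + real (Suc k) * h * N v')"
    using Suc 1 P_difference[OF assms(1,2), of k] unfolding a_def b_def c_def by linarith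
  also have "\<dots> \<le> real k * h * (2 * N (w - v) + real (Suc k) * h * N v') + 0 + h * (2 * N (w - v) + real (Suc k) * h * N v')"
    using assms(1) H by (intro add_mono mult_left_mono mult_right_mono) auto
  also have "\<dots> = real (Suc k) * h * (2 * N (w - v) + real (Suc k) * h * N v')"
    by (simp add: algebra_simps)
  also have "a + b + c = ?p x - x - (real (Suc k) * h) *\<^sub>R w"
    by (simp add: a_def b_def c_def algebra_simps)
  finally show ?case .
qed simp

text \<open>Pass to the limit in \<open>P_expansion\<close>; the extra \<open>\<tau> n * N w\<close>
  pays for the lag of the discrete time behind \<open>t\<close>.\<close>

lemma T_expansion:
  assumes "G x w" "G v v'" "t \<ge> 0"
  shows "N (T t x - x - t *\<^sub>R w) \<le> t * (2 * N (w - v) + t * N v')"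
proof -
  have H: "x \<in> H" "w \<in> H" "v \<in> H" "v' \<in> H" using G_H assms by auto
  have bd: "N (U n t x - (x + t *\<^sub>R w)) \<le> t * (2 * N (w - v) + t * N v') + \<tau> n * N w" for n
  proof -
    define s where "s = real (steps t n) * \<tau> n"
    have s: "s \<le> t" "t - \<tau> n \<le> s" "0 \<le> s" using U_time[OF assms(3), of n] unfolding s_def by auto
    have "N (U n t x - x - s *\<^sub>R w) \<le> s * (2 * N (w - v) + s * N v')"
      unfolding U_def s_def by (rule P_expansion[OF _ assms(1,2)]) simp
    also have "\<dots> \<le> t * (2 * N (w - v) + t * N v')"
      using s H assms(3) by (intro mult_mono add_mono order_refl mult_nonneg_nonneg add_nonneg_nonneg) auto
    finally have 1: "N (U n t x - x - s *\<^sub>R w) \<le> t * (2 * N (w - v) + t * N v')" .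
    have "N ((s - t) *\<^sub>R w) \<le> \<tau> n * N w"
      using s H N_scale[of w "s - t"] by (auto intro!: mult_right_mono)
    moreover have "N (U n t x - (x + t *\<^sub>R w)) = N ((U n t x - x - s *\<^sub>R w) + (s - t) *\<^sub>R w)"
      by (simp add: algebra_simps)
    moreover have "N ((U n t x - x - s *\<^sub>R w) + (s - t) *\<^sub>R w) \<le> N (U n t x - x - s *\<^sub>R w) + N ((s - t) *\<^sub>R w)"
      by (rule N_triangle) (use H in auto)
    ultimately show ?thesis using 1 by linarith
  qed
  have "N (T t x - (x + t *\<^sub>R w)) \<le> t * (2 * N (w - v) + t * N v') + 0 * N w"
  proof (rule LIMSEQ_le)
    show "(\<lambda>n. N (U n t x - (x + t *\<^sub>R w))) \<longlonglongrightarrow> N (T t x - (x + t *\<^sub>R w))"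
      using N_tendsto[of "T t x - (x + t *\<^sub>R w)" "\<lambda>n. U n t x - (x + t *\<^sub>R w)" sequentially] T_lim[OF H(1) assms(3)] assms H by simp
    show "(\<lambda>n. t * (2 * N (w - v) + t * N v') + \<tau> n * N w) \<longlonglongrightarrow> t * (2 * N (w - v) + t * N v') + 0 * N w"
      by (intro tendsto_intros LIMSEQ_inverse_real_of_nat)
  qed (use bd in auto)
  then show ?thesis by (simp add: algebra_simps)
qed

abbreviation dT :: "real \<Rightarrow> 'a \<Rightarrow> 'a" where "dT t x \<equiv> (1 / t) *\<^sub>R (T t x - x)"

text \<open>Divided by \<open>t\<close>, the bound of \<open>T_expansion\<close> is
  \<open>2 * N (w - v) + t * N v'\<close>: by density \<open>v\<close> is fixed close to
  \<open>w\<close> first, and only then does \<open>t\<close> tend to 0.\<close>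

lemma T_derivative:
  assumes "G x w"
  shows "((\<lambda>t. N (dT t x - w)) \<longlongrightarrow> 0) (at_right 0)"
proof (rule tendstoI)
  fix e :: real assume "e > 0"
  have H: "x \<in> H" "w \<in> H" using G_H assms by auto
  obtain v v' where v: "G v v'" "N (w - v) < e / 4"
    using D_dense[OF H(2), of "e / 4"] \<open>e > 0\<close> by (auto simp: D_def)
  have "((\<lambda>t. t * N v') \<longlongrightarrow> 0 * N v') (at_right 0)" by (intro tendsto_intros)
  then have "\<forall>\<^sub>F t in at_right 0. t * N v' < e / 4"
    using order_tendstoD(2)[of _ 0 _ "e / 4"] \<open>e > 0\<close> by simp
  moreover have "\<forall>\<^sub>F t in at_right (0::real). t > 0" by (rule eventually_at_right_less)
  ultimately show "\<forall>\<^sub>F t in at_right 0. dist (N (dT t x - w)) 0 < e"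
  proof eventually_elim
    case (elim t)
    have "dT t x - w = (1 / t) *\<^sub>R (T t x - x - t *\<^sub>R w)"
      using elim by (simp add: algebra_simps)
    then have "N (dT t x - w) = (1 / t) * N (T t x - x - t *\<^sub>R w)"
      using N_scale[of "T t x - x - t *\<^sub>R w" "1 / t"] H elim by simp
    also have "\<dots> \<le> 2 * N (w - v) + t * N v'"
      using T_expansion[OF assms v(1), of t] elim by (simp add: field_simps)
    also have "\<dots> < e" using elim v(2) \<open>e > 0\<close> by linarith
    finally show ?case using H elim by simp
  qed
qed

text \<open>Contractivity and Cauchy-Schwarz give \<open>ip (T t x) x \<le> ip x x\<close>, so every
  difference quotient pairs nonpositively with \<open>x\<close>.\<close>

lemma T_derivative_dissipative:
  assumes "x \<in> H" "y \<in> H" "((\<lambda>t. N (dT t x - y)) \<longlongrightarrow> 0) (at_right 0)"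
  shows "ip y x \<le> 0"
proof -
  have "((\<lambda>t. N (dT t x - y) * N x) \<longlongrightarrow> 0 * N x) (at_right 0)"
    by (intro tendsto_intros assms)
  moreover have "\<forall>\<^sub>F t in at_right 0. ip y x \<le> N (dT t x - y) * N x"
    using eventually_at_right_less[of "0::real"]
  proof eventually_elim
    case (elim t)
    have "ip (T t x) x \<le> N (T t x) * N x" using Cauchy_Schwarz[of "T t x" x] assms elim by simp
    also have "\<dots> \<le> N x * N x" using T_N_le[of x t] assms elim by (intro mult_right_mono) auto
    finally have "ip (T t x - x) x \<le> 0" using assms elim N_sq[of x] by (simp add: ip_simps power2_eq_square)
    then have "ip (dT t x) x \<le> 0"
      using assms elim ip_scale_left[of "T t x - x" x "1 / t"] by (simp add: divide_nonpos_pos)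
    moreover have "\<bar>ip (dT t x - y) x\<bar> \<le> N (dT t x - y) * N x"
      using Cauchy_Schwarz assms elim by simp
    moreover have "ip (dT t x - y) x = ip (dT t x) x - ip y x"
      using assms elim by (intro ip_diff_left) auto
    ultimately show ?case by linarith
  qed
  ultimately show ?thesis
    using tendsto_lowerbound[of _ "0" "at_right (0::real)"] by (simp add: trivial_limit_at_right_real)
qed

text \<open>The generator of \<open>T\<close> is dissipative and extends the maximal relation \<open>G\<close>, hence agrees with it.\<close>

lemma T_generator:
  assumes "x \<in> H" "y \<in> H" "((\<lambda>t. N (dT t x - y)) \<longlongrightarrow> 0) (at_right 0)"
  shows "x \<in> D"
proof -
  obtain z where z: "G z ((1 / 1) *\<^sub>R (z - (x - y)))" using G_range[of 1 "x - y"] assms by auto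
  define w where "w = z - (x - y)"
  have zw: "G z w" "z \<in> H" "w \<in> H" using z G_H by (auto simp: w_def)
  have "((\<lambda>t. N (dT t x - y) + N (dT t z - w)) \<longlongrightarrow> 0 + 0) (at_right 0)"
    by (intro tendsto_add assms T_derivative zw)
  moreover have "\<forall>\<^sub>F t in at_right 0. norm (N (dT t (x - z) - (y - w))) \<le>
    N (dT t x - y) + N (dT t z - w)"
    using eventually_at_right_less[of "0::real"]
  proof eventually_elim
    case (elim t)
    define r where "r = T t (x - z) - (T t x - T t z)"
    define a where "a = dT t x - y"
    define b where "b = dT t z - w"
    have H: "r \<in> H" "a \<in> H" "b \<in> H" using assms zw elim by (auto simp: r_def a_def b_def)
    have "N r = 0" using T_lin[of x z t 1 "-1"] assms zw elim by (simp add: r_def)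
    then have "N ((1 / t) *\<^sub>R r) = 0" using N_scale[OF H(1)] by simp
    moreover have "dT t (x - z) - (y - w) = (1 / t) *\<^sub>R r + (a - b)"
      by (simp add: r_def a_def b_def algebra_simps)
    ultimately have "N (dT t (x - z) - (y - w)) \<le> N a + N b"
      using N_triangle[of "(1 / t) *\<^sub>R r" "a - b"] N_triangle_diff[of a b] H by simp
    then show ?case using assms zw elim by (simp add: a_def b_def)
  qed
  ultimately have "((\<lambda>t. N (dT t (x - z) - (y - w))) \<longlongrightarrow> 0) (at_right 0)"
    by (intro Lim_null_comparison[rotated, OF tendsto_eq_rhs]) auto
  then have "ip (y - w) (x - z) \<le> 0" by (intro T_derivative_dissipative) (use assms zw in auto)
  \<comment> \<open>The semigroup's derivative at \<open>x - z\<close> is \<open>x - z\<close>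
    itself, so dissipativity makes its square norm nonpositive.\<close>
  moreover have "y - w = x - z" by (simp add: w_def algebra_simps)
  ultimately have "N (z - x) = 0"
    using ip_nonneg[of "x - z"] assms zw N_diff_commute[of z x] by (simp add: N_def)
  then have "G x w" using G_cong[OF zw(1), of x w] assms zw by simp
  then show ?thesis by (auto simp: D_def)
qed

end

section \<open>Square integrable functions and primitives on an interval\<close>

type_synonym fn = "real \<Rightarrow> real"

definition prim :: "fn \<Rightarrow> real \<Rightarrow> real"
  where "prim u x = integral\<^sup>L (lebesgue_on {0..x}) u"

lemmas LI_cong = Bochner_Integration.integral_cong
lemmas LI_add = Bochner_Integration.integral_add
lemmas dominated_integrable = Bochner_Integration.integrable_bound

lemma wderiv_prim: "wderiv l f g \<longleftrightarrow> L2 l g \<and> (\<forall>x\<in>{0..l}. f x = f 0 + prim g x)"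
  by (simp add: wderiv_def prim_def)

locale interval =
  fixes l :: real
  assumes l_pos: "l > 0"
begin

abbreviation M :: "real measure" where "M \<equiv> lebesgue_on {0..l}"

abbreviation LI :: "fn \<Rightarrow> real" where "LI \<equiv> integral\<^sup>L M"

sublocale finite_measure M
  by (rule finite_measure_lebesgue_on) simp

section \<open>Square integrable functions and their completeness\<close>

lemma L2_meas: "L2 l f \<Longrightarrow> f \<in> borel_measurable M"
  by (simp add: L2_def)

lemma L2_sq_integrable: "L2 l f \<Longrightarrow> integrable M (\<lambda>y. (f y)^2)"
  by (simp add: L2_def)

lemma L2_mult_integrable:
  assumes "L2 l f" "L2 l g"
  shows "integrable M (\<lambda>y. f y * g y)"
proof (rule dominated_integrable)
  show "integrable M (\<lambda>y. (f y)^2 + (g y)^2)"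
    using assms by (intro Bochner_Integration.integrable_add L2_sq_integrable)
  show "(\<lambda>y. f y * g y) \<in> borel_measurable M"
    using assms by (intro borel_measurable_times L2_meas)
  have "\<bar>a * b\<bar> \<le> a^2 + b^2" for a b :: real
    using sum_squares_bound[of "\<bar>a\<bar>" "\<bar>b\<bar>"] abs_ge_zero[of "a * b"] unfolding abs_mult power2_abs by linarith
  then show "AE y in M. norm (f y * g y) \<le> norm ((f y)^2 + (g y)^2)"
    by (auto intro!: AE_I2)
qed

lemma L2_const [simp]: "L2 l (\<lambda>_. c)"
  by (simp add: L2_def)

lemma L2_integrable: "L2 l f \<Longrightarrow> integrable M f"
  using L2_mult_integrable[of f "\<lambda>_. 1"] by simp

text \<open>Measurability of \<open>g\<close> rests on completeness of Lebesgue measure, used after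
  extension by zero.\<close>

lemma L2_cong_AE:
  assumes "L2 l f" "AE y in M. f y = g y"
  shows "L2 l g"
proof -
  have fm: "f \<in> borel_measurable M" using assms L2_meas by blast
  have gm: "g \<in> borel_measurable M"
  proof -
    let ?f = "\<lambda>x. if x \<in> {0..l} then f x else 0" and ?g = "\<lambda>x. if x \<in> {0..l} then g x else 0"
    have "?f \<in> borel_measurable lebesgue"
      using fm by (subst borel_measurable_if) auto
    moreover have "AE x in lebesgue. ?f x = ?g x"
      using assms(2) by (subst (asm) AE_restrict_space_iff) auto
    ultimately have "?g \<in> borel_measurable lebesgue"
      by (rule borel_measurable_AE)
    then show ?thesis by (subst (asm) borel_measurable_if) auto
  qed
  have "integrable M (\<lambda>y. (g y)^2) \<longleftrightarrow> integrable M (\<lambda>y. (f y)^2)"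
    using assms(2) by (intro integrable_cong_AE borel_measurable_power fm gm) (auto elim!: eventually_mono)
  then show ?thesis using assms gm by (simp add: L2_def)
qed

lemma L2_add [simp]:
  assumes "L2 l f" "L2 l g"
  shows "L2 l (\<lambda>y. f y + g y)"
  unfolding L2_def power2_sum mult.assoc using assms
  by (intro conjI borel_measurable_add L2_meas Bochner_Integration.integrable_add L2_sq_integrable
      integrable_mult_right L2_mult_integrable)

lemma L2_scale [simp]: "L2 l f \<Longrightarrow> L2 l (\<lambda>y. c * f y)"
  unfolding L2_def power_mult_distrib
  by (intro conjI borel_measurable_times borel_measurable_const integrable_mult_right) auto

lemma L2_minus [simp]: "L2 l f \<Longrightarrow> L2 l (\<lambda>y. - f y)"
  using L2_scale[of f "-1"] by simp

lemma L2_diff [simp]: "L2 l f \<Longrightarrow> L2 l g \<Longrightarrow> L2 l (\<lambda>y. f y - g y)"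
  using L2_add[of f "\<lambda>y. - g y"] by simp

lemma L2_bounded_mult:
  assumes "a \<in> borel_measurable M" "AE y in M. \<bar>a y\<bar> \<le> C" "L2 l f"
  shows "L2 l (\<lambda>y. a y * f y)"
  unfolding L2_def
proof
  show m: "(\<lambda>y. a y * f y) \<in> borel_measurable M"
    using assms(1) L2_meas[OF assms(3)] by (rule borel_measurable_times)
  show "integrable M (\<lambda>y. (a y * f y)^2)"
  proof (rule dominated_integrable)
    show "integrable M (\<lambda>y. C^2 * (f y)^2)" using assms by (intro integrable_mult_right L2_sq_integrable)
    show "AE y in M. norm ((a y * f y)^2) \<le> norm (C^2 * (f y)^2)"
      using assms(2)
    proof eventually_elim
      case (elim y)
      then have "(a y)^2 \<le> C^2" using abs_le_square_iff[of "a y" C] by linarith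
      then show ?case by (simp add: power_mult_distrib mult_right_mono)
    qed
  qed (use m in simp)
qed

lemma L2_Linf_mult: "Linf l a \<Longrightarrow> L2 l f \<Longrightarrow> L2 l (\<lambda>y. a y * f y)"
  unfolding Linf_def using L2_bounded_mult by blast

lemma L2_continuous:
  assumes "continuous_on {0..l} f"
  shows "L2 l f"
  unfolding L2_def
  using assms by (auto intro!: continuous_imp_measurable_on_sets_lebesgue continuous_imp_integrable_real continuous_intros)

sublocale L2: semi_inner "{f. L2 l f}" "\<lambda>f g. LI (\<lambda>y. f y * g y)"
proof
  show "subspace {f. L2 l f}"
    unfolding subspace_def by (auto simp: zero_fun_def plus_fun_def scaleR_fun_def)
qed (auto simp: L2_mult_integrable algebra_simps mult.left_commute integral_nonneg)

lemma L2_N_sq: "L2 l f \<Longrightarrow> (L2.N f)^2 = LI (\<lambda>y. (f y)^2)"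
  using L2.N_sq[of f] by (simp add: power2_eq_square)

lemma L2_N_eq_0_iff:
  assumes "L2 l f"
  shows "L2.N f = 0 \<longleftrightarrow> (AE y in M. f y = 0)"
proof -
  have "L2.N f = 0 \<longleftrightarrow> LI (\<lambda>y. (f y)^2) = 0"
    unfolding L2_N_sq[OF assms, symmetric] by simp
  also have "\<dots> \<longleftrightarrow> (AE y in M. f y = 0)"
    by (subst integral_nonneg_eq_0_iff_AE) (use assms in "auto simp: L2_sq_integrable")
  finally show ?thesis .
qed

lemma nn_integral_L2_sq:
  assumes "L2 l f"
  shows "(\<integral>\<^sup>+y. ennreal ((f y)^2) \<partial>M) = ennreal ((L2.N f)^2)"
  unfolding L2_N_sq[OF assms] using assms by (intro nn_integral_eq_integral) (auto simp: L2_sq_integrable)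

text \<open>Riesz-Fischer: a subsequence with geometrically small increments has almost everywhere
  summable increments, hence a pointwise limit, and Fatou's lemma turns pointwise convergence into
  the norm bound.\<close>

lemma L2_complete:
  assumes X: "\<And>n. L2 l (X n)"
    and Cau: "\<And>e. e > 0 \<Longrightarrow> \<exists>k. \<forall>m\<ge>k. \<forall>n\<ge>k. L2.N (X m - X n) < e"
  shows "\<exists>L. L2 l L \<and> (\<lambda>n::nat. L2.N (X n - L)) \<longlonglongrightarrow> 0"
proof -
  have "\<forall>k. \<exists>n. \<forall>i\<ge>n. \<forall>j\<ge>n. L2.N (X i - X j) < (1/2) ^ k" using Cau by simp
  then obtain b where b: "\<And>k i j. i \<ge> b k \<Longrightarrow> j \<ge> b k \<Longrightarrow> L2.N (X i - X j) < (1/2) ^ k" by metis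
  \<comment> \<open>The maximum over all indices up to \<open>k\<close> makes the subsequence
    indices monotone.\<close>
  define r where "r k = Max (b ` {..k})" for k
  have r: "r k \<ge> b k" "r k \<le> r (Suc k)" for k unfolding r_def by (auto intro!: Max_mono)
  define d where "d k = (\<lambda>y. \<bar>X (r (Suc k)) y - X (r k) y\<bar>)" for k
  have dL2: "L2 l (d k)" for k
  proof -
    have "L2 l (\<lambda>y. X (r (Suc k)) y - X (r k) y)" using X by simp
    then show ?thesis unfolding d_def L2_def by auto
  qed
  have Nd: "L2.N (d k) \<le> (1/2) ^ k" for k
  proof -
    have "L2.N (d k) = L2.N (X (r (Suc k)) - X (r k))"
      by (simp add: L2.N_def d_def abs_mult_self_eq)
    also have "\<dots> < (1/2) ^ k" using r[of k] by (intro b) auto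
    finally show ?thesis by simp
  qed
  have int_d: "LI (d k) \<le> L2.N (\<lambda>_. 1) * (1/2) ^ k" for k
  proof -
    have "LI (d k) \<le> L2.N (\<lambda>_. 1) * L2.N (d k)"
      using L2.Cauchy_Schwarz[of "\<lambda>_. 1" "d k"] dL2 by simp
    also have "\<dots> \<le> L2.N (\<lambda>_. 1) * (1/2) ^ k" using Nd by (intro mult_left_mono) auto
    finally show ?thesis .
  qed
  have summ: "AE y in M. summable (\<lambda>k. d k y)"
  proof -
    have dm: "(\<lambda>y. ennreal (d k y)) \<in> borel_measurable M" for k using L2_meas[OF dL2] by measurable
    have "(\<integral>\<^sup>+y. (\<Sum>k. ennreal (d k y)) \<partial>M) = (\<Sum>k. \<integral>\<^sup>+y. ennreal (d k y) \<partial>M)"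
      using dm by (rule nn_integral_suminf)
    also have "\<dots> = (\<Sum>k. ennreal (LI (d k)))"
      using dL2 by (intro suminf_cong nn_integral_eq_integral L2_integrable) (auto simp: d_def)
    also have "\<dots> \<le> (\<Sum>k. ennreal (L2.N (\<lambda>_. 1) * (1/2) ^ k))"
      using int_d by (intro suminf_le) auto
    also have "\<dots> = ennreal (\<Sum>k. L2.N (\<lambda>_. 1) * (1/2) ^ k)"
      by (intro suminf_ennreal2 summable_mult) (auto simp: summable_geometric)
    also have "\<dots> < \<infinity>" by simp
    finally have "AE y in M. (\<Sum>k. ennreal (d k y)) \<noteq> \<infinity>"
      using dm by (intro nn_integral_PInf_AE) auto
    then show ?thesis
      by eventually_elim (auto intro!: summable_suminf_not_top simp: d_def)
  qed
  define L where "L y = lim (\<lambda>k. X (r k) y)" for y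
  have Lm: "L \<in> borel_measurable M"
    unfolding L_def using X L2_meas by (intro borel_measurable_lim_metric) auto
  have conv: "AE y in M. (\<lambda>k. X (r k) y) \<longlonglongrightarrow> L y"
    using summ
  proof eventually_elim
    case (elim y)
    then have "summable (\<lambda>k. X (r (Suc k)) y - X (r k) y)"
      unfolding d_def by (rule summable_rabs_cancel)
    then have "convergent (\<lambda>n. \<Sum>k<n. X (r (Suc k)) y - X (r k) y)"
      by (simp add: summable_iff_convergent)
    then have "convergent (\<lambda>n. X (r n) y - X (r 0) y)" by (simp add: sum_lessThan_telescope[of "\<lambda>n. X (r n) y"])
    then have "convergent (\<lambda>n. (X (r n) y - X (r 0) y) + X (r 0) y)" by (intro convergent_add convergent_const)
    then show ?case by (simp add: L_def convergent_LIMSEQ_iff)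
  qed
  \<comment> \<open>Fatou along \<open>r j\<close> with \<open>n\<close> fixed. The bound also shows
    that \<open>X n - L\<close> is square integrable, from which the same follows for
    \<open>L\<close>.\<close>
  have key: "L2 l (\<lambda>y. X n y - L y) \<and> L2.N (X n - L) \<le> (1/2) ^ k" if n: "n \<ge> r k" for n k
  proof -
    have m: "(\<lambda>y. (X n y - X (r j) y)^2) \<in> borel_measurable M" for j using X L2_meas by measurable
    have "(\<integral>\<^sup>+y. ennreal ((X n y - L y)^2) \<partial>M) = (\<integral>\<^sup>+y. liminf (\<lambda>j. ennreal ((X n y - X (r j) y)^2)) \<partial>M)"
    proof (rule nn_integral_cong_AE)
      show "AE y in M. ennreal ((X n y - L y)^2) = liminf (\<lambda>j. ennreal ((X n y - X (r j) y)^2))"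
        using conv
      proof eventually_elim
        case (elim y)
        then have "(\<lambda>j. ennreal ((X n y - X (r j) y)^2)) \<longlonglongrightarrow> ennreal ((X n y - L y)^2)"
          by (intro tendsto_intros tendsto_ennrealI)
        then show ?case by (metis lim_imp_Liminf trivial_limit_sequentially)
      qed
    qed
    also have "\<dots> \<le> liminf (\<lambda>j. \<integral>\<^sup>+y. ennreal ((X n y - X (r j) y)^2) \<partial>M)"
      using m by (intro nn_integral_liminf) auto
    also have "\<dots> \<le> ennreal (((1/2) ^ k)^2)"
    proof (rule order_trans[OF Liminf_mono[of _ "\<lambda>_. ennreal (((1/2) ^ k)^2)"]])
      show "\<forall>\<^sub>F j in sequentially. (\<integral>\<^sup>+y. ennreal ((X n y - X (r j) y)^2) \<partial>M) \<le> ennreal (((1/2) ^ k)^2)"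
        using eventually_ge_at_top[of k]
      proof eventually_elim
        case (elim j)
        have "r k \<le> r j" using elim r(2) by (rule lift_Suc_mono_le[rotated])
        then have "L2.N (X n - X (r j)) < (1/2) ^ k" using n r(1)[of k] by (intro b) auto
        then have "(L2.N (X n - X (r j)))^2 \<le> ((1/2) ^ k)^2"
          using X by (intro power_mono) (auto simp: fun_diff_def)
        then show ?case using nn_integral_L2_sq[of "X n - X (r j)"] X
          by (simp add: fun_diff_def ennreal_leI)
      qed
    qed (simp add: Liminf_const)
    finally have le: "(\<integral>\<^sup>+y. ennreal ((X n y - L y)^2) \<partial>M) \<le> ennreal (((1/2) ^ k)^2)" .
    have "integrable M (\<lambda>y. (X n y - L y)^2)"
    proof (rule integrableI_bounded)
      show "(\<lambda>y. (X n y - L y)^2) \<in> borel_measurable M" using X L2_meas Lm by measurable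
      show "(\<integral>\<^sup>+y. ennreal (norm ((X n y - L y)^2)) \<partial>M) < \<infinity>"
        using le by (simp add: le_less_trans)
    qed
    then have L2d: "L2 l (\<lambda>y. X n y - L y)"
      unfolding L2_def by (intro conjI borel_measurable_diff L2_meas[OF X] Lm)
    then have "ennreal ((L2.N (X n - L))^2) \<le> ennreal (((1/2) ^ k)^2)"
      using le nn_integral_L2_sq[of "X n - L"] by (simp add: fun_diff_def)
    then have "(L2.N (X n - L))^2 \<le> ((1/2) ^ k)^2" by (subst (asm) ennreal_le_iff) auto
    then show ?thesis using L2d power2_le_imp_le by fastforce
  qed
  have "L2 l (\<lambda>y. X (r 0) y - (X (r 0) y - L y))"
    by (rule L2_diff[OF X[of "r 0"] conjunct1[OF key[OF order_refl, of 0]]])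
  then have "L2 l L" by simp
  moreover have "(\<lambda>n. L2.N (X n - L)) \<longlonglongrightarrow> 0"
  proof (rule LIMSEQ_I)
    fix e :: real assume "e > 0"
    then obtain k where k: "(1/2::real) ^ k < e" using real_arch_pow_inv[of e "1/2"] by auto
    have "norm (L2.N (X n - L) - 0) < e" if "n \<ge> r k" for n
      using key[OF that] k X \<open>L2 l L\<close> L2.N_nonneg[of "X n - L"] by (simp add: fun_diff_def)
    then show "\<exists>no. \<forall>n\<ge>no. norm (L2.N (X n - L) - 0) < e" by blast
  qed
  ultimately show ?thesis by blast
qed

sublocale L2: semi_hilbert "{f. L2 l f}" "\<lambda>f g. LI (\<lambda>y. f y * g y)"
proof
  fix X :: "nat \<Rightarrow> real \<Rightarrow> real"
  assume "\<And>n. X n \<in> {f. L2 l f}" "\<And>e. e > 0 \<Longrightarrow> \<exists>k. \<forall>m\<ge>k. \<forall>n\<ge>k. L2.N (X m - X n) < e"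
  then show "\<exists>L\<in>{f. L2 l f}. (\<lambda>n. L2.N (X n - L)) \<longlonglongrightarrow> 0" using L2_complete[of X] by auto
qed

section \<open>Primitives\<close>

lemma prim_zero [simp]: "prim u 0 = 0"
proof -
  have "AE y in lebesgue_on {0..0::real}. u y = 0"
  proof -
    have "AE y in lebesgue. y \<noteq> (0::real)"
      by (rule AE_I'[of "{0}"]) (auto simp: negligible_iff_null_sets[symmetric])
    then have "AE y in lebesgue. y \<in> {0::real} \<longrightarrow> u y = 0" by eventually_elim auto
    then show ?thesis by (subst AE_restrict_space_iff) auto
  qed
  then show ?thesis unfolding prim_def by (rule integral_eq_zero_AE)
qed

lemma prim_indicator:
  assumes "0 \<le> x" "x \<le> l"
  shows "prim u x = LI (\<lambda>y. indicator {0..x} y * u y)"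
proof -
  have "prim u x = integral\<^sup>L lebesgue (\<lambda>y. indicator {0..x} y *\<^sub>R u y)"
    unfolding prim_def by (rule integral_restrict_space) simp
  also have "\<dots> = integral\<^sup>L lebesgue (\<lambda>y. indicator {0..l} y *\<^sub>R (indicator {0..x} y * u y))"
    using assms by (intro LI_cong) (auto simp: indicator_def)
  also have "\<dots> = LI (\<lambda>y. indicator {0..x} y * u y)"
    using integral_restrict_space[of "{0..l}" lebesgue "\<lambda>y. indicator {0..x} y * u y"] by simp
  finally show ?thesis .
qed

lemma integrable_subinterval_M:
  fixes u :: "real \<Rightarrow> real"
  assumes "integrable M u" "x \<le> l"
  shows "integrable (lebesgue_on {0..x}) u"
  by (rule Equivalence_Lebesgue_Henstock_Integration.integrable_subinterval[OF assms(1)]) (use assms(2) in auto)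

lemma prim_HK:
  assumes "integrable M u" "x \<le> l"
  shows "prim u x = integral {0..x} u"
  unfolding prim_def using integrable_subinterval_M[OF assms] by (rule lebesgue_integral_eq_integral) simp

lemma prim_continuous: "integrable M u \<Longrightarrow> continuous_on {0..l} (prim u)"
  unfolding prim_def by (rule indefinite_integral_continuous_real)

lemma prim_L2 [simp]: "L2 l u \<Longrightarrow> L2 l (prim u)"
  using L2_continuous[OF prim_continuous[OF L2_integrable]] .

lemma indicator_Icc_meas: "indicat_real {0..x} \<in> borel_measurable M"
  by (intro measurable_restrict_space1 borel_measurable_indicator) simp

lemma prim_cong_AE:
  assumes "AE y in M. u y = v y" "u \<in> borel_measurable M" "v \<in> borel_measurable M" "x \<in> {0..l}"
  shows "prim u x = prim v x"
proof -
  have "LI (\<lambda>y. indicator {0..x} y * u y) = LI (\<lambda>y. indicator {0..x} y * v y)"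
    using assms(1) by (intro integral_cong_AE borel_measurable_times assms indicator_Icc_meas) (auto elim!: eventually_mono)
  then show ?thesis using assms by (simp add: prim_indicator)
qed

lemma prim_add:
  assumes "integrable M u" "integrable M v" "x \<in> {0..l}"
  shows "prim (\<lambda>y. u y + v y) x = prim u x + prim v x"
  unfolding prim_def using assms integrable_subinterval_M by (intro LI_add) auto

lemma prim_scale: "prim (\<lambda>y. c * u y) x = c * prim u x"
  unfolding prim_def by simp

text \<open>All integrals over subintervals vanish. In Henstock's lemma the sum of the local errors
  is then a Riemann sum of the absolute value of \<open>u\<close>, so that absolute value has
  integral 0.\<close>

lemma prim_eq_0_imp_AE:
  assumes u: "integrable M u" and z: "\<And>x. x \<in> {0..l} \<Longrightarrow> prim u x = 0"
  shows "AE y in M. u y = 0"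
proof -
  have ui: "u integrable_on cbox 0 l" using u by (simp add: integrable_on_lebesgue_on)
  have box: "integral k u = 0" if k: "k \<subseteq> cbox 0 l" "k = cbox c d" for k c d
  proof (cases "c \<le> d")
    case True
    then have cd: "0 \<le> c" "d \<le> l" "c \<le> l" "0 \<le> d" using k by auto
    have "integral {0..c} u + integral {c..d} u = integral {0..d} u"
      using ui cd True by (intro Henstock_Kurzweil_Integration.integral_combine integrable_on_subinterval[of u "cbox 0 l"]) auto
    then show ?thesis using prim_HK[OF u] z[of c] z[of d] k cd True by simp
  qed (use k in auto)
  have "((\<lambda>x. \<bar>u x\<bar>) has_integral 0) (cbox 0 l)"
    unfolding has_integral
  proof (intro allI impI)
    fix e :: real assume "e > 0"
    obtain \<gamma> where g: "gauge \<gamma>" and H: "\<And>p. p tagged_partial_division_of (cbox 0 l) \<Longrightarrow> \<gamma> fine p \<Longrightarrow>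
        sum (\<lambda>(x,k). norm (measure lborel k *\<^sub>R u x - integral k u)) p < e"
      using Henstock_lemma[OF ui \<open>e > 0\<close>] by blast
    have "norm ((\<Sum>(x, k)\<in>p. measure lborel k *\<^sub>R \<bar>u x\<bar>) - 0) < e"
      if p: "p tagged_division_of (cbox 0 l)" "\<gamma> fine p" for p
    proof -
      have "(\<Sum>(x, k)\<in>p. measure lborel k *\<^sub>R \<bar>u x\<bar>) = sum (\<lambda>(x,k). norm (measure lborel k *\<^sub>R u x - integral k u)) p"
      proof (rule sum.cong[OF refl], clarsimp simp only: split_conv)
        fix x k assume xk: "(x, k) \<in> p"
        have "integral k u = 0"
          using tagged_division_ofD(3,4)[OF p(1) xk] box by blast
        then show "measure lborel k *\<^sub>R \<bar>u x\<bar> =  norm (measure lborel k *\<^sub>R u x - integral k u)"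
          by (simp add: abs_mult)
      qed
      moreover have "\<dots> < e" using p by (intro H) (auto simp: tagged_division_of_def)
      moreover have "0 \<le> (\<Sum>(x, k)\<in>p. measure lborel k *\<^sub>R \<bar>u x\<bar>)" by (intro sum_nonneg) auto
      ultimately show ?thesis by simp
    qed
    then show "\<exists>\<gamma>. gauge \<gamma> \<and> (\<forall>p. p tagged_division_of (cbox 0 l) \<and> \<gamma> fine p \<longrightarrow>
        norm ((\<Sum>(x, k)\<in>p. measure lborel k *\<^sub>R \<bar>u x\<bar>) - 0) < e)" using g by blast
  qed
  moreover have "LI (\<lambda>x. \<bar>u x\<bar>) = integral {0..l} (\<lambda>x. \<bar>u x\<bar>)"
    using u by (intro lebesgue_integral_eq_integral) auto
  ultimately have "LI (\<lambda>x. \<bar>u x\<bar>) = 0" by (simp add: integral_unique)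
  then have "AE y in M. \<bar>u y\<bar> = 0"
    using u by (subst (asm) integral_nonneg_eq_0_iff_AE) auto
  then show ?thesis by simp
qed

text \<open>Fubini for \<open>u y * v x\<close> on the triangle \<open>y \<le> x\<close>:
  integrating in \<open>y\<close> first gives \<open>prim u x * v x\<close>, integrating in
  \<open>x\<close> first gives \<open>u y\<close> times the integral of \<open>v\<close> beyond
  \<open>y\<close>.\<close>

lemma prim_adjoint:
  assumes uL: "L2 l u" and vL: "L2 l v"
  shows "LI (\<lambda>x. prim u x * v x) + LI (\<lambda>x. u x * prim v x)
       = LI u * LI v"
proof -
  interpret pair_sigma_finite M M ..
  note u = L2_integrable[OF uL] and v = L2_integrable[OF vL]
  define F where "F x y = indicator {y. y \<le> x} y * u y * v x" for x y :: real
  have idm: "(\<lambda>x. x) \<in> borel_measurable M"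
    using id_borel_measurable_lebesgue_on[of "{0..l}"] by (simp add: id_def)
  have um [measurable]: "u \<in> borel_measurable M" and vm [measurable]: "v \<in> borel_measurable M"
    using u v by auto
  have Fm: "(\<lambda>(x, y). F x y) \<in> borel_measurable (M \<Otimes>\<^sub>M M)"
  proof -
    have 1: "(\<lambda>p. fst p) \<in> borel_measurable (M \<Otimes>\<^sub>M M)" "(\<lambda>p. snd p) \<in> borel_measurable (M \<Otimes>\<^sub>M M)"
      using measurable_compose[OF measurable_fst idm] measurable_compose[OF measurable_snd idm] by auto
    have "{p \<in> space (M \<Otimes>\<^sub>M M). snd p \<le> fst p} \<in> sets (M \<Otimes>\<^sub>M M)"
      using 1(2,1) by (rule borel_measurable_le)
    then have "(\<lambda>p. indicator {p \<in> space (M \<Otimes>\<^sub>M M). snd p \<le> fst p} p * u (snd p) * v (fst p)) \<in> borel_measurable (M \<Otimes>\<^sub>M M)"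
      by measurable
    then show ?thesis
      by (rule measurable_cong[THEN iffD1, rotated]) (auto simp: F_def indicator_def)
  qed
  have inner: "LI (\<lambda>y. F x y) = prim u x * v x" if "x \<in> {0..l}" for x
  proof -
    have "LI (\<lambda>y. F x y) = LI (\<lambda>y. (indicator {0..x} y * u y) * v x)"
      by (intro LI_cong) (auto simp: F_def indicator_def)
    then show ?thesis using that by (simp add: prim_indicator)
  qed
  have intF: "integrable (M \<Otimes>\<^sub>M M) (\<lambda>(x, y). F x y)"
  proof (rule dominated_integrable[OF _ Fm])
    show "integrable (M \<Otimes>\<^sub>M M) (\<lambda>(x, y). v x * u y)"
    proof (rule Fubini_integrable)
      show "(\<lambda>(x, y). v x * u y) \<in> borel_measurable (M \<Otimes>\<^sub>M M)" by measurable
      show "integrable M (\<lambda>x. LINT y|M. norm (case (x, y) of (x, y) \<Rightarrow> v x * u y))"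
        using v by (simp add: abs_mult)
    qed (use u in auto)
    show "AE p in M \<Otimes>\<^sub>M M. norm (case p of (x, y) \<Rightarrow> F x y) \<le> norm (case p of (x, y) \<Rightarrow> v x * u y)"
      by (auto simp: F_def indicator_def abs_mult)
  qed
  have "LI (\<lambda>x. prim u x * v x) = (LINT x|M. (LINT y|M. F x y))"
    using inner by (intro LI_cong) auto
  also have "\<dots> = (LINT y|M. (LINT x|M. F x y))"
    using Fubini_integral[OF intF] by simp
  also have "\<dots> = (LINT y|M. u y * (LI v - prim v y))"
  proof (intro LI_cong refl)
    fix y assume "y \<in> space M"
    then have y: "y \<in> {0..l}" by simp
    note im = indicator_Icc_meas[of y]
    have iv: "integrable M (\<lambda>x. indicator {0..y} x * v x)"
      by (rule dominated_integrable[OF v borel_measurable_times[OF im vm]])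
        (auto intro!: AE_I2 simp: indicator_def)
    \<comment> \<open>The triangle is closed and \<open>{0..y}\<close> also contains
      \<open>y\<close>, so the two integrands may differ at \<open>x = y\<close>, a null
      set.\<close>
    have "AE x in lebesgue. x \<noteq> y"
      by (rule AE_I'[of "{y}"]) (auto simp: negligible_iff_null_sets[symmetric])
    then have ne: "AE x in M. x \<noteq> y" by (subst AE_restrict_space_iff) (auto elim: eventually_mono)
    have "(LINT x|M. F x y) = (LINT x|M. u y * (v x - indicator {0..y} x * v x))"
    proof (rule integral_cong_AE)
      show "(\<lambda>x. F x y) \<in> borel_measurable M"
        using measurable_compose[OF measurable_Pair2' Fm, of y] y by simp
      show "(\<lambda>x. u y * (v x - indicator {0..y} x * v x)) \<in> borel_measurable M" using im by measurable
      show "AE x in M. F x y = u y * (v x - indicator {0..y} x * v x)"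
        using ne AE_space by eventually_elim (auto simp: F_def indicator_def)
    qed
    also have "\<dots> = u y * (LI v - prim v y)"
      using y iv v by (simp add: prim_indicator)
    finally show "(LINT x|M. F x y) = u y * (LI v - prim v y)" .
  qed
  also have "\<dots> = LI u * LI v - (LINT y|M. u y * prim v y)"
    using u L2_mult_integrable[OF uL prim_L2[OF vL]] by (simp add: right_diff_distrib)
  finally show ?thesis by simp
qed


section \<open>Weak derivatives\<close>

lemma wderivD:
  assumes "wderiv l f g"
  shows "L2 l g" "integrable M g" "\<And>x. x \<in> {0..l} \<Longrightarrow> f x = f 0 + prim g x"
  using assms L2_integrable unfolding wderiv_prim by blast+

lemma wderivI: "L2 l g \<Longrightarrow> (\<And>x. x \<in> {0..l} \<Longrightarrow> f x = f 0 + prim g x) \<Longrightarrow> wderiv l f g"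
  unfolding wderiv_prim by blast

lemma wderiv_continuous:
  assumes "wderiv l f g"
  shows "continuous_on {0..l} f"
proof -
  have "continuous_on {0..l} (\<lambda>x. f 0 + prim g x)"
    by (intro continuous_intros prim_continuous wderivD(2)[OF assms])
  then show ?thesis by (rule continuous_on_eq) (rule wderivD(3)[OF assms, symmetric])
qed

lemma H1_continuous: "H1 l f \<Longrightarrow> continuous_on {0..l} f"
  unfolding H1_def using wderiv_continuous by blast

lemma H1_L2: "H1 l f \<Longrightarrow> L2 l f"
  using L2_continuous H1_continuous by blast

lemma H2_H1: "H2 l f \<Longrightarrow> H1 l f"
  unfolding H2_def H1_def by blast

lemma wderiv_cong:
  assumes "wderiv l f g" "\<And>x. x \<in> {0..l} \<Longrightarrow> f' x = f x" "AE y in M. g y = g' y"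
  shows "wderiv l f' g'"
proof (rule wderivI)
  show L: "L2 l g'" using L2_cong_AE[OF wderivD(1)[OF assms(1)] assms(3)] .
  fix x assume x: "x \<in> {0..l}"
  have "prim g x = prim g' x"
    using assms(3) L2_meas[OF wderivD(1)[OF assms(1)]] L2_meas[OF L] x by (rule prim_cong_AE)
  then show "f' x = f' 0 + prim g' x"
    using wderivD(3)[OF assms(1) x] assms(2)[OF x] assms(2)[of 0] l_pos by simp
qed

lemma wderiv_cong_fun: "wderiv l f g \<Longrightarrow> (\<And>x. x \<in> {0..l} \<Longrightarrow> f' x = f x) \<Longrightarrow> wderiv l f' g"
  by (rule wderiv_cong) auto

lemma wderiv_unique:
  assumes "wderiv l f g" "wderiv l f g'"
  shows "AE y in M. g y = g' y"
proof -
  have "AE y in M. g y + (- 1) * g' y = 0"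
  proof (rule prim_eq_0_imp_AE)
    show "integrable M (\<lambda>y. g y + (- 1) * g' y)" using wderivD(2) assms by simp
    fix x assume x: "x \<in> {0..l}"
    have "prim (\<lambda>y. g y + (- 1) * g' y) x = prim g x + prim (\<lambda>y. (- 1) * g' y) x"
      using wderivD(2) assms x by (intro prim_add) auto
    then show "prim (\<lambda>y. g y + (- 1) * g' y) x = 0"
      using prim_scale[of "-1" g' x] wderivD(3)[OF assms(1) x] wderivD(3)[OF assms(2) x] by simp
  qed
  then show ?thesis by simp
qed

lemma continuous_AE_eq:
  fixes f g :: "real \<Rightarrow> real"
  assumes "continuous_on {0..l} f" "continuous_on {0..l} g" "AE y in M. f y = g y" "x \<in> {0..l}"
  shows "f x = g x"
proof -
  define h where "h y = \<bar>f y - g y\<bar>" for y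
  have c: "continuous_on {0..l} h" unfolding h_def using assms by (intro continuous_intros)
  have "LI h = 0"
    unfolding h_def using assms(3) by (intro integral_eq_zero_AE) (auto elim: eventually_mono)
  moreover have "(h has_integral LI h) {0..l}"
    using c by (intro has_integral_integral_lebesgue_on continuous_imp_integrable_real) auto
  ultimately have "h x = 0"
    using has_integral_0_cbox_imp_0[of 0 l h x] c assms(4) l_pos by (simp add: h_def)
  then show ?thesis by (simp add: h_def)
qed

lemma d1_wderiv:
  assumes "wderiv l f g"
  shows "wderiv l f (d1 l f)" and "AE y in M. d1 l f y = g y"
proof -
  show "wderiv l f (d1 l f)"
  proof (cases "\<exists>g. wderiv l f g \<and> H1 l g")
    case True
    then show ?thesis unfolding d1_def using someI_ex[OF True] by simp
  next
    case False
    then show ?thesis unfolding d1_def if_not_P[OF False] using someI[of "\<lambda>g. wderiv l f g", OF assms] by simp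
  qed
  then show "AE y in M. d1 l f y = g y" by (rule wderiv_unique) fact
qed

text \<open>\<open>d1\<close> prefers a derivative in \<open>H1\<close>. Two such derivatives agree
  almost everywhere and are continuous, so the chosen one is determined pointwise on the interval;
  this gives the boundary values of \<open>d1\<close> their meaning.\<close>

lemma d1_H1:
  assumes "wderiv l f g" "H1 l g"
  shows "H1 l (d1 l f)" and "\<And>x. x \<in> {0..l} \<Longrightarrow> d1 l f x = g x"
proof -
  have ex: "\<exists>g. wderiv l f g \<and> H1 l g" using assms by blast
  show H: "H1 l (d1 l f)" unfolding d1_def using ex someI_ex[OF ex] by simp
  show "d1 l f x = g x" if "x \<in> {0..l}" for x
    using continuous_AE_eq[OF H1_continuous[OF H] H1_continuous[OF assms(2)] d1_wderiv(2)[OF assms(1)] that] .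
qed

lemma d2_AE:
  assumes "wderiv l f g" "wderiv l g u"
  shows "AE y in M. d2 l f y = u y"
proof -
  have "H1 l g" using assms(2) H1_def by blast
  then have "wderiv l (d1 l f) u"
    using wderiv_cong[OF assms(2) d1_H1(2)[OF assms(1)]] by simp
  then show ?thesis unfolding d2_def by (rule d1_wderiv(2))
qed

lemma H2_wderivs:
  assumes "H2 l f"
  shows "wderiv l f (d1 l f)" "wderiv l (d1 l f) (d2 l f)"
proof -
  obtain g u where g: "wderiv l f g" "wderiv l g u" using assms unfolding H2_def H1_def by blast
  then show "wderiv l f (d1 l f)" by (intro d1_wderiv)
  have "H1 l (d1 l f)" using d1_H1(1)[OF g(1)] g(2) H1_def by blast
  then show "wderiv l (d1 l f) (d2 l f)" unfolding d2_def H1_def using d1_wderiv(1) by blast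
qed

lemma H1_wderiv: "H1 l f \<Longrightarrow> wderiv l f (d1 l f)"
  unfolding H1_def using d1_wderiv(1) by blast

lemma H2I: "wderiv l f g \<Longrightarrow> wderiv l g u \<Longrightarrow> H2 l f"
  unfolding H2_def H1_def by blast

lemma wderiv_add:
  assumes "wderiv l f f'" "wderiv l g g'"
  shows "wderiv l (\<lambda>y. f y + g y) (\<lambda>y. f' y + g' y)"
proof (rule wderivI)
  show "L2 l (\<lambda>y. f' y + g' y)" using assms wderivD(1) by simp
  show "f x + g x = f 0 + g 0 + prim (\<lambda>y. f' y + g' y) x" if "x \<in> {0..l}" for x
    using that prim_add[OF wderivD(2)[OF assms(1)] wderivD(2)[OF assms(2)]] wderivD(3)[OF assms(1) that] wderivD(3)[OF assms(2) that]
    by simp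
qed

lemma wderiv_scale:
  assumes "wderiv l f f'"
  shows "wderiv l (\<lambda>y. c * f y) (\<lambda>y. c * f' y)"
proof (rule wderivI)
  show "L2 l (\<lambda>y. c * f' y)" using assms wderivD(1) by simp
  show "c * f x = c * f 0 + prim (\<lambda>y. c * f' y) x" if "x \<in> {0..l}" for x
    using wderivD(3)[OF assms that] by (simp add: prim_scale distrib_left)
qed

lemma wderiv_lin:
  assumes "wderiv l f f'" "wderiv l g g'"
  shows "wderiv l (\<lambda>y. s * f y + t * g y) (\<lambda>y. s * f' y + t * g' y)"
  by (intro wderiv_add wderiv_scale assms)

lemma wderiv_const: "wderiv l (\<lambda>_. c) (\<lambda>_. 0)"
  by (rule wderivI) (auto simp: prim_def)

lemma prim_wderiv: "L2 l u \<Longrightarrow> wderiv l (prim u) u"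
  by (rule wderivI) auto

lemma wderiv_C1:
  assumes "\<And>x. x \<in> {0..l} \<Longrightarrow> (f has_real_derivative f' x) (at x within {0..l})" "continuous_on {0..l} f'"
  shows "wderiv l f f'"
proof (rule wderivI)
  show L: "L2 l f'" using assms(2) by (rule L2_continuous)
  fix x assume x: "x \<in> {0..l}"
  have "(f' has_integral (f x - f 0)) {0..x}"
  proof (rule fundamental_theorem_of_calculus)
    fix y assume "y \<in> {0..x}"
    then show "(f has_vector_derivative f' y) (at y within {0..x})"
      using assms(1)[of y] x unfolding has_real_derivative_iff_has_vector_derivative
      by (auto intro: has_vector_derivative_within_subset)
  qed (use x in auto)
  then show "f x = f 0 + prim f' x"
    using prim_HK[OF L2_integrable[OF L], of x] x by (simp add: integral_unique)
qed

lemma integral_prim: "LI u = prim u l"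
  by (simp add: prim_def)

text \<open>Once the constants \<open>f 0\<close> and \<open>g 0\<close> are split off, only
  primitives remain and \<open>prim_adjoint\<close> applies.\<close>

lemma integral_by_parts:
  assumes "wderiv l f f'" "wderiv l g g'"
  shows "LI (\<lambda>y. f' y * g y + f y * g' y) = f l * g l - f 0 * g 0"
proof -
  note f = wderivD[OF assms(1)] and g = wderivD[OF assms(2)]
  have i: "integrable M (\<lambda>y. prim f' y * g' y)" "integrable M (\<lambda>y. f' y * prim g' y)"
    using f(1) g(1) by (auto intro!: L2_mult_integrable)
  have "LI (\<lambda>y. f' y * g y + f y * g' y) =
    LI (\<lambda>y. f' y * (g 0 + prim g' y) + (f 0 + prim f' y) * g' y)"
  proof (intro LI_cong refl)
    fix y assume "y \<in> space M"
    then have "f y = f 0 + prim f' y" "g y = g 0 + prim g' y" using f(3)[of y] g(3)[of y] by auto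
    then show "f' y * g y + f y * g' y = f' y * (g 0 + prim g' y) + (f 0 + prim f' y) * g' y" by simp
  qed
  also have "\<dots> = LI (\<lambda>y. (g 0 * f' y + f 0 * g' y) + (prim f' y * g' y + f' y * prim g' y))"
    by (intro LI_cong) (auto simp: algebra_simps)
  also have "\<dots> = g 0 * LI f' + f 0 * LI g' + LI f' * LI g'"
    using f(2) g(2) i prim_adjoint[OF f(1) g(1)] by simp
  also have "\<dots> = f l * g l - f 0 * g 0"
  proof -
    have "f l = f 0 + prim f' l" "g l = g 0 + prim g' l" using f(3)[of l] g(3)[of l] l_pos by auto
    then show ?thesis by (simp add: integral_prim algebra_simps)
  qed
  finally show ?thesis .
qed

end

section \<open>Product rule and the sharp Poincare inequality\<close>

lemma wderiv_subinterval:
  assumes "0 < l" "wderiv l f g" "0 < x" "x \<le> l"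
  shows "wderiv x f g"
proof -
  interpret interval l by unfold_locales fact
  have L: "L2 l g" using assms(2) by (rule wderivD)
  have "integrable (lebesgue_on {0..x}) g" "integrable (lebesgue_on {0..x}) (\<lambda>y. (g y)^2)"
    using integrable_subinterval_M[OF L2_integrable[OF L] assms(4)] integrable_subinterval_M[OF L2_sq_integrable[OF L] assms(4)] .
  then have "L2 x g" unfolding L2_def by (intro conjI borel_measurable_integrable)
  moreover have "f y = f 0 + prim g y" if "y \<in> {0..x}" for y
    using that assms(4) by (intro wderivD(3)[OF assms(2)]) auto
  ultimately show ?thesis unfolding wderiv_prim by blast
qed

context interval begin

text \<open>Integration by parts on \<open>[0, x]\<close>, for each \<open>x\<close>, is precisely
  the formula that the product is a primitive.\<close>

lemma wderiv_mult:
  assumes "wderiv l f f'" "wderiv l g g'"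
  shows "wderiv l (\<lambda>y. f y * g y) (\<lambda>y. f' y * g y + f y * g' y)"
proof (rule wderivI)
  have bounded: "L2 l (\<lambda>y. a y * b y)" if "continuous_on {0..l} a" "L2 l b" for a b
  proof -
    have "compact (a ` {0..l})" using that(1) by (intro compact_continuous_image) auto
    then have "bounded (a ` {0..l})" by (rule compact_imp_bounded)
    then obtain C where "\<forall>z\<in>a ` {0..l}. norm z \<le> C"
      unfolding bounded_iff by blast
    then have "\<bar>a y\<bar> \<le> C" if "y \<in> {0..l}" for y using that by force
    then have "AE y in M. \<bar>a y\<bar> \<le> C" by (intro AE_I2) simp
    then show ?thesis by (rule L2_bounded_mult[OF L2_meas[OF L2_continuous[OF that(1)]] _ that(2)])
  qed
  show "L2 l (\<lambda>y. f' y * g y + f y * g' y)"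
    using bounded[OF wderiv_continuous[OF assms(2)] wderivD(1)[OF assms(1)]]
      bounded[OF wderiv_continuous[OF assms(1)] wderivD(1)[OF assms(2)]]
    by (simp add: mult.commute)
  fix x assume x: "x \<in> {0..l}"
  show "f x * g x = f 0 * g 0 + prim (\<lambda>y. f' y * g y + f y * g' y) x"
  proof (cases "x = 0")
    case False
    then interpret x: interval x using x by unfold_locales auto
    have "wderiv x f f'" "wderiv x g g'" using wderiv_subinterval assms x False l_pos by auto
    from x.integral_by_parts[OF this] show ?thesis by (simp add: prim_def)
  qed simp
qed

text \<open>With \<open>\<phi> = a tan (a (l - y))\<close>, which satisfies \<open>\<phi>' = - (a^2) - \<phi>^2\<close>, the difference of the two sides is
  the integral of the square \<open>(f' - \<phi> f)^2\<close>; the pole at the critical value \<open>a = \<pi> / (2 l)\<close> is avoided by a limit.\<close>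

lemma poincare:
  assumes f: "wderiv l f f'" "f 0 = 0"
  shows "LI (\<lambda>y. (f y)^2) \<le> 4 * l^2 / pi^2 * LI (\<lambda>y. (f' y)^2)"
proof -
  let ?I = "LI (\<lambda>y. (f y)^2)" and ?K = "LI (\<lambda>y. (f' y)^2)"
  have fL: "L2 l f" "L2 l f'" using wderivD(1)[OF f(1)] H1_L2 f(1) H1_def by blast+
  have sub: "a^2 * ?I \<le> ?K" if a: "0 < a" "a < pi / (2 * l)" for a
  proof -
    define \<phi> where "\<phi> y = a * tan (a * (l - y))" for y
    have cos0: "cos (a * (l - y)) \<noteq> 0" if y: "y \<in> {0..l}" for y
    proof -
      have "a * (l - y) \<le> a * l" using a y by simp
      also have "\<dots> < pi / 2" using a l_pos by (simp add: field_simps)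
      finally have "cos (a * (l - y)) > 0"
        using a y l_pos by (intro cos_gt_zero_pi) (auto intro: less_le_trans[of _ 0])
      then show ?thesis by simp
    qed
    have der: "(\<phi> has_real_derivative (- (a^2) - (\<phi> y)^2)) (at y within {0..l})" if y: "y \<in> {0..l}" for y
    proof -
      have "(\<phi> has_real_derivative (a * (inverse ((cos (a * (l - y)))^2) * (a * (0 - 1))))) (at y within {0..l})"
        unfolding \<phi>_def by (rule derivative_eq_intros refl cos0[OF y] | simp)+
      moreover have "a * (inverse ((cos (a * (l - y)))^2) * (a * (0 - 1))) = - (a^2) - (\<phi> y)^2"
      proof -
        have "inverse ((cos (a * (l - y)))^2) = 1 + (tan (a * (l - y)))^2"
          using tan_sec[OF cos0[OF y]] by (simp add: power_inverse)
        then show ?thesis by (simp add: \<phi>_def power2_eq_square algebra_simps)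
      qed
      ultimately show ?thesis by simp
    qed
    have \<phi>c: "continuous_on {0..l} \<phi>" by (rule DERIV_continuous_on[OF der])
    have "continuous_on {0..l} (\<lambda>y. - (a^2) - (\<phi> y)^2)" by (intro continuous_intros \<phi>c)
    with der have \<phi>: "wderiv l \<phi> (\<lambda>y. - (a^2) - (\<phi> y)^2)" by (rule wderiv_C1)
    have ff: "wderiv l (\<lambda>y. f y * f y) (\<lambda>y. f' y * f y + f y * f' y)" by (intro wderiv_mult f)
    let ?p = "\<lambda>y. (- (a^2) - (\<phi> y)^2) * (f y * f y) + \<phi> y * (f' y * f y + f y * f' y)"
    have prod: "wderiv l (\<lambda>y. \<phi> y * (f y * f y)) ?p"
      by (intro wderiv_mult \<phi> ff)
    \<comment> \<open>Both boundary terms vanish: at \<open>l\<close> because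
      \<open>tan 0 = 0\<close>, at 0 because \<open>f\<close> is clamped there.\<close>
    have "LI ?p = 0"
    proof -
      have "\<phi> l = 0" by (simp add: \<phi>_def)
      then show ?thesis using integral_by_parts[OF \<phi> ff] f(2) by simp
    qed
    moreover have "LI ?p
       \<le> LI (\<lambda>y. (f' y)^2 - a^2 * (f y)^2)"
    proof (rule integral_mono)
      show "integrable M (\<lambda>y. (f' y)^2 - a^2 * (f y)^2)" using fL by (simp add: L2_sq_integrable)
      show "integrable M ?p"
        using prod by (rule wderivD)
      fix y
      have "0 \<le> (f' y - \<phi> y * f y)^2" by simp
      then show "?p y \<le> (f' y)^2 - a^2 * (f y)^2"
        by (simp add: power2_eq_square algebra_simps)
    qed
    ultimately show ?thesis using fL by (simp add: L2_sq_integrable)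
  qed
  have b: "0 < pi / (2 * l)" using l_pos by simp
  have "((\<lambda>a. a^2 * ?I) \<longlongrightarrow> (pi / (2 * l))^2 * ?I) (at_left (pi / (2 * l)))"
    by (intro tendsto_intros)
  moreover have "\<forall>\<^sub>F a in at_left (pi / (2 * l)). a^2 * ?I \<le> ?K"
    using eventually_at_left_real[OF b] by eventually_elim (use sub in auto)
  ultimately have "(pi / (2 * l))^2 * ?I \<le> ?K"
    by (rule tendsto_upperbound) (simp add: trivial_limit_at_left_real)
  then show ?thesis using l_pos by (simp add: power_divide power_mult_distrib field_simps)
qed

lemma poincare2:
  assumes f: "wderiv l f f'" "wderiv l f' f''" "f 0 = 0" "f' 0 = 0"
  shows "LI (\<lambda>y. (f y)^2) \<le> 16 * l^4 / pi^4 * LI (\<lambda>y. (f'' y)^2)"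
proof -
  have "LI (\<lambda>y. (f y)^2) \<le> 4 * l^2 / pi^2 * (4 * l^2 / pi^2 * LI (\<lambda>y. (f'' y)^2))"
    using poincare[OF f(1,3)] mult_left_mono[OF poincare[OF f(2,4)], of "4 * l^2 / pi^2"] by simp
  then show ?thesis by (simp add: power2_eq_square power4_eq_xxxx mult_ac)
qed

end

text \<open>Stated with two linear projections instead of a product type, because a state is a
  right-nested quadruple, which is not literally a pair of pairs.\<close>

lemma m_dissipative_direct_sum:
  fixes p :: "'c::real_vector \<Rightarrow> 'a::real_vector" and q :: "'c \<Rightarrow> 'b::real_vector"
  assumes 1: "m_dissipative Ha ipa Ga" and 2: "m_dissipative Hb ipb Gb"
    and lin: "linear p" "linear q" and ex: "\<And>a b. \<exists>c. p c = a \<and> q c = b"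
    and eq: "\<And>x y. p x \<in> Ha \<Longrightarrow> q x \<in> Hb \<Longrightarrow> p y \<in> Ha \<Longrightarrow> q y \<in> Hb \<Longrightarrow> ip x y = ipa (p x) (p y) + ipb (q x) (q y)"
  shows "m_dissipative {c. p c \<in> Ha \<and> q c \<in> Hb} ip (\<lambda>x y. Ga (p x) (p y) \<and> Gb (q x) (q y))"
proof -
  interpret a: m_dissipative Ha ipa Ga by fact
  interpret b: m_dissipative Hb ipb Gb by fact
  let ?H = "{c. p c \<in> Ha \<and> q c \<in> Hb}"
  note lin_simps = linear_add[OF lin(1)] linear_add[OF lin(2)] linear_scale[OF lin(1)] linear_scale[OF lin(2)]
    linear_diff[OF lin(1)] linear_diff[OF lin(2)] linear_0[OF lin(1)] linear_0[OF lin(2)]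
  interpret s: semi_inner ?H ip
  proof
    show "subspace ?H" unfolding subspace_def by (auto simp: lin_simps)
    show "ip x y = ip y x" if "x \<in> ?H" "y \<in> ?H" for x y
      using that a.ip_sym[of "p x" "p y"] b.ip_sym[of "q x" "q y"] by (simp add: eq)
    show "ip (x + y) z = ip x z + ip y z" if "x \<in> ?H" "y \<in> ?H" "z \<in> ?H" for x y z
      using that by (simp add: eq lin_simps a.ip_add_left b.ip_add_left)
    show "ip (s *\<^sub>R x) z = s * ip x z" if "x \<in> ?H" "z \<in> ?H" for x z s
      using that by (simp add: eq lin_simps a.ip_scale_left b.ip_scale_left distrib_left)
    show "0 \<le> ip x x" if "x \<in> ?H" for x
      using that a.ip_nonneg b.ip_nonneg by (simp add: eq)
  qed
  have N: "s.N x = sqrt ((a.N (p x))^2 + (b.N (q x))^2)" if "x \<in> ?H" for x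
    using that by (simp add: s.N_def eq a.N_sq b.N_sq)
  have N_le: "a.N (p x) \<le> s.N x" "b.N (q x) \<le> s.N x" if "x \<in> ?H" for x
    unfolding N[OF that] by simp_all
  have N_0: "s.N x = 0 \<longleftrightarrow> a.N (p x) = 0 \<and> b.N (q x) = 0" if "x \<in> ?H" for x
    unfolding N[OF that] real_sqrt_eq_zero_cancel_iff sum_power2_eq_zero_iff ..
  show ?thesis
  proof
    fix X :: "nat \<Rightarrow> 'c"
    assume X: "\<And>n. X n \<in> ?H" and Cau: "\<And>e. e > 0 \<Longrightarrow> \<exists>M. \<forall>m\<ge>M. \<forall>n\<ge>M. s.N (X m - X n) < e"
    have "\<exists>L\<in>Ha. (\<lambda>n. a.N (p (X n) - L)) \<longlonglongrightarrow> 0"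
    proof (rule a.complete)
      show "\<exists>M. \<forall>m\<ge>M. \<forall>n\<ge>M. a.N (p (X m) - p (X n)) < e" if "e > 0" for e
      proof -
        have "a.N (p (X m) - p (X n)) \<le> s.N (X m - X n)" for m n
          using N_le(1)[OF s.H_diff[OF X[of m] X[of n]]] by (simp add: lin_simps)
        then show ?thesis using Cau[OF that] by (meson le_less_trans)
      qed
    qed (use X in auto)
    moreover have "\<exists>L\<in>Hb. (\<lambda>n. b.N (q (X n) - L)) \<longlonglongrightarrow> 0"
    proof (rule b.complete)
      show "\<exists>M. \<forall>m\<ge>M. \<forall>n\<ge>M. b.N (q (X m) - q (X n)) < e" if "e > 0" for e
      proof -
        have "b.N (q (X m) - q (X n)) \<le> s.N (X m - X n)" for m n
          using N_le(2)[OF s.H_diff[OF X[of m] X[of n]]] by (simp add: lin_simps)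
        then show ?thesis using Cau[OF that] by (meson le_less_trans)
      qed
    qed (use X in auto)
    ultimately obtain c where c: "p c \<in> Ha" "(\<lambda>n. a.N (p (X n) - p c)) \<longlonglongrightarrow> 0"
        "q c \<in> Hb" "(\<lambda>n. b.N (q (X n) - q c)) \<longlonglongrightarrow> 0"
      by (metis ex)
    have "(\<lambda>n. sqrt ((a.N (p (X n) - p c))^2 + (b.N (q (X n) - q c))^2)) \<longlonglongrightarrow> sqrt (0^2 + 0^2)"
      by (intro tendsto_intros c)
    moreover have "s.N (X n - c) = sqrt ((a.N (p (X n) - p c))^2 + (b.N (q (X n) - q c))^2)" for n
      using N[of "X n - c"] X[of n] c by (simp add: lin_simps)
    ultimately show "\<exists>L\<in>?H. (\<lambda>n. s.N (X n - L)) \<longlonglongrightarrow> 0" using c by (intro bexI[of _ c]) auto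
  next
    fix x y x' y'
    assume G: "Ga (p x) (p y) \<and> Gb (q x) (q y)" and H: "x' \<in> ?H" "y' \<in> ?H" "s.N (x - x') = 0" "s.N (y - y') = 0"
    have "x - x' \<in> ?H" "y - y' \<in> ?H" using G H a.G_H b.G_H by (auto simp: lin_simps)
    then have "a.N (p x - p x') = 0" "b.N (q x - q x') = 0" "a.N (p y - p y') = 0" "b.N (q y - q y') = 0"
      using N_0[of "x - x'"] N_0[of "y - y'"] H by (auto simp: lin_simps)
    then show "Ga (p x') (p y') \<and> Gb (q x') (q y')" using G H a.G_cong b.G_cong by blast
  next
    fix y assume "Ga (p 0) (p y) \<and> Gb (q 0) (q y)"
    then show "s.N y = 0" using N_0[of y] a.G_single b.G_single a.G_H b.G_H by (auto simp: lin_simps)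
  next
    fix t :: real and y assume "t > 0" "y \<in> ?H"
    then obtain u v where "Ga u ((1 / t) *\<^sub>R (u - p y))" "Gb v ((1 / t) *\<^sub>R (v - q y))"
      using a.G_range[of t "p y"] b.G_range[of t "q y"] by auto
    moreover obtain c where "p c = u" "q c = v" using ex by blast
    ultimately show "\<exists>x. Ga (p x) (p ((1 / t) *\<^sub>R (x - y))) \<and> Gb (q x) (q ((1 / t) *\<^sub>R (x - y)))"
      by (intro exI[of _ c]) (simp add: lin_simps)
  next
    show "x \<in> ?H \<and> y \<in> ?H" if "Ga (p x) (p y) \<and> Gb (q x) (q y)" for x y
      using that a.G_H b.G_H by blast
    show "Ga (p (s *\<^sub>R x + t *\<^sub>R x')) (p (s *\<^sub>R y + t *\<^sub>R y')) \<and> Gb (q (s *\<^sub>R x + t *\<^sub>R x')) (q (s *\<^sub>R y + t *\<^sub>R y'))"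
      if "Ga (p x) (p y) \<and> Gb (q x) (q y)" "Ga (p x') (p y') \<and> Gb (q x') (q y')" for x y x' y' s t
      using that a.G_lin b.G_lin unfolding lin_simps by blast
    show "ip y x \<le> 0" if "Ga (p x) (p y) \<and> Gb (q x) (q y)" for x y
      using that a.G_diss[of "p x" "p y"] b.G_diss[of "q x" "q y"] a.G_H[of "p x" "p y"] b.G_H[of "q x" "q y"]
      by (simp add: eq)
  qed
qed

lemma subspace_linI:
  assumes "0 \<in> S" "\<And>x y s t. x \<in> S \<Longrightarrow> y \<in> S \<Longrightarrow> s *\<^sub>R x + t *\<^sub>R y \<in> S"
  shows "subspace S"
proof (rule subspaceI[OF assms(1)])
  show "x + y \<in> S" if "x \<in> S" "y \<in> S" for x y using assms(2)[OF that, of 1 1] by simp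
  show "c *\<^sub>R x \<in> S" if "x \<in> S" for x c using assms(2)[OF that that, of c 0] by simp
qed

section \<open>Weighted inner products\<close>

context interval begin

definition W :: "fn \<Rightarrow> fn \<Rightarrow> fn \<Rightarrow> real"
  where "W a u v = LI (\<lambda>y. a y * u y * v y)"

lemma W_integrable [simp]: "Linf l a \<Longrightarrow> L2 l u \<Longrightarrow> L2 l v \<Longrightarrow> integrable M (\<lambda>y. a y * u y * v y)"
  by (rule L2_mult_integrable[OF L2_Linf_mult])

lemma Linf_mult:
  assumes "Linf l b" "Linf l b'"
  shows "Linf l (\<lambda>y. b y * b' y)"
proof -
  obtain B B' where B: "AE y in M. \<bar>b y\<bar> \<le> B" "AE y in M. \<bar>b' y\<bar> \<le> B'" using assms unfolding Linf_def by blast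
  have "AE y in M. \<bar>b y * b' y\<bar> \<le> B * B'"
    using B by eventually_elim (auto simp: abs_mult intro!: mult_mono)
  then show ?thesis using assms unfolding Linf_def by (auto intro: borel_measurable_times)
qed

lemma W_sym: "W a u v = W a v u"
  unfolding W_def by (intro LI_cong) (auto simp: mult_ac)

lemma W_add_left:
  assumes "Linf l a" "L2 l u" "L2 l v" "L2 l w"
  shows "W a (\<lambda>y. u y + v y) w = W a u w + W a v w"
  unfolding W_def using W_integrable[OF assms(1,2,4)] W_integrable[OF assms(1,3,4)]
  by (simp add: distrib_left distrib_right)

lemma W_scale_left: "W a (\<lambda>y. c * u y) w = c * W a u w"
proof -
  have "W a (\<lambda>y. c * u y) w = LI (\<lambda>y. c * (a y * u y * w y))"
    unfolding W_def by (intro LI_cong) (auto simp: mult_ac)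
  then show ?thesis by (simp add: W_def)
qed

lemma W_cong:
  assumes "Linf l a" "L2 l u" "L2 l v" "L2 l u'" "L2 l v'" "AE y in M. u y = u' y" "AE y in M. v y = v' y"
  shows "W a u v = W a u' v'"
  unfolding W_def
proof (rule integral_cong_AE)
  show "AE y in M. a y * u y * v y = a y * u' y * v' y" using assms(6,7) by eventually_elim simp
qed (use assms in "auto intro: borel_measurable_integrable")

lemma W_lower:
  assumes "Linf l a" "L2 l u" "AE y in M. c \<le> a y"
  shows "c * (L2.N u)^2 \<le> W a u u"
  unfolding L2_N_sq[OF assms(2)] W_def integral_mult_right_zero[symmetric]
proof (rule integral_mono_AE)
  show "AE y in M. c * (u y)^2 \<le> a y * u y * u y"
    using assms(3) by eventually_elim (simp add: power2_eq_square mult.assoc mult_right_mono)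
qed (use assms in "auto simp: L2_sq_integrable")

lemma W_upper:
  assumes "Linf l a" "L2 l u" "AE y in M. a y \<le> c"
  shows "W a u u \<le> c * (L2.N u)^2"
  unfolding L2_N_sq[OF assms(2)] W_def integral_mult_right_zero[symmetric]
proof (rule integral_mono_AE)
  show "AE y in M. a y * u y * u y \<le> c * (u y)^2"
    using assms(3) by eventually_elim (simp add: power2_eq_square mult.assoc mult_right_mono)
qed (use assms in "auto simp: L2_sq_integrable")

text \<open>The interval has positive length. Hence properties that hold almost everywhere hold
  somewhere, which turns bounds on functions into inequalities between the constants.\<close>

lemma not_AE_False: "\<not> (AE y in M. False)"
proof -
  have "emeasure M (space M) \<noteq> 0" using l_pos by (simp add: emeasure_restrict_space)
  then show ?thesis unfolding eventually_False ae_filter_eq_bot_iff .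
qed

lemma W_bound:
  assumes "Linf l a" "L2 l u" "L2 l v" "AE y in M. \<bar>a y\<bar> \<le> C"
  shows "\<bar>W a u v\<bar> \<le> C * L2.N u * L2.N v"
proof -
  have au: "L2 l (\<lambda>y. a y * u y)" using assms by (simp add: L2_Linf_mult)
  have C: "0 \<le> C"
  proof (rule ccontr)
    assume "\<not> 0 \<le> C"
    then have "AE y in M. False" using assms(4) by (auto elim!: eventually_mono)
    then show False using not_AE_False by blast
  qed
  have "(L2.N (\<lambda>y. a y * u y))^2 \<le> (C * L2.N u)^2"
    unfolding power_mult_distrib L2_N_sq[OF au] L2_N_sq[OF assms(2)] integral_mult_right_zero[symmetric]
  proof (rule integral_mono_AE)
    show "AE y in M. (a y)^2 * (u y)^2 \<le> C^2 * (u y)^2"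
      using assms(4)
    proof eventually_elim
      case (elim y)
      then have "(a y)^2 \<le> C^2" using abs_le_square_iff[of "a y" C] by linarith
      then show ?case by (rule mult_right_mono) simp
    qed
    show "integrable M (\<lambda>y. (a y)^2 * (u y)^2)" using L2_sq_integrable[OF au] by (simp add: power_mult_distrib)
  qed (use assms in "auto simp: L2_sq_integrable")
  then have "L2.N (\<lambda>y. a y * u y) \<le> C * L2.N u"
    by (rule power2_le_imp_le) (use C assms in simp)
  then have "L2.N (\<lambda>y. a y * u y) * L2.N v \<le> C * L2.N u * L2.N v"
    using assms by (intro mult_right_mono) auto
  moreover have "\<bar>W a u v\<bar> \<le> L2.N (\<lambda>y. a y * u y) * L2.N v"
    using L2.Cauchy_Schwarz[of "\<lambda>y. a y * u y" v] au assms(3) by (simp add: W_def)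
  ultimately show ?thesis by linarith
qed

end

section \<open>One damped component\<close>

text \<open>The bending and the torsion equations are both instances: \<open>Dv\<close> is the spatial derivative of order two
  (resp. one) on the space \<open>V\<close> of functions clamped at \<open>0\<close>, and \<open>St S m b\<close> says that the stress
  resultant \<open>S\<close> has weak derivative data \<open>m\<close> inside and \<open>b\<close> at the free end.\<close>

locale component = interval +
  fixes V :: "fn \<Rightarrow> bool" and Dv :: "fn \<Rightarrow> fn"
    and St :: "fn \<Rightarrow> fn \<Rightarrow> real \<Rightarrow> bool" and \<gamma> C0 :: real
  assumes V_subspace: "subspace {f. V f}"
    and V_L2: "V f \<Longrightarrow> L2 l f" and Dv_L2: "V f \<Longrightarrow> L2 l (Dv f)"
    and Dv_lin: "V f \<Longrightarrow> V g \<Longrightarrow> AE y in M. Dv (s *\<^sub>R f + t *\<^sub>R g) y = s * Dv f y + t * Dv g y"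
    and Dv_surj: "L2 l u \<Longrightarrow> \<exists>f. V f \<and> (AE y in M. Dv f y = u y)"
    and V_poincare: "V f \<Longrightarrow> (L2.N f)^2 \<le> \<gamma> * (L2.N (Dv f))^2"
    and V_endpoint: "V f \<Longrightarrow> \<bar>f l\<bar> \<le> C0 * L2.N (Dv f)"
    and \<gamma>_pos: "0 < \<gamma>" and C0_pos: "0 < C0"
    and St_ex: "L2 l m \<Longrightarrow> \<exists>S. St S m b"
    and St_L2: "St S m b \<Longrightarrow> L2 l S" and St_L2': "St S m b \<Longrightarrow> L2 l m"
    and St_lin: "St S m b \<Longrightarrow> St S' m' b' \<Longrightarrow> St (s *\<^sub>R S + t *\<^sub>R S') (s *\<^sub>R m + t *\<^sub>R m') (s * b + t * b')"
    and St_cong: "St S m b \<Longrightarrow> (AE y in lebesgue_on {0..l}. m y = m' y) \<Longrightarrow> St S m' b"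
    and St_inj: "St S m b \<Longrightarrow> (AE y in lebesgue_on {0..l}. S y = 0) \<Longrightarrow> (AE y in lebesgue_on {0..l}. m y = 0)"
    and St_green: "St S m b \<Longrightarrow> V \<phi> \<Longrightarrow> LI (\<lambda>y. m y * \<phi> y) = - b * \<phi> l - LI (\<lambda>y. S y * Dv \<phi> y)"
begin

lemma V_add [simp]: "V f \<Longrightarrow> V g \<Longrightarrow> V (f + g)"
  using subspace_add[OF V_subspace] by auto
lemma V_scale [simp]: "V f \<Longrightarrow> V (c *\<^sub>R f)"
  using subspace_scale[OF V_subspace] by auto
lemma V_diff [simp]: "V f \<Longrightarrow> V g \<Longrightarrow> V (f - g)"
  using subspace_diff[OF V_subspace] by auto
lemma V_zero [simp]: "V 0"
  using subspace_0[OF V_subspace] by auto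

lemma Dv_add: "V f \<Longrightarrow> V g \<Longrightarrow> AE y in M. Dv (f + g) y = Dv f y + Dv g y"
  using Dv_lin[of f g 1 1] by simp

lemma Dv_diff: "V f \<Longrightarrow> V g \<Longrightarrow> AE y in M. Dv (f - g) y = Dv f y - Dv g y"
  using Dv_lin[of f g 1 "-1"] by simp

lemma Dv_scale: "V f \<Longrightarrow> AE y in M. Dv (c *\<^sub>R f) y = c * Dv f y"
  using Dv_lin[of f f c 0] by simp

lemma V_null:
  assumes "V f" "AE y in M. Dv f y = 0"
  shows "AE y in M. f y = 0" "f l = 0"
proof -
  have 0: "L2.N (Dv f) = 0" using L2_N_eq_0_iff[OF Dv_L2[OF assms(1)]] assms(2) by simp
  then have "L2.N f = 0" using V_poincare[OF assms(1)] by simp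
  then show "AE y in M. f y = 0" using L2_N_eq_0_iff[OF V_L2[OF assms(1)]] by simp
  show "f l = 0" using V_endpoint[OF assms(1)] 0 by simp
qed

text \<open>A right inverse of \<open>Dv\<close>. Functions in \<open>V\<close> are controlled by
  \<open>Dv\<close>, so it is determined almost everywhere and at the endpoint \<open>l\<close>; see
  \<open>V_null\<close>.\<close>

definition lift :: "fn \<Rightarrow> fn"
  where "lift u = (SOME f. V f \<and> (AE y in M. Dv f y = u y))"

lemma lift: "L2 l u \<Longrightarrow> V (lift u)" "L2 l u \<Longrightarrow> AE y in M. Dv (lift u) y = u y"
  using someI_ex[OF Dv_surj[of u]] unfolding lift_def by blast+

lemma L2_N_cong: "L2 l u \<Longrightarrow> L2 l v \<Longrightarrow> AE y in M. u y = v y \<Longrightarrow> L2.N u = L2.N v"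
  using L2.N_cong[of u v] L2_N_eq_0_iff[of "u - v"] by (auto simp: fun_diff_def)

lemma lift_N:
  assumes "L2 l u"
  shows "(L2.N (lift u))^2 \<le> \<gamma> * (L2.N u)^2" "\<bar>lift u l\<bar> \<le> C0 * L2.N u"
  using V_poincare[OF lift(1)[OF assms]] V_endpoint[OF lift(1)[OF assms]]
    L2_N_cong[OF Dv_L2[OF lift(1)[OF assms]] assms lift(2)[OF assms]] by auto

end

text \<open>\<open>a\<close> is the stiffness, \<open>r\<close> the mass density, \<eta> the damping
  and \<open>k\<close> the boundary gain. The two middle conditions on \<epsilon> express \<epsilon>
  < 1 / \<open>Km\<close>. The last one is \<epsilon> at most
  \<open>4 * c / (4 * \<gamma> * r1 + \<eta>1 * c)\<close>, which for the respective Poincare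
  constants \<gamma> is \<open>eps1_star\<close> or \<open>eps2_star\<close>.\<close>

locale damped_component = component +
  fixes a r \<eta> :: "real \<Rightarrow> real" and k \<epsilon> a0 r0 r1 c \<eta>1 :: real
  assumes a: "Linf l a" and r: "Linf l r" and \<eta>: "Linf l \<eta>"
    and a0: "0 < a0" "AE y in lebesgue_on {0..l}. a0 \<le> a y"
    and r0: "0 < r0" "AE y in lebesgue_on {0..l}. r0 \<le> r y"
    and r1: "0 < r1" "AE y in lebesgue_on {0..l}. r y \<le> r1"
    and c: "0 < c" "AE y in lebesgue_on {0..l}. c \<le> \<eta> y * a y"
    and \<eta>1: "0 < \<eta>1" "AE y in lebesgue_on {0..l}. \<eta> y \<le> \<eta>1"
    and k: "0 \<le> k" and \<epsilon>: "0 < \<epsilon>" "\<epsilon> * sqrt r1 < 1" "\<epsilon> * (\<gamma> * sqrt r1) < a0"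
      "\<epsilon> * (4 * \<gamma> * r1 + \<eta>1 * c) \<le> 4 * c"
begin

lemma \<eta>a: "Linf l (\<lambda>y. \<eta> y * a y)"
  using Linf_mult \<eta> a .

section \<open>The perturbed energy of one component\<close>

definition phase :: "(fn \<times> fn) set" where "phase = {(f, g). V f \<and> L2 l g}"

definition E :: "fn \<times> fn \<Rightarrow> fn \<times> fn \<Rightarrow> real" where
  "E X Y = W a (Dv (fst X)) (Dv (fst Y)) + W r (snd X) (snd Y)
     + \<epsilon> * (W r (fst X) (snd Y) + W r (snd X) (fst Y))"

lemma phase_D: "X \<in> phase \<Longrightarrow> V (fst X)" "X \<in> phase \<Longrightarrow> L2 l (snd X)" "X \<in> phase \<Longrightarrow> L2 l (fst X)" "X \<in> phase \<Longrightarrow> L2 l (Dv (fst X))"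
  unfolding phase_def using V_L2 Dv_L2 by auto

lemma phase_subspace: "subspace phase"
proof -
  have "phase = {f. V f} \<times> {g. L2 l g}" by (auto simp: phase_def)
  then show ?thesis using subspace_Times[OF V_subspace L2.H_subspace] by simp
qed

lemma W_Dv_add:
  assumes "X \<in> phase" "Y \<in> phase" "L2 l v"
  shows "W a (Dv (fst X + fst Y)) v = W a (Dv (fst X)) v + W a (Dv (fst Y)) v"
proof -
  have "W a (Dv (fst X + fst Y)) v = W a (\<lambda>y. Dv (fst X) y + Dv (fst Y) y) v"
    by (rule W_cong[OF a]) (use assms phase_D Dv_add Dv_L2[OF V_add] in auto)
  also have "\<dots> = W a (Dv (fst X)) v + W a (Dv (fst Y)) v"
    by (rule W_add_left[OF a]) (use assms phase_D in auto)
  finally show ?thesis .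
qed

lemma W_Dv_scale:
  assumes "X \<in> phase" "L2 l v"
  shows "W a (Dv (s *\<^sub>R fst X)) v = s * W a (Dv (fst X)) v"
proof -
  have "W a (Dv (s *\<^sub>R fst X)) v = W a (\<lambda>y. s * Dv (fst X) y) v"
    by (rule W_cong[OF a]) (use assms phase_D Dv_scale Dv_L2[OF V_scale] in auto)
  then show ?thesis by (simp add: W_scale_left)
qed

definition E0 :: "fn \<times> fn \<Rightarrow> real"
  where "E0 X = W a (Dv (fst X)) (Dv (fst X)) + W r (snd X) (snd X)"

lemma W_r_nonneg: "L2 l g \<Longrightarrow> 0 \<le> W r g g"
  by (rule order_trans[OF _ W_lower[OF r _ r0(2)]]) (use r0(1) in auto)

lemma W_a_nonneg: "L2 l g \<Longrightarrow> 0 \<le> W a g g"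
  by (rule order_trans[OF _ W_lower[OF a _ a0(2)]]) (use a0(1) in auto)

lemma E0_nonneg: "X \<in> phase \<Longrightarrow> 0 \<le> E0 X"
  unfolding E0_def using W_r_nonneg W_a_nonneg phase_D by simp

text \<open>Young's inequality \<open>2 r f g \<le> \<surd>r1 (f^2 + r g^2)\<close> and Poincare bound the cross term by \<open>\<theta> E0\<close> with \<open>\<theta> < 1\<close>.\<close>

lemma cross_term:
  obtains \<theta> where "0 \<le> \<theta>" "\<theta> < 1" "\<And>X. X \<in> phase \<Longrightarrow> \<bar>2 * \<epsilon> * W r (fst X) (snd X)\<bar> \<le> \<theta> * E0 X"
proof
  define \<theta> where "\<theta> = max (\<epsilon> * sqrt r1) (\<epsilon> * (\<gamma> * sqrt r1) / a0)"
  show "0 \<le> \<theta>" "\<theta> < 1" using \<epsilon> a0 r1 by (auto simp: \<theta>_def le_max_iff_disj)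
  fix X assume X: "X \<in> phase"
  obtain f g where fg: "X = (f, g)" by force
  have fgL: "V f" "L2 l f" "L2 l g" "L2 l (Dv f)" using phase_D[OF X] by (auto simp: fg)
  have "\<bar>2 * W r f g\<bar> \<le> LI (\<lambda>y. sqrt r1 * (f y)^2 + sqrt r1 * (r y * g y * g y))"
  proof -
    have "\<bar>2 * W r f g\<bar> \<le> LI (\<lambda>y. \<bar>2 * (r y * f y * g y)\<bar>)"
      unfolding W_def integral_mult_right_zero[symmetric] by (rule integral_abs_bound)
    also have "\<dots> \<le> LI (\<lambda>y. sqrt r1 * (f y)^2 + sqrt r1 * (r y * g y * g y))"
    proof (rule integral_mono_AE)
      show "AE y in M. \<bar>2 * (r y * f y * g y)\<bar> \<le> sqrt r1 * (f y)^2 + sqrt r1 * (r y * g y * g y)"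
        using r0(2) r1(2)
      proof eventually_elim
        case (elim y)
        \<comment> \<open>Half of the weight \<open>r\<close> stays with \<open>g\<close> and the
          other half is absorbed into \<open>sqrt r1\<close>; this is where the square roots in
          \<open>Km\<close> come from.\<close>
        define s where "s = sqrt (r y)"
        have s: "0 \<le> s" "s \<le> sqrt r1" "r y = s * s" using elim r0(1) by (auto simp: s_def)
        have "2 * \<bar>f y\<bar> * \<bar>s * g y\<bar> \<le> (f y)^2 + (s * g y)^2"
          using sum_squares_bound[of "\<bar>f y\<bar>" "\<bar>s * g y\<bar>"] by simp
        then have "s * (2 * \<bar>f y\<bar> * \<bar>s * g y\<bar>) \<le> sqrt r1 * ((f y)^2 + (s * g y)^2)"
          using s r1(1) by (intro mult_mono) auto
        moreover have "\<bar>2 * (r y * f y * g y)\<bar> = s * (2 * \<bar>f y\<bar> * \<bar>s * g y\<bar>)"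
          using s(1) by (simp add: s(3) abs_mult mult_ac)
        ultimately show ?case by (simp add: s(3) power2_eq_square algebra_simps)
      qed
    qed (use fgL r in "auto simp: L2_sq_integrable")
    finally show ?thesis .
  qed
  also have "\<dots> = sqrt r1 * (L2.N f)^2 + sqrt r1 * W r g g"
    using fgL r by (simp add: L2_sq_integrable L2_N_sq W_def)
  also have "\<dots> \<le> sqrt r1 * (\<gamma> * (W a (Dv f) (Dv f) / a0)) + sqrt r1 * W r g g"
  proof -
    have "(L2.N (Dv f))^2 \<le> W a (Dv f) (Dv f) / a0"
      using W_lower[OF a fgL(4) a0(2)] a0(1) by (simp add: field_simps)
    then have "(L2.N f)^2 \<le> \<gamma> * (W a (Dv f) (Dv f) / a0)"
      using V_poincare[OF fgL(1)] mult_left_mono[of "(L2.N (Dv f))^2" "W a (Dv f) (Dv f) / a0" \<gamma>] \<gamma>_pos by linarith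
    then show ?thesis using r1(1) by (intro add_right_mono mult_left_mono) auto
  qed
  finally have "\<epsilon> * \<bar>2 * W r f g\<bar> \<le> \<epsilon> * (sqrt r1 * (\<gamma> * (W a (Dv f) (Dv f) / a0)) + sqrt r1 * W r g g)"
    using \<epsilon>(1) by (intro mult_left_mono) auto
  also have "\<dots> = \<epsilon> * (\<gamma> * sqrt r1) / a0 * W a (Dv f) (Dv f) + \<epsilon> * sqrt r1 * W r g g"
    by (simp add: algebra_simps)
  also have "\<dots> \<le> \<theta> * W a (Dv f) (Dv f) + \<theta> * W r g g"
    using W_r_nonneg W_a_nonneg fgL by (intro add_mono mult_right_mono) (auto simp: \<theta>_def)
  finally show "\<bar>2 * \<epsilon> * W r (fst X) (snd X)\<bar> \<le> \<theta> * E0 X"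
    using \<epsilon>(1) by (simp add: fg E0_def abs_mult distrib_left mult_ac)
qed

lemma E_diag: "E X X = E0 X + 2 * \<epsilon> * W r (fst X) (snd X)"
  unfolding E_def E0_def using W_sym[of r "snd X" "fst X"] by simp

sublocale B: semi_inner phase E
proof
  show "subspace phase" by (rule phase_subspace)
next
  fix X Y assume "X \<in> phase" "Y \<in> phase"
  show "E X Y = E Y X" unfolding E_def using W_sym by (metis add.commute)
next
  fix X Y Z assume H: "X \<in> phase" "Y \<in> phase" "Z \<in> phase"
  note L = phase_D[OF H(1)] phase_D[OF H(2)] phase_D[OF H(3)]
  have "W r (fst X + fst Y) (snd Z) = W r (fst X) (snd Z) + W r (fst Y) (snd Z)"
    "W r (snd X + snd Y) (fst Z) = W r (snd X) (fst Z) + W r (snd Y) (fst Z)"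
    "W r (snd X + snd Y) (snd Z) = W r (snd X) (snd Z) + W r (snd Y) (snd Z)"
    unfolding plus_fun_def using L by (auto intro!: W_add_left r)
  then show "E (X + Y) Z = E X Z + E Y Z"
    unfolding E_def using W_Dv_add[OF H(1,2) L(12)] by (simp add: algebra_simps)
next
  fix X Z s assume H: "X \<in> phase" "Z \<in> phase"
  have "W r (s *\<^sub>R u) v = s * W r u v" for u v
    unfolding scaleR_fun_def using W_scale_left by simp
  then show "E (s *\<^sub>R X) Z = s * E X Z"
    unfolding E_def using W_Dv_scale[OF H(1) phase_D(4)[OF H(2)]] by (simp add: algebra_simps)
next
  fix X assume X: "X \<in> phase"
  obtain \<theta> where "0 \<le> \<theta>" "\<theta> < 1" "\<bar>2 * \<epsilon> * W r (fst X) (snd X)\<bar> \<le> \<theta> * E0 X"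
    using cross_term X by metis
  moreover have "\<theta> * E0 X \<le> 1 * E0 X"
    using E0_nonneg[OF X] \<open>\<theta> < 1\<close> by (intro mult_right_mono) auto
  ultimately show "0 \<le> E X X" unfolding E_diag by linarith
qed

lemma E_lower:
  obtains \<delta> where "\<delta> > 0" "\<And>X. X \<in> phase \<Longrightarrow> \<delta> * E0 X \<le> E X X"
proof -
  obtain \<theta> where \<theta>: "0 \<le> \<theta>" "\<theta> < 1" "\<And>X. X \<in> phase \<Longrightarrow> \<bar>2 * \<epsilon> * W r (fst X) (snd X)\<bar> \<le> \<theta> * E0 X"
    using cross_term by metis
  show ?thesis
  proof (rule that[of "1 - \<theta>"])
    show "(1 - \<theta>) * E0 X \<le> E X X" if "X \<in> phase" for X
      using \<theta>(3)[OF that] unfolding E_diag left_diff_distrib by linarith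
  qed (use \<theta> in simp)
qed

lemma E_upper: "X \<in> phase \<Longrightarrow> E X X \<le> 2 * E0 X"
proof -
  assume X: "X \<in> phase"
  obtain \<theta> where "0 \<le> \<theta>" "\<theta> < 1" "\<bar>2 * \<epsilon> * W r (fst X) (snd X)\<bar> \<le> \<theta> * E0 X"
    using cross_term X by metis
  moreover have "\<theta> * E0 X \<le> 1 * E0 X"
    using E0_nonneg[OF X] \<open>\<theta> < 1\<close> by (intro mult_right_mono) auto
  ultimately show ?thesis unfolding E_diag by linarith
qed

text \<open>In the coordinates \<open>Dv f\<close> and \<open>g\<close> the seminorm is equivalent
  to that of two copies of L2. Null vectors and completeness are read off there.\<close>

lemma E0_equiv:
  obtains d D where "0 < d" "0 < D"
    "\<And>X. X \<in> phase \<Longrightarrow> L2.N (Dv (fst X)) \<le> d * B.N X" "\<And>X. X \<in> phase \<Longrightarrow> L2.N (snd X) \<le> d * B.N X"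
    "\<And>X. X \<in> phase \<Longrightarrow> (B.N X)^2 \<le> D * ((L2.N (Dv (fst X)))^2 + (L2.N (snd X))^2)"
proof -
  obtain \<delta> where \<delta>: "\<delta> > 0" "\<And>X. X \<in> phase \<Longrightarrow> \<delta> * E0 X \<le> E X X" using E_lower by blast
  obtain A where A: "AE y in M. \<bar>a y\<bar> \<le> A" using a unfolding Linf_def by blast
  define d where "d = sqrt (1 / (\<delta> * a0)) + sqrt (1 / (\<delta> * r0))"
  define D where "D = 2 * (\<bar>A\<bar> + r1)"
  have bd: "x \<le> sqrt (1 / q) * y" if "q * x^2 \<le> y^2" "0 < q" "0 \<le> y" for x y q :: real
  proof -
    have "x^2 \<le> y^2 / q" using that by (simp add: field_simps)
    then have "x \<le> sqrt (y^2 / q)" by (rule real_le_rsqrt)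
    then show ?thesis using that by (simp add: real_sqrt_divide)
  qed
  have 1: "\<delta> * a0 * (L2.N (Dv (fst X)))^2 \<le> (B.N X)^2" "\<delta> * r0 * (L2.N (snd X))^2 \<le> (B.N X)^2" if X: "X \<in> phase" for X
  proof -
    note L = phase_D[OF X]
    have "a0 * (L2.N (Dv (fst X)))^2 \<le> E0 X" "r0 * (L2.N (snd X))^2 \<le> E0 X"
      unfolding E0_def using W_lower[OF a L(4) a0(2)] W_lower[OF r L(2) r0(2)] W_r_nonneg[OF L(2)] W_a_nonneg[OF L(4)]
      by linarith+
    then have "\<delta> * (a0 * (L2.N (Dv (fst X)))^2) \<le> \<delta> * E0 X" "\<delta> * (r0 * (L2.N (snd X))^2) \<le> \<delta> * E0 X"
      using \<delta>(1) by (auto intro!: mult_left_mono)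
    then show "\<delta> * a0 * (L2.N (Dv (fst X)))^2 \<le> (B.N X)^2" "\<delta> * r0 * (L2.N (snd X))^2 \<le> (B.N X)^2"
      using \<delta>(2)[OF X] B.N_sq[OF X] by (simp_all add: mult.assoc)
  qed
  show ?thesis
  proof (rule that[of d D])
    show "0 < d" using \<delta> a0 r0 unfolding d_def by (intro add_pos_pos) auto
    show "0 < D" using r1 by (simp add: D_def)
    fix X assume X: "X \<in> phase"
    note L = phase_D[OF X]
    have n: "0 \<le> B.N X" using X by simp
    have s: "0 \<le> sqrt (1 / (\<delta> * a0)) * B.N X" "0 \<le> sqrt (1 / (\<delta> * r0)) * B.N X" using \<delta> a0 r0 n by auto
    show "L2.N (Dv (fst X)) \<le> d * B.N X" "L2.N (snd X) \<le> d * B.N X"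
      unfolding d_def distrib_right using bd[OF 1(1)[OF X] _ n] bd[OF 1(2)[OF X] _ n] \<delta>(1) a0(1) r0(1) s by auto
    have "AE y in M. a y \<le> \<bar>A\<bar>" using A by eventually_elim auto
    then have "W a (Dv (fst X)) (Dv (fst X)) \<le> \<bar>A\<bar> * (L2.N (Dv (fst X)))^2" by (rule W_upper[OF a L(4)])
    moreover have "\<dots> \<le> (\<bar>A\<bar> + r1) * (L2.N (Dv (fst X)))^2" using r1 by (intro mult_right_mono) auto
    moreover have "W r (snd X) (snd X) \<le> r1 * (L2.N (snd X))^2" by (rule W_upper[OF r L(2) r1(2)])
    moreover have "\<dots> \<le> (\<bar>A\<bar> + r1) * (L2.N (snd X))^2" by (intro mult_right_mono) auto
    ultimately have "E0 X \<le> (\<bar>A\<bar> + r1) * ((L2.N (Dv (fst X)))^2 + (L2.N (snd X))^2)"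
      unfolding E0_def distrib_left by linarith
    then show "(B.N X)^2 \<le> D * ((L2.N (Dv (fst X)))^2 + (L2.N (snd X))^2)"
      using E_upper[OF X] B.N_sq[OF X] unfolding D_def mult.assoc[of 2] by linarith
  qed
qed

lemma B_N_eq_0_iff:
  assumes "X \<in> phase"
  shows "B.N X = 0 \<longleftrightarrow> (AE y in M. Dv (fst X) y = 0) \<and> (AE y in M. snd X y = 0)"
proof -
  note L = phase_D[OF assms]
  obtain d D where dD: "0 < d" "0 < D"
    "\<And>X. X \<in> phase \<Longrightarrow> L2.N (Dv (fst X)) \<le> d * B.N X" "\<And>X. X \<in> phase \<Longrightarrow> L2.N (snd X) \<le> d * B.N X"
    "\<And>X. X \<in> phase \<Longrightarrow> (B.N X)^2 \<le> D * ((L2.N (Dv (fst X)))^2 + (L2.N (snd X))^2)"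
    by (rule E0_equiv) blast
  have "B.N X = 0 \<longleftrightarrow> L2.N (Dv (fst X)) = 0 \<and> L2.N (snd X) = 0"
  proof
    assume "B.N X = 0"
    then show "L2.N (Dv (fst X)) = 0 \<and> L2.N (snd X) = 0"
      using dD(3,4)[OF assms] L2.N_nonneg[of "Dv (fst X)"] L2.N_nonneg[of "snd X"] L by simp
  next
    assume "L2.N (Dv (fst X)) = 0 \<and> L2.N (snd X) = 0"
    then have "(B.N X)^2 \<le> 0" using dD(5)[OF assms] by simp
    then show "B.N X = 0" by simp
  qed
  then show ?thesis using L2_N_eq_0_iff L by simp
qed

text \<open>Both coordinates of a Cauchy sequence converge in L2; \<open>lift\<close> turns the
  limit of the \<open>Dv\<close>-coordinate back into an element of \<open>V\<close>.\<close>

sublocale B: semi_hilbert phase E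
proof
  fix X :: "nat \<Rightarrow> fn \<times> fn"
  assume X: "\<And>n. X n \<in> phase" and Cau: "\<And>e. e > 0 \<Longrightarrow> \<exists>M. \<forall>m\<ge>M. \<forall>n\<ge>M. B.N (X m - X n) < e"
  obtain d D where dD: "0 < d" "0 < D"
    "\<And>X. X \<in> phase \<Longrightarrow> L2.N (Dv (fst X)) \<le> d * B.N X" "\<And>X. X \<in> phase \<Longrightarrow> L2.N (snd X) \<le> d * B.N X"
    "\<And>X. X \<in> phase \<Longrightarrow> (B.N X)^2 \<le> D * ((L2.N (Dv (fst X)))^2 + (L2.N (snd X))^2)"
    by (rule E0_equiv) blast
  note L = phase_D[OF X]
  have NDv: "L2.N (Dv (fst (Y - Z))) = L2.N (Dv (fst Y) - Dv (fst Z))" if "Y \<in> phase" "Z \<in> phase" for Y Z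
    using phase_D[OF that(1)] phase_D[OF that(2)] Dv_diff[of "fst Y" "fst Z"] Dv_L2[OF V_diff]
    by (intro L2_N_cong) (auto simp: fun_diff_def)
  have small: "\<exists>M. \<forall>m\<ge>M. \<forall>n\<ge>M. d * B.N (X m - X n) < e" if "e > 0" for e
    using Cau[of "e / d"] that dD(1) by (simp add: field_simps)
  have "\<exists>u\<in>{f. L2 l f}. (\<lambda>n. L2.N (Dv (fst (X n)) - u)) \<longlonglongrightarrow> 0"
  proof (rule L2.complete)
    show "\<exists>M. \<forall>m\<ge>M. \<forall>n\<ge>M. L2.N (Dv (fst (X m)) - Dv (fst (X n))) < e" if "e > 0" for e
    proof -
      have "L2.N (Dv (fst (X m)) - Dv (fst (X n))) \<le> d * B.N (X m - X n)" for m n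
        using dD(3)[OF B.H_diff[OF X[of m] X[of n]]] NDv[OF X[of m] X[of n]] by simp
      then show ?thesis using small[OF that] by (meson le_less_trans)
    qed
  qed (use L in auto)
  then obtain u where u: "L2 l u" "(\<lambda>n. L2.N (Dv (fst (X n)) - u)) \<longlonglongrightarrow> 0" by auto
  have "\<exists>g\<in>{f. L2 l f}. (\<lambda>n. L2.N (snd (X n) - g)) \<longlonglongrightarrow> 0"
  proof (rule L2.complete)
    show "\<exists>M. \<forall>m\<ge>M. \<forall>n\<ge>M. L2.N (snd (X m) - snd (X n)) < e" if "e > 0" for e
    proof -
      have "L2.N (snd (X m) - snd (X n)) \<le> d * B.N (X m - X n)" for m n
        using dD(4)[OF B.H_diff[OF X[of m] X[of n]]] by simp
      then show ?thesis using small[OF that] by (meson le_less_trans)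
    qed
  qed (use L in auto)
  then obtain g where g: "L2 l g" "(\<lambda>n. L2.N (snd (X n) - g)) \<longlonglongrightarrow> 0" by auto
  define Z where "Z = (lift u, g)"
  have Z: "Z \<in> phase" using lift[OF u(1)] g(1) by (simp add: Z_def phase_def)
  have eq: "L2.N (Dv (fst (X n - Z))) = L2.N (Dv (fst (X n)) - u)" for n
    unfolding NDv[OF X Z]
  proof (rule L2_N_cong)
    show "AE y in M. (Dv (fst (X n)) - Dv (fst Z)) y = (Dv (fst (X n)) - u) y"
      using lift(2)[OF u(1)] by eventually_elim (simp add: Z_def)
  qed (use L u phase_D[OF Z] in "auto simp: fun_diff_def")
  have "(\<lambda>n. sqrt (D * ((L2.N (Dv (fst (X n)) - u))^2 + (L2.N (snd (X n) - g))^2))) \<longlonglongrightarrow> sqrt (D * (0^2 + 0^2))"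
    by (intro tendsto_intros u g)
  then have "(\<lambda>n. B.N (X n - Z)) \<longlonglongrightarrow> 0"
  proof (rule Lim_null_comparison[rotated, OF tendsto_eq_rhs])
    show "\<forall>\<^sub>F n in sequentially. norm (B.N (X n - Z)) \<le> sqrt (D * ((L2.N (Dv (fst (X n)) - u))^2 + (L2.N (snd (X n) - g))^2))"
    proof (intro always_eventually allI)
      fix n
      have "(B.N (X n - Z))^2 \<le> D * ((L2.N (Dv (fst (X n)) - u))^2 + (L2.N (snd (X n) - g))^2)"
        using dD(5)[OF B.H_diff[OF X[of n] Z]] unfolding eq by (simp add: Z_def)
      then show "norm (B.N (X n - Z)) \<le> sqrt (D * ((L2.N (Dv (fst (X n)) - u))^2 + (L2.N (snd (X n) - g))^2))"
        using B.N_nonneg[OF B.H_diff[OF X[of n] Z]] by (simp add: real_le_rsqrt)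
    qed
  qed simp
  then show "\<exists>L\<in>phase. (\<lambda>n. B.N (X n - L)) \<longlonglongrightarrow> 0" using Z by blast
qed


section \<open>The evolution of one component as a dissipative relation\<close>

abbreviation strain :: "fn \<times> fn \<Rightarrow> fn \<times> fn \<Rightarrow> fn" where
  "strain X Y y \<equiv> a y * Dv (fst X) y + \<eta> y * a y * Dv (fst Y) y"

abbreviation trac :: "fn \<times> fn \<Rightarrow> fn \<times> fn \<Rightarrow> real" where
  "trac X Y \<equiv> k * (fst Y l + \<epsilon> * fst X l)"

text \<open>The velocity \<open>snd X\<close> is only an L2 representative. \<open>fst Y\<close> is
  its representative in \<open>V\<close>, so \<open>Dv\<close> and the value at \<open>l\<close> of
  the velocity are always taken from \<open>Y\<close>.\<close>

definition genrel :: "fn \<times> fn \<Rightarrow> fn \<times> fn \<Rightarrow> bool" where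
  "genrel X Y \<longleftrightarrow> X \<in> phase \<and> Y \<in> phase \<and> (AE y in M. snd X y = fst Y y) \<and>
    (\<exists>S. St S (\<lambda>y. r y * snd Y y) (trac X Y) \<and>
       (AE y in M. S y = strain X Y y))"

lemma genrel_I:
  assumes "X \<in> phase" "Y \<in> phase" "AE y in M. snd X y = fst Y y"
    "St S (\<lambda>y. r y * snd Y y) (trac X Y)"
    "AE y in M. S y = strain X Y y"
  shows "genrel X Y"
  unfolding genrel_def using assms by blast

lemma genrel_E:
  assumes "genrel X Y"
  obtains S where "X \<in> phase" "Y \<in> phase" "AE y in M. snd X y = fst Y y"
    "St S (\<lambda>y. r y * snd Y y) (trac X Y)"
    "AE y in M. S y = strain X Y y"
  using assms unfolding genrel_def by blast

lemma genrel_lin: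
  assumes "genrel X Y" "genrel X' Y'"
  shows "genrel (s *\<^sub>R X + t *\<^sub>R X') (s *\<^sub>R Y + t *\<^sub>R Y')"
proof -
  obtain S where H: "X \<in> phase" "Y \<in> phase" and S: "AE y in M. snd X y = fst Y y"
    "St S (\<lambda>y. r y * snd Y y) (trac X Y)"
    "AE y in M. S y = strain X Y y"
    using assms(1) by (rule genrel_E)
  obtain S' where H': "X' \<in> phase" "Y' \<in> phase" and S': "AE y in M. snd X' y = fst Y' y"
    "St S' (\<lambda>y. r y * snd Y' y) (trac X' Y')"
    "AE y in M. S' y = strain X' Y' y"
    using assms(2) by (rule genrel_E)
  show ?thesis
  proof (rule genrel_I)
    show "AE y in M. snd (s *\<^sub>R X + t *\<^sub>R X') y = fst (s *\<^sub>R Y + t *\<^sub>R Y') y"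
      using S(1) S'(1) by eventually_elim simp
    show "St (s *\<^sub>R S + t *\<^sub>R S') (\<lambda>y. r y * snd (s *\<^sub>R Y + t *\<^sub>R Y') y)
        (k * (fst (s *\<^sub>R Y + t *\<^sub>R Y') l + \<epsilon> * fst (s *\<^sub>R X + t *\<^sub>R X') l))"
      using St_lin[OF S(2) S'(2), of s t] by (simp add: plus_fun_def scaleR_fun_def algebra_simps)
    show "AE y in M. (s *\<^sub>R S + t *\<^sub>R S') y = a y * Dv (fst (s *\<^sub>R X + t *\<^sub>R X')) y + \<eta> y * a y * Dv (fst (s *\<^sub>R Y + t *\<^sub>R Y')) y"
      using S(3) S'(3) Dv_lin[OF phase_D(1)[OF H(1)] phase_D(1)[OF H'(1)], of s t]
        Dv_lin[OF phase_D(1)[OF H(2)] phase_D(1)[OF H'(2)], of s t]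
      by eventually_elim (simp add: algebra_simps)
  qed (use H H' in auto)
qed

lemma B_null:
  assumes "X \<in> phase" "X' \<in> phase" "B.N (X - X') = 0"
  shows "AE y in M. Dv (fst X) y = Dv (fst X') y" "AE y in M. fst X y = fst X' y" "fst X l = fst X' l"
    "AE y in M. snd X y = snd X' y"
proof -
  note L = phase_D[OF assms(1)] phase_D[OF assms(2)]
  have z: "AE y in M. Dv (fst X - fst X') y = 0" "AE y in M. snd X y - snd X' y = 0"
    using B_N_eq_0_iff[OF B.H_diff[OF assms(1,2)]] assms(3) by (simp_all add: fun_diff_def)
  show "AE y in M. snd X y = snd X' y" using z(2) by simp
  show "AE y in M. Dv (fst X) y = Dv (fst X') y"
    using z(1) Dv_diff[OF L(1) L(5)] by eventually_elim simp
  show "AE y in M. fst X y = fst X' y" "fst X l = fst X' l"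
    using V_null[OF V_diff[OF L(1,5)] z(1)] by simp_all
qed

lemma genrel_cong:
  assumes "genrel X Y" "X' \<in> phase" "Y' \<in> phase" "B.N (X - X') = 0" "B.N (Y - Y') = 0"
  shows "genrel X' Y'"
proof -
  obtain S where H: "X \<in> phase" "Y \<in> phase"
    and e: "AE y in M. snd X y = fst Y y"
    and S: "St S (\<lambda>y. r y * snd Y y) (trac X Y)"
    and Se: "AE y in M. S y = strain X Y y"
    using assms(1) by (rule genrel_E)
  note x = B_null[OF H(1) assms(2,4)] and y = B_null[OF H(2) assms(3,5)]
  have "AE y in M. snd X' y = fst Y' y" using e x(4) y(2) by eventually_elim simp
  moreover have "St S (\<lambda>y. r y * snd Y' y) (trac X' Y')"
  proof (rule St_cong)
    show "St S (\<lambda>y. r y * snd Y y) (trac X' Y')" using S x(3) y(3) by simp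
    show "AE z in M. r z * snd Y z = r z * snd Y' z" using y(4) by eventually_elim simp
  qed
  moreover have "AE y in M. S y = strain X' Y' y"
    using Se x(1) y(1) by eventually_elim simp
  ultimately show ?thesis by (rule genrel_I[OF assms(2,3)])
qed

text \<open>The principle of virtual work, and the only way in which the equation of motion enters
  the energy estimates.\<close>

lemma stress_green:
  assumes H: "X \<in> phase" "Y \<in> phase" and S: "St S (\<lambda>y. r y * snd Y y) b"
    and Se: "AE y in M. S y = strain X Y y" and \<phi>: "V \<phi>"
  shows "W r (snd Y) \<phi> = - b * \<phi> l - (W a (Dv (fst X)) (Dv \<phi>) + W (\<lambda>y. \<eta> y * a y) (Dv (fst Y)) (Dv \<phi>))"
proof -
  let ?u = "Dv (fst X)" and ?w = "Dv (fst Y)"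
  note i = W_integrable[OF a phase_D(4)[OF H(1)] Dv_L2[OF \<phi>]] W_integrable[OF \<eta>a phase_D(4)[OF H(2)] Dv_L2[OF \<phi>]]
  have "W r (snd Y) \<phi> = - b * \<phi> l - LI (\<lambda>y. S y * Dv \<phi> y)"
    using St_green[OF S \<phi>] by (simp add: W_def)
  also have "LI (\<lambda>y. S y * Dv \<phi> y) = LI (\<lambda>y. a y * ?u y * Dv \<phi> y + \<eta> y * a y * ?w y * Dv \<phi> y)"
  proof (rule integral_cong_AE)
    show "AE y in M. S y * Dv \<phi> y = a y * ?u y * Dv \<phi> y + \<eta> y * a y * ?w y * Dv \<phi> y"
      using Se by eventually_elim (simp add: algebra_simps)
  qed (use L2_mult_integrable[OF St_L2[OF S] Dv_L2[OF \<phi>]] i in \<open>auto intro!: borel_measurable_add borel_measurable_integrable\<close>)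
  also have "\<dots> = W a ?u (Dv \<phi>) + W (\<lambda>y. \<eta> y * a y) ?w (Dv \<phi>)"
    unfolding W_def using i by (rule LI_add)
  finally show ?thesis .
qed

lemma genrel_single:
  assumes "genrel 0 Y"
  shows "B.N Y = 0"
proof -
  obtain S where H: "0 \<in> phase" "Y \<in> phase" and e: "AE y in M. snd (0 :: fn \<times> fn) y = fst Y y"
    and S: "St S (\<lambda>y. r y * snd Y y) (trac (0 :: fn \<times> fn) Y)"
    and Se: "AE y in M. S y = strain (0 :: fn \<times> fn) Y y"
    using assms by (rule genrel_E)
  note L = phase_D[OF H(2)]
  have D0: "AE y in M. Dv 0 y = 0" using Dv_scale[OF V_zero, of 0] by simp
  text \<open>\<open>fst Y\<close> vanishes almost everywhere; testing its stress against itself kills \<open>Dv (fst Y)\<close>.\<close>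
  have F0: "AE y in M. fst Y y = 0" using e by eventually_elim simp
  have "W r (snd Y) (fst Y) = 0"
    unfolding W_def using F0 by (intro integral_eq_zero_AE) (auto elim: eventually_mono)
  moreover have "W a (Dv (fst (0 :: fn \<times> fn))) (Dv (fst Y)) = 0"
    unfolding W_def using D0 by (intro integral_eq_zero_AE) (auto elim: eventually_mono)
  moreover have "c * (L2.N (Dv (fst Y)))^2 \<le> W (\<lambda>y. \<eta> y * a y) (Dv (fst Y)) (Dv (fst Y))"
    by (rule W_lower[OF \<eta>a L(4) c(2)])
  moreover have "0 \<le> k * (fst Y l * fst Y l)" using k by simp
  ultimately have "c * (L2.N (Dv (fst Y)))^2 \<le> 0"
    using stress_green[OF H S Se L(1)] by (simp add: mult.assoc)
  then have "L2.N (Dv (fst Y)) = 0" using c(1) by (simp add: mult_le_0_iff)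
  then have DY: "AE y in M. Dv (fst Y) y = 0" using L2_N_eq_0_iff[OF L(4)] by simp
  have "AE y in M. S y = 0" using Se D0 DY by eventually_elim simp
  with S have "AE y in M. r y * snd Y y = 0" by (rule St_inj)
  then have "AE y in M. snd Y y = 0" using r0(2) by eventually_elim (use r0(1) in auto)
  then show ?thesis using B_N_eq_0_iff[OF H(2)] DY by simp
qed

text \<open>The equation is tested with the velocity \<open>F\<close> and with \<epsilon> times the
  displacement \<open>f\<close>. The elastic terms \<open>W a w u\<close> cancel, and the boundary
  terms add up to \<open>- k * (F l + \<epsilon> * f l)^2\<close>. What is left must be absorbed by
  the damping \<open>W ?ea w w\<close>: Poincare bounds the inertial part by the fraction
  \<open>\<epsilon> * \<gamma> * r1 / c\<close> of it, completing a square bounds the rest by the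
  fraction \<open>\<epsilon> * \<eta>1 / 4\<close>, and the last condition on \<epsilon> says that
  both together do not exceed 1.\<close>

lemma genrel_diss:
  assumes "genrel X Y"
  shows "E Y X \<le> 0"
proof -
  obtain S where H: "X \<in> phase" "Y \<in> phase"
    and e: "AE y in M. snd X y = fst Y y"
    and S: "St S (\<lambda>y. r y * snd Y y) (trac X Y)"
    and Se: "AE y in M. S y = strain X Y y"
    using assms by (rule genrel_E)
  define f u F w n where "f = fst X" "u = Dv (fst X)" "F = fst Y" "w = Dv (fst Y)" "n = snd Y"
  note defs = this
  have L: "V f" "L2 l f" "L2 l u" "V F" "L2 l F" "L2 l w" "L2 l n"
    using phase_D[OF H(1)] phase_D[OF H(2)] by (auto simp: defs)
  define \<beta> where "\<beta> = k * (F l + \<epsilon> * f l)"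
  let ?ea = "\<lambda>y. \<eta> y * a y"
  have green: "W r n \<phi> = - \<beta> * \<phi> l - (W a u (Dv \<phi>) + W ?ea w (Dv \<phi>))" if "V \<phi>" for \<phi>
    using stress_green[OF H S Se that] by (simp only: defs \<beta>_def)
  have gF: "W r v (snd X) = W r v F" if "L2 l v" for v
    by (rule W_cong[OF r]) (use that e L phase_D[OF H(1)] in "auto simp: defs")
  have "E Y X = W a w u + W r n F + \<epsilon> * (W r F F + W r n f)"
    unfolding E_def using gF[OF L(7)] gF[OF L(5)] by (simp add: defs)
  also have "\<dots> = W a w u + (- \<beta> * F l - (W a u w + W ?ea w w)) + \<epsilon> * (W r F F + (- \<beta> * f l - (W a u u + W ?ea w u)))"
    using green[OF L(1)] green[OF L(4)] by (simp add: defs)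
  also have "\<dots> = - \<beta> * (F l + \<epsilon> * f l) - W ?ea w w + \<epsilon> * (W r F F - W a u u - W ?ea w u)"
    using W_sym[of a w u] by (simp add: algebra_simps)
  also have "\<dots> \<le> 0"
  proof -
    have "\<beta> * (F l + \<epsilon> * f l) = k * (F l + \<epsilon> * f l)^2" by (simp add: \<beta>_def power2_eq_square)
    then have 1: "0 \<le> \<beta> * (F l + \<epsilon> * f l)" using k by simp
    have w: "c * (L2.N w)^2 \<le> W ?ea w w" by (rule W_lower[OF \<eta>a L(6) c(2)])
    have "W r F F \<le> r1 * (L2.N F)^2" by (rule W_upper[OF r L(5) r1(2)])
    also have "\<dots> \<le> r1 * (\<gamma> * (L2.N w)^2)" using V_poincare[OF L(4)] r1(1) by (intro mult_left_mono) (auto simp: defs)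
    finally have "c * W r F F \<le> c * (r1 * (\<gamma> * (L2.N w)^2))" using c(1) by (intro mult_left_mono) auto
    also have "\<dots> = \<gamma> * r1 * (c * (L2.N w)^2)" by simp
    also have "\<dots> \<le> \<gamma> * r1 * W ?ea w w" using w \<gamma>_pos r1(1) by (intro mult_left_mono) auto
    finally have 2: "c * W r F F \<le> \<gamma> * r1 * W ?ea w w" .
    \<comment> \<open>Pointwise, \<open>a * (u + \<eta> * w / 2)^2\<close> is nonnegative; one of
      the two factors \<eta> in its last term is then bounded by \<open>\<eta>1\<close>.\<close>
    have 3: "- W a u u - W ?ea w u \<le> \<eta>1 / 4 * W ?ea w w"
    proof -
      note i = W_integrable[OF a L(3,3)] W_integrable[OF \<eta>a L(6,3)] W_integrable[OF \<eta>a L(6,6)]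
      have "- W a u u - W ?ea w u = LI (\<lambda>y. - (a y * u y * u y) - \<eta> y * a y * w y * u y)"
        unfolding W_def using i by simp
      also have "\<dots> \<le> LI (\<lambda>y. \<eta>1 / 4 * (\<eta> y * a y * w y * w y))"
      proof (rule integral_mono_AE)
        show "AE y in M. - (a y * u y * u y) - \<eta> y * a y * w y * u y \<le> \<eta>1 / 4 * (\<eta> y * a y * w y * w y)"
          using a0(2) c(2) \<eta>1(2)
        proof eventually_elim
          case (elim y)
          have ay: "a y > 0" using elim a0(1) by linarith
          have "0 \<le> a y * (u y + \<eta> y * w y / 2)^2" using ay by simp
          then have "- (a y * u y * u y) - \<eta> y * a y * w y * u y \<le> \<eta> y / 4 * (\<eta> y * a y * w y * w y)"
            by (simp add: power2_eq_square algebra_simps)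
          also have "\<dots> \<le> \<eta>1 / 4 * (\<eta> y * a y * w y * w y)"
          proof (rule mult_right_mono)
            have "0 \<le> (\<eta> y * a y) * (w y * w y)" 
              by (rule mult_nonneg_nonneg) (use elim c(1) in auto)
            then show "0 \<le> \<eta> y * a y * w y * w y" by (simp add: mult.assoc)
          qed (use elim in simp)
          finally show ?case .
        qed
      qed (use i in auto)
      also have "\<dots> = \<eta>1 / 4 * W ?ea w w" unfolding W_def by simp
      finally show ?thesis .
    qed
    have Wnn: "0 \<le> W ?ea w w" using w c(1) by (meson mult_nonneg_nonneg less_imp_le order_trans zero_le_power2)
    \<comment> \<open>Multiplying by \<open>4 * c\<close> clears the denominators of both
      fractions.\<close>
    have "4 * c * (\<epsilon> * (W r F F - W a u u - W ?ea w u)) = \<epsilon> * (4 * (c * W r F F) + c * (4 * (- W a u u - W ?ea w u)))"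
      by (simp add: algebra_simps)
    also have "\<dots> \<le> \<epsilon> * (4 * (\<gamma> * r1 * W ?ea w w) + c * (4 * (\<eta>1 / 4 * W ?ea w w)))"
      using 2 3 \<epsilon>(1) c(1) by (intro mult_left_mono add_mono) auto
    also have "\<dots> = \<epsilon> * (4 * \<gamma> * r1 + \<eta>1 * c) * W ?ea w w" by (simp add: algebra_simps)
    also have "\<dots> \<le> 4 * c * W ?ea w w" using \<epsilon>(4) Wnn by (rule mult_right_mono)
    finally have "\<epsilon> * (W r F F - W a u u - W ?ea w u) \<le> W ?ea w w" using c(1) by simp
    then show ?thesis using 1 by linarith
  qed
  finally show ?thesis .
qed

section \<open>Solvability of the resolvent equation\<close>

definition R :: "fn \<Rightarrow> real \<Rightarrow> fn" where "R m b = (SOME S. St S m b)"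

lemma R: "L2 l m \<Longrightarrow> St (R m b) m b"
  unfolding R_def by (rule someI_ex[of "\<lambda>S. St S m b"]) (rule St_ex)

lemma lift_lin:
  assumes "L2 l u" "L2 l v"
  shows "AE y in M. lift (u - v) y = lift u y - lift v y" "lift (u - v) l = lift u l - lift v l"
proof -
  have L: "L2 l (u - v)" using assms by (simp add: fun_diff_def)
  note lu = lift[OF assms(1)] and lv = lift[OF assms(2)] and luv = lift[OF L]
  have V: "V (lift u - lift v)" using lu lv by simp
  have "AE y in M. Dv (lift (u - v) - (lift u - lift v)) y = 0"
    using Dv_diff[OF luv(1) V] Dv_diff[OF lu(1) lv(1)] lu(2) lv(2) luv(2) by eventually_elim simp
  from V_null[OF V_diff[OF luv(1) V] this]
  show "AE y in M. lift (u - v) y = lift u y - lift v y" "lift (u - v) l = lift u l - lift v l" by simp_all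
qed

text \<open>The resolvent equation for parameter \<open>t\<close>, written for \<open>w = Dv g\<close>, has the symmetric coercive form \<open>Q\<close>.\<close>

lemma genrel_range:
  assumes t: "t > 0" and Y: "Y \<in> phase"
  shows "\<exists>X. genrel X ((1 / t) *\<^sub>R (X - Y))"
proof -
  obtain F1 F2 where F: "Y = (F1, F2)" by force
  have FL: "V F1" "L2 l F2" "L2 l F1" "L2 l (Dv F1)" using phase_D[OF Y] by (auto simp: F)
  \<comment> \<open>The first equation gives \<open>f = F1 + t *\<^sub>R g\<close>, so the strain
    term is \<open>a * Dv F1 + bt * w\<close> with \<open>w = Dv g\<close>.\<close>
  define bt where "bt y = t * a y + \<eta> y * a y" for y
  have bt: "Linf l bt" unfolding bt_def
  proof -
    obtain A B where "AE y in M. \<bar>a y\<bar> \<le> A" "AE y in M. \<bar>\<eta> y * a y\<bar> \<le> B" using a \<eta>a unfolding Linf_def by blast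
    then have "AE y in M. \<bar>t * a y + \<eta> y * a y\<bar> \<le> t * A + B"
    proof eventually_elim
      case (elim y)
      have "\<bar>t * a y\<bar> \<le> t * A" using elim t by (simp add: abs_mult)
      then show ?case using elim by linarith
    qed
    then show "Linf l (\<lambda>y. t * a y + \<eta> y * a y)" using a \<eta>a unfolding Linf_def
      by (auto intro!: borel_measurable_add borel_measurable_times)
  qed
  obtain C1 where C1: "AE y in M. \<bar>bt y\<bar> \<le> C1" using bt unfolding Linf_def by blast
  have rb: "AE y in M. \<bar>r y\<bar> \<le> r1" using r0(2) r1(2) by eventually_elim (use r0(1) in auto)
  \<comment> \<open>With \<open>f = F1 + t *\<^sub>R g\<close>, the traction
    \<open>k * (g l + \<epsilon> * f l)\<close> splits into \<open>\<kappa> * g l\<close> and the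
    datum \<open>k * \<epsilon> * F1 l\<close>.\<close>
  define \<kappa> where "\<kappa> = k * (1 + \<epsilon> * t)"
  have \<kappa>: "0 \<le> \<kappa>" using k t \<epsilon>(1) by (simp add: \<kappa>_def)
  define m where "m w = (\<lambda>y. (1 / t) * (r y * lift w y))" for w
  have liftL: "L2 l (lift w)" if "L2 l w" for w using lift(1)[OF that] V_L2 by blast
  have mL: "L2 l (m w)" if "L2 l w" for w unfolding m_def using L2_Linf_mult[OF r liftL[OF that]] by (rule L2_scale)
  define Rw where "Rw w = R (m w) (\<kappa> * lift w l)" for w
  have Rw: "St (Rw w) (m w) (\<kappa> * lift w l)" if "L2 l w" for w unfolding Rw_def by (rule R[OF mL[OF that]])
  \<comment> \<open>The stress is \<open>Rw w\<close> plus a part \<open>R2\<close> carrying only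
    data; equating it with the strain term gives \<open>S w = R2 - a * Dv F1\<close>.\<close>
  define S where "S w = (\<lambda>y. bt y * w y - Rw w y)" for w
  have SL: "L2 l (S w)" if "L2 l w" for w
    unfolding S_def using L2_Linf_mult[OF bt that] St_L2[OF Rw[OF that]] by (rule L2_diff)
  define Q where "Q w v = W bt w v + (1 / t) * W r (lift w) (lift v) + \<kappa> * lift w l * lift v l" for w v
  have Q: "LI (\<lambda>y. S w y * v y) = Q w v" if w: "L2 l w" and v: "L2 l v" for w v
  proof -
    note Rl = St_L2[OF Rw[OF w]]
    have "LI (\<lambda>y. S w y * v y) = LI (\<lambda>y. bt y * w y * v y - Rw w y * v y)"
      unfolding S_def by (simp add: left_diff_distrib)
    also have "\<dots> = W bt w v - LI (\<lambda>y. Rw w y * v y)"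
      unfolding W_def using W_integrable[OF bt w v] L2_mult_integrable[OF Rl v] by (rule Bochner_Integration.integral_diff)
    also have "LI (\<lambda>y. Rw w y * v y) = LI (\<lambda>y. Rw w y * Dv (lift v) y)"
    proof (rule integral_cong_AE)
      show "AE y in M. Rw w y * v y = Rw w y * Dv (lift v) y" using lift(2)[OF v] by eventually_elim simp
    qed (use L2_mult_integrable[OF Rl v] L2_mult_integrable[OF Rl Dv_L2[OF lift(1)[OF v]]] in auto)
    also have "\<dots> = - (\<kappa> * lift w l) * lift v l - LI (\<lambda>y. m w y * lift v y)"
      using St_green[OF Rw[OF w] lift(1)[OF v]] by simp
    also have "LI (\<lambda>y. m w y * lift v y) = (1 / t) * W r (lift w) (lift v)"
      unfolding W_def integral_mult_right_zero[symmetric]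
      by (intro LI_cong) (auto simp: m_def)
    finally show ?thesis unfolding Q_def by simp
  qed
  have Q_diff: "Q (u - v) w = Q u w - Q v w" if u: "L2 l u" and v: "L2 l v" and w: "L2 l w" for u v w
  proof -
    have "W bt (u - v) w = W bt u w - W bt v w"
      unfolding W_def fun_diff_def using W_integrable[OF bt u w] W_integrable[OF bt v w]
      by (simp add: left_diff_distrib right_diff_distrib)
    moreover have "W r (lift (u - v)) (lift w) = W r (lift u) (lift w) - W r (lift v) (lift w)"
    proof -
      have "W r (lift (u - v)) (lift w) = W r (\<lambda>y. lift u y - lift v y) (lift w)"
        by (rule W_cong[OF r]) (use lift_lin(1)[OF u v] u v w liftL in "auto simp: fun_diff_def")
      also have "\<dots> = W r (lift u) (lift w) - W r (lift v) (lift w)"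
        unfolding W_def using W_integrable[OF r liftL[OF u] liftL[OF w]] W_integrable[OF r liftL[OF v] liftL[OF w]]
        by (simp add: left_diff_distrib right_diff_distrib)
      finally show ?thesis .
    qed
    ultimately have "Q (u - v) w = (W bt u w - W bt v w) + (1 / t) * (W r (lift u) (lift w) - W r (lift v) (lift w))
        + \<kappa> * (lift u l - lift v l) * lift w l"
      unfolding Q_def by (simp only: lift_lin(2)[OF u v])
    then show ?thesis unfolding Q_def by (simp add: algebra_simps diff_divide_distrib)
  qed
  have N_lift: "L2.N (lift w) \<le> sqrt \<gamma> * L2.N w" if "L2 l w" for w
    by (rule power2_le_imp_le) (use lift_N(1)[OF that] that \<gamma>_pos in "auto simp: power_mult_distrib")
  define C where "C = C1 + (1 / t) * r1 * \<gamma> + \<kappa> * C0 * C0"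
  have Q_bound: "Q w v \<le> C * L2.N w * L2.N v" if w: "L2 l w" and v: "L2 l v" for w v
  proof -
    have Nw: "0 \<le> L2.N w" "0 \<le> L2.N v" using w v by simp_all
    have "W bt w v \<le> C1 * L2.N w * L2.N v" using W_bound[OF bt w v C1] by simp
    moreover have "(1 / t) * W r (lift w) (lift v) \<le> (1 / t) * r1 * \<gamma> * L2.N w * L2.N v"
    proof -
      have "W r (lift w) (lift v) \<le> r1 * (L2.N (lift w) * L2.N (lift v))"
        using W_bound[OF r liftL[OF w] liftL[OF v] rb] by (simp add: mult.assoc)
      also have "\<dots> \<le> r1 * ((sqrt \<gamma> * L2.N w) * (sqrt \<gamma> * L2.N v))"
        using N_lift[OF w] N_lift[OF v] liftL w v r1(1) \<gamma>_pos by (intro mult_left_mono mult_mono) auto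
      also have "\<dots> = r1 * \<gamma> * L2.N w * L2.N v" using \<gamma>_pos by simp
      finally show ?thesis using t by (simp add: field_simps)
    qed
    moreover have "\<kappa> * lift w l * lift v l \<le> \<kappa> * C0 * C0 * L2.N w * L2.N v"
    proof -
      have "lift w l * lift v l \<le> \<bar>lift w l\<bar> * \<bar>lift v l\<bar>" by (metis abs_ge_self abs_mult)
      also have "\<dots> \<le> (C0 * L2.N w) * (C0 * L2.N v)"
        using lift_N(2)[OF w] lift_N(2)[OF v] C0_pos Nw by (intro mult_mono) auto
      finally have "\<kappa> * (lift w l * lift v l) \<le> \<kappa> * ((C0 * L2.N w) * (C0 * L2.N v))"
        using \<kappa> by (rule mult_left_mono)
      then show ?thesis by (simp add: mult_ac)
    qed
    ultimately show ?thesis unfolding Q_def C_def distrib_right by linarith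
  qed
  \<comment> \<open>The stress generated by the data alone: the inertial part
    \<open>- r * F2 / t\<close> and the traction of \<open>F1\<close>.\<close>
  define R2 where "R2 = R (\<lambda>y. - (1 / t) * (r y * F2 y)) (k * \<epsilon> * F1 l)"
  have R2: "St R2 (\<lambda>y. - (1 / t) * (r y * F2 y)) (k * \<epsilon> * F1 l)"
    unfolding R2_def by (rule R[OF L2_scale[OF L2_Linf_mult[OF r FL(2)]]])
  obtain w where w: "L2 l w" and wS: "L2.N (S w - (\<lambda>y. R2 y - a y * Dv F1 y)) = 0"
  proof -
    have C_bnd: "L2.N (S u) \<le> C * L2.N u" if "u \<in> {f. L2 l f}" for u
    proof -
      have u: "L2 l u" using that by simp
      have "L2.N (S u) * L2.N (S u) \<le> C * L2.N u * L2.N (S u)"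
        using Q_bound[OF u SL[OF u]] Q[OF u SL[OF u]] L2.N_sq[of "S u"] SL[OF u] by (simp add: power2_eq_square)
      moreover have "0 \<le> C * L2.N u"
      proof -
        \<comment> \<open>\<open>C1\<close> is merely an almost everywhere bound; a point where it
          holds shows that it is nonnegative.\<close>
        obtain y where "\<bar>bt y\<bar> \<le> C1" using C1 not_AE_False by (metis (mono_tags, lifting) eventually_mono)
        then have "0 \<le> C" using t r1(1) \<gamma>_pos \<kappa> C0_pos by (simp add: C_def)
        then show ?thesis using u by simp
      qed
      ultimately show ?thesis using SL[OF u]
        by (cases "L2.N (S u) = 0") (auto simp: mult_le_cancel_right dest: less_le_trans[of 0] order_antisym[OF _ L2.N_nonneg])
    qed
    \<comment> \<open>\<open>lift\<close> and \<open>R\<close> are arbitrary choices, so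
      \<open>S\<close> is additive only up to null functions. The defect \<open>q\<close> is tested
      against itself through the form \<open>Q\<close>, which is exactly additive.\<close>
    have S_diff: "L2.N (S u - S v - S (u - v)) = 0" if "u \<in> {f. L2 l f}" "v \<in> {f. L2 l f}" for u v
    proof -
      have u: "L2 l u" and v: "L2 l v" and uv: "L2 l (u - v)" using that by (auto simp: fun_diff_def)
      define q where "q = S u - S v - S (u - v)"
      have q: "L2 l q" unfolding q_def fun_diff_def using SL[OF u] SL[OF v] SL[OF uv] by (simp add: fun_diff_def)
      have H: "S u \<in> {f. L2 l f}" "S v \<in> {f. L2 l f}" "S (u - v) \<in> {f. L2 l f}" "q \<in> {f. L2 l f}"
        using SL u v uv q by auto
      have "(L2.N q)^2 = LI (\<lambda>y. q y * q y)" by (rule L2.N_sq[OF H(4)])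
      also have "\<dots> = LI (\<lambda>y. S u y * q y) - LI (\<lambda>y. S v y * q y) - LI (\<lambda>y. S (u - v) y * q y)"
        using L2.ip_diff_left[OF L2.H_diff[OF H(1,2)] H(3,4)] L2.ip_diff_left[OF H(1,2,4)]
        unfolding q_def[symmetric] by simp
      also have "\<dots> = 0" using Q[OF u q] Q[OF v q] Q[OF uv q] Q_diff[OF u v q] by simp
      finally show ?thesis by (simp add: q_def)
    qed
    have coer: "(t * a0) * (L2.N u)^2 \<le> LI (\<lambda>y. S u y * u y)" if "u \<in> {f. L2 l f}" for u
    proof -
      have u: "L2 l u" using that by simp
      have "AE y in M. t * a0 \<le> bt y"
        using a0(2) c(2)
      proof eventually_elim
        case (elim y)
        have "t * a0 \<le> t * a y" using elim t by simp
        then show ?case using elim c(1) unfolding bt_def by linarith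
      qed
      then have "(t * a0) * (L2.N u)^2 \<le> W bt u u" by (rule W_lower[OF bt u])
      moreover have "0 \<le> (1 / t) * W r (lift u) (lift u)" using W_r_nonneg[OF liftL[OF u]] t by simp
      moreover have "0 \<le> \<kappa> * lift u l * lift u l" using \<kappa> by (simp add: mult.assoc)
      ultimately show ?thesis unfolding Q[OF u u] Q_def by linarith
    qed
    let ?rhs = "\<lambda>y. R2 y - a y * Dv F1 y"
    have rhs: "?rhs \<in> {f. L2 l f}"
      using L2_diff[OF St_L2[OF R2] L2_Linf_mult[OF a FL(4)]] by simp
    have S_H: "S u \<in> {f. L2 l f}" if "u \<in> {f. L2 l f}" for u using SL that by simp
    have "0 < t * a0" using t a0(1) by simp
    from L2.coercive_surj[OF S_H S_diff C_bnd coer this rhs] that show ?thesis by auto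
  qed
  have eqn: "AE y in M. S w y = R2 y - a y * Dv F1 y"
  proof -
    have "L2 l (S w - (\<lambda>y. R2 y - a y * Dv F1 y))"
      unfolding fun_diff_def using SL[OF w] St_L2[OF R2] L2_Linf_mult[OF a FL(4)] by simp
    then have "AE y in M. (S w - (\<lambda>y. R2 y - a y * Dv F1 y)) y = 0"
      using L2_N_eq_0_iff wS by blast
    then show ?thesis by eventually_elim simp
  qed
  define g where "g = lift w"
  have g: "V g" "L2 l g" "AE y in M. Dv g y = w y" using lift[OF w] liftL[OF w] by (auto simp: g_def)
  define X where "X = (F1 + t *\<^sub>R g, g)"
  have X: "X \<in> phase" using g FL by (simp add: X_def phase_def)
  define Z where "Z = (1 / t) *\<^sub>R (X - Y)"
  have Z: "Z \<in> phase" unfolding Z_def using X Y by simp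
  have fZ: "fst Z = g" "\<And>y. snd Z y = (1 / t) * (g y - F2 y)"
    using t by (simp_all add: Z_def X_def F fun_eq_iff)
  have "St (Rw w + R2) (m w + (\<lambda>y. - (1 / t) * (r y * F2 y))) (\<kappa> * lift w l + k * \<epsilon> * F1 l)"
    using St_lin[OF Rw[OF w] R2, of 1 1] by simp
  moreover have "m w + (\<lambda>y. - (1 / t) * (r y * F2 y)) = (\<lambda>y. r y * snd Z y)"
    by (simp add: fun_eq_iff m_def fZ g_def algebra_simps)
  moreover have "\<kappa> * lift w l + k * \<epsilon> * F1 l = k * (fst Z l + \<epsilon> * fst X l)"
    by (simp add: \<kappa>_def fZ X_def g_def algebra_simps)
  ultimately have St: "St (Rw w + R2) (\<lambda>y. r y * snd Z y) (trac X Z)" by simp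
  have "AE y in M. (Rw w + R2) y = strain X Z y"
    using eqn g(3) Dv_add[OF FL(1) V_scale[OF g(1), of t]] Dv_scale[OF g(1), of t]
    by eventually_elim (simp add: S_def bt_def fZ X_def algebra_simps)
  moreover have "AE y in M. snd X y = fst Z y" by (simp add: fZ X_def)
  ultimately have "genrel X Z" by (intro genrel_I[OF X Z _ St])
  then show ?thesis unfolding Z_def by blast
qed

sublocale B: m_dissipative phase E genrel
proof
  show "X \<in> phase \<and> Y \<in> phase" if "genrel X Y" for X Y using that by (simp add: genrel_def)
qed (fact genrel_lin genrel_cong genrel_single genrel_diss genrel_range)+

end

section \<open>Essential bounds\<close>

context interval begin

lemma Linf_minus: "Linf l f \<Longrightarrow> Linf l (\<lambda>y. - f y)"
  unfolding Linf_def by auto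

text \<open>\<open>real_of_ereal\<close> sends infinite values to 0, so the extended essential
  supremum is first shown finite; its lower bound uses the positive length of the interval.\<close>

lemma ess_sup:
  assumes "Linf l f"
  shows "AE y in M. f y \<le> ess_sup l f" and "AE y in M. f y \<le> c \<Longrightarrow> ess_sup l f \<le> c"
proof -
  obtain C where m: "f \<in> borel_measurable M" and C: "AE y in M. \<bar>f y\<bar> \<le> C"
    using assms unfolding Linf_def by blast
  let ?s = "esssup M (\<lambda>y. ereal (f y))"
  have me: "(\<lambda>y. ereal (f y)) \<in> borel_measurable M" using m by simp
  have le: "AE y in M. ereal (f y) \<le> ?s" by (rule esssup_AE)
  have "?s \<le> ereal C" using C by (intro esssup_I[OF me]) (auto elim: eventually_mono)
  moreover have "ereal (- C) \<le> ?s"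
  proof (rule ccontr)
    assume "\<not> ereal (- C) \<le> ?s"
    moreover have "ereal (- C) \<le> ?s" if "ereal x \<le> ?s" "\<bar>x\<bar> \<le> C" for x
      using that(2) by (intro order_trans[OF _ that(1)]) simp
    ultimately have "\<not> (ereal (f y) \<le> ?s \<and> \<bar>f y\<bar> \<le> C)" for y by blast
    with eventually_conj[OF le C] have "AE y in M. False" by simp
    then show False using not_AE_False by blast
  qed
  ultimately have s: "?s = ereal (ess_sup l f)"
    unfolding ess_sup_def by (cases ?s) auto
  show "AE y in M. f y \<le> ess_sup l f" using le unfolding s by simp
  show "ess_sup l f \<le> c" if "AE y in M. f y \<le> c"
    using esssup_I[OF me, of "ereal c"] that unfolding s by simp
qed

lemma ess_inf:
  assumes "Linf l f"
  shows "AE y in M. ess_inf l f \<le> f y" and "AE y in M. c \<le> f y \<Longrightarrow> c \<le> ess_inf l f"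
proof -
  show "AE y in M. ess_inf l f \<le> f y"
    using ess_sup(1)[OF Linf_minus[OF assms]] unfolding ess_inf_def by eventually_elim simp
  show "c \<le> ess_inf l f" if "AE y in M. c \<le> f y"
    using ess_sup(2)[OF Linf_minus[OF assms], of "- c"] that unfolding ess_inf_def by simp
qed

lemma ess_inf_le_ess_sup:
  assumes "Linf l f"
  shows "ess_inf l f \<le> ess_sup l f"
proof (rule ccontr)
  assume "\<not> ess_inf l f \<le> ess_sup l f"
  then have "\<not> (ess_inf l f \<le> f y \<and> f y \<le> ess_sup l f)" for y by linarith
  with eventually_conj[OF ess_inf(1)[OF assms] ess_sup(1)[OF assms]] have "AE y in M. False" by simp
  then show False using not_AE_False by blast
qed

section \<open>The bending and the torsion component\<close>

definition Vb :: "fn \<Rightarrow> bool" where "Vb f \<longleftrightarrow> H2 l f \<and> f 0 = 0 \<and> d1 l f 0 = 0"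

text \<open>\<open>S\<close> is the bending moment and \<open>S1\<close> the shear force. The signs
  put bending, where \<open>m\<close> is minus the second derivative of \<open>S\<close>, and
  torsion, where \<open>m\<close> is the first derivative of the torque, under one Green
  identity.\<close>

definition Stb :: "fn \<Rightarrow> fn \<Rightarrow> real \<Rightarrow> bool" where
  "Stb S m b \<longleftrightarrow> (\<exists>S1. wderiv l S S1 \<and> wderiv l S1 (\<lambda>y. - m y) \<and> S l = 0 \<and> S1 l = b)"

definition Vt :: "fn \<Rightarrow> bool" where "Vt h \<longleftrightarrow> H1 l h \<and> h 0 = 0"

definition Stt :: "fn \<Rightarrow> fn \<Rightarrow> real \<Rightarrow> bool" where
  "Stt S m b \<longleftrightarrow> wderiv l S m \<and> S l = - b"

lemma l_nonneg [simp]: "0 \<le> l"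
  using l_pos by simp

lemma zero_mem: "0 \<in> {0..l}" "l \<in> {0..l}"
  using l_pos by auto

lemma VbI:
  assumes "wderiv l f f'" "wderiv l f' f''" "f 0 = 0" "f' 0 = 0"
  shows "Vb f" "AE y in M. d2 l f y = f'' y"
proof -
  have "H1 l f'" using assms(2) H1_def by blast
  then show "Vb f" unfolding Vb_def using H2I[OF assms(1,2)] assms(3,4) d1_H1(2)[OF assms(1) _ zero_mem(1)] by simp
  show "AE y in M. d2 l f y = f'' y" using assms(1,2) by (rule d2_AE)
qed

lemma VbD:
  assumes "Vb f"
  shows "wderiv l f (d1 l f)" "wderiv l (d1 l f) (d2 l f)" "f 0 = 0" "d1 l f 0 = 0"
  using assms H2_wderivs unfolding Vb_def by auto

lemma N_le_of_sq:
  assumes "L2 l f" "L2 l g" "0 \<le> c" "LI (\<lambda>y. (f y)^2) \<le> c * LI (\<lambda>y. (g y)^2)"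
  shows "L2.N f \<le> sqrt c * L2.N g"
  by (rule power2_le_imp_le) (use assms in "auto simp: power_mult_distrib L2_N_sq")

lemma endpoint_bound:
  assumes "wderiv l f f'" "f 0 = 0"
  shows "\<bar>f l\<bar> \<le> L2.N (\<lambda>_. 1) * L2.N f'"
proof -
  have "f l = LI (\<lambda>y. 1 * f' y)"
    using wderivD(3)[OF assms(1), of l] assms(2) by (simp add: integral_prim)
  then show ?thesis using L2.Cauchy_Schwarz[of "\<lambda>_. 1" f'] wderivD(1)[OF assms(1)] by simp
qed

lemma N_one_pos: "0 < L2.N (\<lambda>_. 1)"
proof -
  have "L2.N (\<lambda>_. 1) \<noteq> 0" using L2_N_eq_0_iff[of "\<lambda>_. 1"] not_AE_False by simp
  moreover have "0 \<le> L2.N (\<lambda>_. 1)" by (rule L2.N_nonneg) simp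
  ultimately show ?thesis by linarith
qed

text \<open>Two primitives invert \<open>d2\<close>. The Poincare inequality for \<open>f\<close>
  and for its derivative gives the first constant; for the derivative alone, combined with
  \<open>endpoint_bound\<close>, it gives the second.\<close>

lemma bending: "component l Vb (d2 l) Stb (16 * l^4 / pi^4) (L2.N (\<lambda>_. 1) * sqrt (4 * l^2 / pi^2))"
proof
  have lin: "wderiv l (s *\<^sub>R f + t *\<^sub>R g) (\<lambda>y. s * d1 l f y + t * d1 l g y)"
    "wderiv l (\<lambda>y. s * d1 l f y + t * d1 l g y) (\<lambda>y. s * d2 l f y + t * d2 l g y)"
    if "Vb f" "Vb g" for f g s t
    using wderiv_lin[OF VbD(1)[OF that(1)] VbD(1)[OF that(2)]] wderiv_lin[OF VbD(2)[OF that(1)] VbD(2)[OF that(2)]]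
    by (simp_all add: plus_fun_def scaleR_fun_def)
  have V: "Vb (s *\<^sub>R f + t *\<^sub>R g)" "AE y in M. d2 l (s *\<^sub>R f + t *\<^sub>R g) y = s * d2 l f y + t * d2 l g y"
    if "Vb f" "Vb g" for f g s t
    using VbI[OF lin[OF that, of s t]] that by (simp_all add: VbD)
  show "subspace {f. Vb f}"
  proof (rule subspace_linI)
    have "Vb (\<lambda>_. 0)" by (rule VbI(1)[OF wderiv_const wderiv_const]) auto
    then show "0 \<in> {f. Vb f}" by (simp add: zero_fun_def)
  qed (use V(1) in simp)
  show "AE y in M. d2 l (s *\<^sub>R f + t *\<^sub>R g) y = s * d2 l f y + t * d2 l g y" if "Vb f" "Vb g" for f g s t
    using V(2)[OF that] .
  show "L2 l f" if "Vb f" for f using that H2_H1 H1_L2 unfolding Vb_def by blast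
  show "L2 l (d2 l f)" if "Vb f" for f using wderivD(1)[OF VbD(2)[OF that]] .
  show "\<exists>f. Vb f \<and> (AE y in M. d2 l f y = u y)" if "L2 l u" for u
    using VbI[OF prim_wderiv[OF prim_L2[OF that]] prim_wderiv[OF that]] by (intro exI[of _ "prim (prim u)"]) simp
  show "(L2.N f)^2 \<le> 16 * l^4 / pi^4 * (L2.N (d2 l f))^2" if "Vb f" for f
    using poincare2[OF VbD[OF that]] L2_N_sq[OF wderivD(1)[OF VbD(2)[OF that]]] L2_N_sq[of f] that H2_H1 H1_L2
    unfolding Vb_def by simp
  show "\<bar>f l\<bar> \<le> L2.N (\<lambda>_. 1) * sqrt (4 * l^2 / pi^2) * L2.N (d2 l f)" if "Vb f" for f
  proof -
    have "L2.N (d1 l f) \<le> sqrt (4 * l^2 / pi^2) * L2.N (d2 l f)"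
      using poincare[OF VbD(2,4)[OF that]] wderivD(1)[OF VbD(1)[OF that]] wderivD(1)[OF VbD(2)[OF that]]
      by (intro N_le_of_sq) auto
    then have "L2.N (\<lambda>_. 1) * L2.N (d1 l f) \<le> L2.N (\<lambda>_. 1) * (sqrt (4 * l^2 / pi^2) * L2.N (d2 l f))"
      by (rule mult_left_mono) simp
    then show ?thesis using endpoint_bound[OF VbD(1,3)[OF that]] by (simp only: mult.assoc)
  qed
  show "0 < 16 * l^4 / pi^4" "0 < L2.N (\<lambda>_. 1) * sqrt (4 * l^2 / pi^2)"
    using l_pos N_one_pos by simp_all
  show "\<exists>S. Stb S m b" if m: "L2 l m" for m b
  proof -
    \<comment> \<open>The constant is chosen so that \<open>S1 l = b\<close>; the next integration
      is likewise normalised to vanish at \<open>l\<close>.\<close>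
    define S1 where "S1 x = (b + prim m l) + prim (\<lambda>y. - m y) x" for x
    have neg: "prim (\<lambda>y. - m y) x = - prim m x" for x using prim_scale[of "-1" m x] by simp
    have S1: "wderiv l S1 (\<lambda>y. - m y)"
      unfolding S1_def using wderiv_add[OF wderiv_const prim_wderiv[OF L2_minus[OF m]], of "b + prim m l"] by simp
    have L: "L2 l S1" using S1 H1_L2 H1_def by blast
    have "wderiv l (\<lambda>x. - prim S1 l + prim S1 x) S1"
      using wderiv_add[OF wderiv_const prim_wderiv[OF L], of "- prim S1 l"] by simp
    then have "Stb (\<lambda>x. - prim S1 l + prim S1 x) m b" unfolding Stb_def
      using S1 by (intro exI[of _ S1]) (simp add: S1_def neg)
    then show ?thesis by blast
  qed
  show "L2 l S" if "Stb S m b" for S m b using that H1_L2 unfolding Stb_def H1_def by blast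
  show "L2 l m" if "Stb S m b" for S m b
    using that L2_minus[of "\<lambda>y. - m y"] wderivD(1) unfolding Stb_def by fastforce
  show "Stb (s *\<^sub>R S + t *\<^sub>R S') (s *\<^sub>R m + t *\<^sub>R m') (s * b + t * b')" if St: "Stb S m b" "Stb S' m' b'" for S m b S' m' b' s t
  proof -
    obtain S1 S1' where S1: "wderiv l S S1" "wderiv l S1 (\<lambda>y. - m y)" "S l = 0" "S1 l = b"
      "wderiv l S' S1'" "wderiv l S1' (\<lambda>y. - m' y)" "S' l = 0" "S1' l = b'"
      using St unfolding Stb_def by blast
    have "wderiv l (s *\<^sub>R S + t *\<^sub>R S') (\<lambda>y. s * S1 y + t * S1' y)" "wderiv l (\<lambda>y. s * S1 y + t * S1' y) (\<lambda>y. - (s *\<^sub>R m + t *\<^sub>R m') y)"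
      using wderiv_lin[OF S1(1,5), of s t] wderiv_lin[OF S1(2,6), of s t] by (simp_all add: plus_fun_def scaleR_fun_def)
    then show ?thesis unfolding Stb_def using S1 by (intro exI[of _ "\<lambda>y. s * S1 y + t * S1' y"]) simp
  qed
  show "Stb S m' b" if "Stb S m b" "AE y in M. m y = m' y" for S m b m'
  proof -
    obtain S1 where S1: "wderiv l S S1" "wderiv l S1 (\<lambda>y. - m y)" "S l = 0" "S1 l = b"
      using \<open>Stb S m b\<close> unfolding Stb_def by blast
    have "AE y in M. - m y = - m' y" using \<open>AE y in M. m y = m' y\<close> by eventually_elim simp
    then have "wderiv l S1 (\<lambda>y. - m' y)" by (rule wderiv_cong[OF S1(2) refl])
    then show ?thesis unfolding Stb_def using S1 by blast
  qed
  show "AE y in M. m y = 0" if "Stb S m b" "AE y in M. S y = 0" for S m b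
  proof -
    obtain S1 where S1: "wderiv l S S1" "wderiv l S1 (\<lambda>y. - m y)"
      using \<open>Stb S m b\<close> unfolding Stb_def by blast
    have "S x = 0" if "x \<in> {0..l}" for x
      using continuous_AE_eq[OF wderiv_continuous[OF S1(1)] continuous_on_const \<open>AE y in M. S y = 0\<close> that] .
    then have "wderiv l (\<lambda>_. 0) S1" by (intro wderiv_cong_fun[OF S1(1)]) simp
    then have "AE y in M. S1 y = 0" by (rule wderiv_unique[OF _ wderiv_const])
    then have "S1 x = 0" if "x \<in> {0..l}" for x
      using continuous_AE_eq[OF wderiv_continuous[OF S1(2)] continuous_on_const _ that] by blast
    then have "wderiv l (\<lambda>_. 0) (\<lambda>y. - m y)" by (intro wderiv_cong_fun[OF S1(2)]) simp
    then have "AE y in M. - m y = 0" by (rule wderiv_unique[OF _ wderiv_const])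
    then show ?thesis by simp
  qed
  show "LI (\<lambda>y. m y * \<phi> y) = - b * \<phi> l - LI (\<lambda>y. S y * d2 l \<phi> y)"
    if "Stb S m b" "Vb \<phi>" for S m b \<phi>
  proof -
    obtain S1 where S1: "wderiv l S S1" "wderiv l S1 (\<lambda>y. - m y)" "S l = 0" "S1 l = b"
      using \<open>Stb S m b\<close> unfolding Stb_def by blast
    note \<phi> = VbD[OF \<open>Vb \<phi>\<close>]
    note L = wderivD(1)[OF S1(1)] wderivD(1)[OF S1(2)] wderivD(1)[OF \<phi>(1)] wderivD(1)[OF \<phi>(2)]
    have L': "L2 l \<phi>" "L2 l S" using H1_L2 \<phi>(1) S1(1) H1_def by blast+
    have "LI (\<lambda>y. - m y * \<phi> y + S1 y * d1 l \<phi> y) = b * \<phi> l"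
      using integral_by_parts[OF S1(2) \<phi>(1)] \<phi>(3) S1(4) by simp
    moreover have "LI (\<lambda>y. - m y * \<phi> y + S1 y * d1 l \<phi> y)
      = LI (\<lambda>y. - m y * \<phi> y) + LI (\<lambda>y. S1 y * d1 l \<phi> y)"
      using L2_mult_integrable[OF L(2) L'(1)] L2_mult_integrable[OF L(1,3)] by (rule LI_add)
    moreover have "LI (\<lambda>y. S1 y * d1 l \<phi> y + S y * d2 l \<phi> y) = 0"
      using integral_by_parts[OF S1(1) \<phi>(2)] \<phi>(4) S1(3) by simp
    moreover have "LI (\<lambda>y. S1 y * d1 l \<phi> y + S y * d2 l \<phi> y)
      = LI (\<lambda>y. S1 y * d1 l \<phi> y) + LI (\<lambda>y. S y * d2 l \<phi> y)"
      using L2_mult_integrable[OF L(1,3)] L2_mult_integrable[OF L'(2) L(4)] by (rule LI_add)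
    ultimately show ?thesis by simp
  qed
qed

lemma VtI:
  assumes "wderiv l f f'" "f 0 = 0"
  shows "Vt f" "AE y in M. d1 l f y = f' y"
  using assms d1_wderiv(2) unfolding Vt_def H1_def by blast+

lemma VtD:
  assumes "Vt f"
  shows "wderiv l f (d1 l f)" "f 0 = 0"
  using assms H1_wderiv unfolding Vt_def by auto

lemma torsion: "component l Vt (d1 l) Stt (4 * l^2 / pi^2) (L2.N (\<lambda>_. 1))"
proof
  have V: "Vt (s *\<^sub>R f + t *\<^sub>R g)" "AE y in M. d1 l (s *\<^sub>R f + t *\<^sub>R g) y = s * d1 l f y + t * d1 l g y"
    if "Vt f" "Vt g" for f g s t
    using VtI[of "s *\<^sub>R f + t *\<^sub>R g" "\<lambda>y. s * d1 l f y + t * d1 l g y"]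
      wderiv_lin[OF VtD(1)[OF that(1)] VtD(1)[OF that(2)], of s t] that
    by (simp_all add: VtD plus_fun_def scaleR_fun_def)
  show "subspace {f. Vt f}"
  proof (rule subspace_linI)
    have "Vt (\<lambda>_. 0)" by (rule VtI(1)[OF wderiv_const]) auto
    then show "0 \<in> {f. Vt f}" by (simp add: zero_fun_def)
  qed (use V(1) in simp)
  show "AE y in M. d1 l (s *\<^sub>R f + t *\<^sub>R g) y = s * d1 l f y + t * d1 l g y" if "Vt f" "Vt g" for f g s t
    using V(2)[OF that] .
  show "L2 l f" if "Vt f" for f using that H1_L2 unfolding Vt_def by blast
  show "L2 l (d1 l f)" if "Vt f" for f using wderivD(1)[OF VtD(1)[OF that]] .
  show "\<exists>f. Vt f \<and> (AE y in M. d1 l f y = u y)" if "L2 l u" for u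
    using VtI[OF prim_wderiv[OF that]] by (intro exI[of _ "prim u"]) simp
  show "(L2.N f)^2 \<le> 4 * l^2 / pi^2 * (L2.N (d1 l f))^2" if "Vt f" for f
    using poincare[OF VtD[OF that]] L2_N_sq[OF wderivD(1)[OF VtD(1)[OF that]]] L2_N_sq[of f] that H1_L2
    unfolding Vt_def by simp
  show "\<bar>f l\<bar> \<le> L2.N (\<lambda>_. 1) * L2.N (d1 l f)" if "Vt f" for f
    using endpoint_bound[OF VtD[OF that]] .
  show "0 < 4 * l^2 / pi^2" "0 < L2.N (\<lambda>_. 1)"
    using l_pos N_one_pos by simp_all
  show "\<exists>S. Stt S m b" if m: "L2 l m" for m b
  proof -
    have "wderiv l (\<lambda>x. (- b - prim m l) + prim m x) m"
      using wderiv_add[OF wderiv_const prim_wderiv[OF m], of "- b - prim m l"] by simp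
    then have "Stt (\<lambda>x. (- b - prim m l) + prim m x) m b" unfolding Stt_def by simp
    then show ?thesis by blast
  qed
  show "L2 l S" if "Stt S m b" for S m b using that H1_L2 unfolding Stt_def H1_def by blast
  show "L2 l m" if "Stt S m b" for S m b using that wderivD(1) unfolding Stt_def by blast
  show "Stt (s *\<^sub>R S + t *\<^sub>R S') (s *\<^sub>R m + t *\<^sub>R m') (s * b + t * b')" if "Stt S m b" "Stt S' m' b'" for S m b S' m' b' s t
    using that wderiv_lin[of S m S' m' s t] unfolding Stt_def by (simp add: plus_fun_def scaleR_fun_def)
  show "Stt S m' b" if "Stt S m b" "AE y in M. m y = m' y" for S m b m'
    using that wderiv_cong[of S m S m'] unfolding Stt_def by simp
  show "AE y in M. m y = 0" if "Stt S m b" "AE y in M. S y = 0" for S m b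
  proof -
    have S: "wderiv l S m" using \<open>Stt S m b\<close> unfolding Stt_def by blast
    have "S x = 0" if "x \<in> {0..l}" for x
      using continuous_AE_eq[OF wderiv_continuous[OF S] continuous_on_const \<open>AE y in M. S y = 0\<close> that] .
    then have "wderiv l (\<lambda>_. 0) m" by (intro wderiv_cong_fun[OF S]) simp
    then show ?thesis by (rule wderiv_unique[OF _ wderiv_const])
  qed
  show "LI (\<lambda>y. m y * \<phi> y) = - b * \<phi> l - LI (\<lambda>y. S y * d1 l \<phi> y)"
    if "Stt S m b" "Vt \<phi>" for S m b \<phi>
  proof -
    have S: "wderiv l S m" "S l = - b" using \<open>Stt S m b\<close> unfolding Stt_def by blast+
    note \<phi> = VtD[OF \<open>Vt \<phi>\<close>]
    have L': "L2 l \<phi>" "L2 l S" using H1_L2 \<phi>(1) S(1) H1_def by blast+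
    have "LI (\<lambda>y. m y * \<phi> y + S y * d1 l \<phi> y) = - b * \<phi> l"
      using integral_by_parts[OF S(1) \<phi>(1)] \<phi>(2) S(2) by simp
    moreover have "LI (\<lambda>y. m y * \<phi> y + S y * d1 l \<phi> y)
      = LI (\<lambda>y. m y * \<phi> y) + LI (\<lambda>y. S y * d1 l \<phi> y)"
      using L2_mult_integrable[OF wderivD(1)[OF S(1)] L'(1)] L2_mult_integrable[OF L'(2) wderivD(1)[OF \<phi>(1)]]
      by (rule LI_add)
    ultimately show ?thesis by simp
  qed
qed

end

section \<open>The generated semigroup\<close>

text \<open>Identifies the operations on states with those of the vector space of functions, in
  which the abstract theory is stated.\<close>

lemma st_ops: "sadd X Y = X + Y" "sscale s X = s *\<^sub>R X" "sdiff X Y = X - Y"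
  by (auto simp: sadd_def sscale_def sdiff_def plus_fun_def scaleR_fun_def fun_diff_def split: prod.splits)

text \<open>\<open>A\<close> may select any value of the relation: the limits defining the generator
  do not see null vectors.\<close>

lemma m_dissipative_generates:
  assumes "m_dissipative H ip G" and "\<And>X. X \<in> Dom \<Longrightarrow> G X (A X)" and "\<And>X Y. G X Y \<Longrightarrow> X \<in> Dom"
  shows "generates_C0_contraction_semigroup H ip Dom A" and "dense_in_wrt Dom H ip"
proof -
  interpret m_dissipative H ip G by fact
  have D: "D = Dom" using assms(2,3) unfolding D_def by blast
  have N: "sqrt (ip X X) = N X" for X by (simp add: N_def)
  show "generates_C0_contraction_semigroup H ip Dom A"
    unfolding generates_C0_contraction_semigroup_def Let_def st_ops N
  proof (intro exI[of _ T] conjI ballI allI impI)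
    show "X \<in> Dom \<longleftrightarrow> (\<exists>Y\<in>H. ((\<lambda>t. N (dT t X - Y)) \<longlongrightarrow> 0) (at_right 0))" if "X \<in> H" for X
    proof
      assume "X \<in> Dom"
      then have "G X (A X)" by (rule assms(2))
      then show "\<exists>Y\<in>H. ((\<lambda>t. N (dT t X - Y)) \<longlongrightarrow> 0) (at_right 0)"
        using T_derivative G_H by blast
    next
      assume "\<exists>Y\<in>H. ((\<lambda>t. N (dT t X - Y)) \<longlongrightarrow> 0) (at_right 0)"
      then show "X \<in> Dom" using T_generator[OF that] D by blast
    qed
    show "Dom \<subseteq> H" using D D_sub by simp
    show "A X \<in> H" if "X \<in> Dom" for X using assms(2)[OF that] G_H by blast
    show "((\<lambda>t. N (dT t X - A X)) \<longlongrightarrow> 0) (at_right 0)" if "X \<in> Dom" for X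
      using assms(2)[OF that] by (rule T_derivative)
  qed (auto intro: T_lin T_zero T_semigroup T_continuous T_N_le)
  show "dense_in_wrt Dom H ip"
    unfolding dense_in_wrt_def st_ops N using D D_sub D_dense by auto
qed


lemma (in interval) Linf_inverse:
  assumes "Linf l a" "0 < a0" "AE y in M. a0 \<le> a y"
  shows "Linf l (\<lambda>y. 1 / a y)"
proof -
  have "AE y in M. \<bar>1 / a y\<bar> \<le> 1 / a0"
    using assms(3) by eventually_elim (use assms(2) in "auto simp: field_simps")
  moreover have "(\<lambda>y. 1 / a y) \<in> borel_measurable M"
    using assms(1) unfolding Linf_def by (intro borel_measurable_divide) auto
  ultimately show ?thesis unfolding Linf_def by blast
qed

text \<open>The product of the two positive essential infima is a lower bound for the product, which
  makes the sharper constant positive.\<close>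

lemma (in interval) ess_inf_mult:
  assumes "Linf l a" "Linf l b" "0 < ess_inf l a" "0 < ess_inf l b" "Linf l (\<lambda>y. a y * b y)"
  shows "0 < ess_inf l (\<lambda>y. a y * b y)" "AE y in M. ess_inf l (\<lambda>y. a y * b y) \<le> a y * b y"
proof -
  have "AE y in M. ess_inf l a * ess_inf l b \<le> a y * b y"
    using ess_inf(1)[OF assms(1)] ess_inf(1)[OF assms(2)]
    by eventually_elim (use assms(3,4) in "auto intro!: mult_mono")
  from ess_inf(2)[OF assms(5) this] show "0 < ess_inf l (\<lambda>y. a y * b y)"
    using mult_pos_pos[OF assms(3,4)] by linarith
  show "AE y in M. ess_inf l (\<lambda>y. a y * b y) \<le> a y * b y" by (rule ess_inf(1)[OF assms(5)])
qed

text \<open>Clears the denominators in \<open>eps1_star\<close> and \<open>eps2_star\<close>. Here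
  \<open>p\<close> is the power of \<open>pi\<close>, the fourth for bending and the second for
  torsion, and \<open>B\<close> is \<open>4 * \<gamma> * r1\<close> for the component.\<close>

lemma eps_bound:
  fixes e A B p h c :: real
  assumes "0 < p" "0 < A" "0 < h * c" "A = p * B" "e < 4 * p * c / (A + p * h * c)"
  shows "e * (B + h * c) \<le> 4 * c"
proof -
  have "0 < A + p * h * c" using mult_pos_pos[OF assms(1,3)] assms(2) by (simp add: mult.assoc)
  then have "e * (A + p * h * c) < 4 * p * c" using assms(5) by (simp add: pos_less_divide_eq)
  then have "p * (e * (B + h * c)) < p * (4 * c)" by (simp add: assms(4) algebra_simps)
  then show ?thesis using assms(1) by simp
qed

section \<open>Assembly of the two components\<close>

theorem theorem1:
  fixes l k1 k2 \<epsilon>1 \<epsilon>2 :: real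
    and \<rho> Iw EI GJ \<eta>\<omega> \<eta>\<phi> :: "real \<Rightarrow> real"
  assumes "l > 0"
    and "Linf l \<rho>" "Linf l Iw" "Linf l EI" "Linf l GJ" "Linf l \<eta>\<omega>" "Linf l \<eta>\<phi>"
    and "ess_inf l \<rho> > 0" "ess_inf l Iw > 0" "ess_inf l EI > 0" "ess_inf l GJ > 0"
        "ess_inf l \<eta>\<omega> > 0" "ess_inf l \<eta>\<phi> > 0"
    and "k1 \<ge> 0" "k2 \<ge> 0"
    and "\<epsilon>1 > 0" "\<epsilon>2 > 0"
    and "\<epsilon>1 < min (eps1_star l \<rho> \<eta>\<omega> EI) (1 / Km l \<rho> EI Iw GJ)"
    and "\<epsilon>2 < min (eps2_star l Iw \<eta>\<phi> GJ) (1 / Km l \<rho> EI Iw GJ)"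
  shows "generates_C0_contraction_semigroup (HH l) (ip2 l EI \<rho> GJ Iw \<epsilon>1 \<epsilon>2)
           (DA1 l EI GJ \<eta>\<omega> \<eta>\<phi> k1 k2 \<epsilon>1 \<epsilon>2) (A1 l \<rho> Iw EI GJ \<eta>\<omega> \<eta>\<phi> k1 k2 \<epsilon>1 \<epsilon>2)
       \<and> dense_in_wrt (DA1 l EI GJ \<eta>\<omega> \<eta>\<phi> k1 k2 \<epsilon>1 \<epsilon>2) (HH l) (ip1 l EI \<rho> GJ Iw)
       \<and> dense_in_wrt (DA1 l EI GJ \<eta>\<omega> \<eta>\<phi> k1 k2 \<epsilon>1 \<epsilon>2) (HH l) (ip2 l EI \<rho> GJ Iw \<epsilon>1 \<epsilon>2)"
proof -
  interpret interval l by unfold_locales fact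
  note Linf = assms(2-7) and pos = assms(8-13) and eps = assms(18,19)
  have sup_pos: "0 < ess_sup l a" if "Linf l a" "0 < ess_inf l a" for a
    using ess_inf_le_ess_sup[OF that(1)] that(2) by linarith
  let ?ip1 = "ip1 l EI \<rho> GJ Iw" and ?ip2 = "ip2 l EI \<rho> GJ Iw \<epsilon>1 \<epsilon>2"
  let ?cb = "ess_inf l (\<lambda>y. \<eta>\<omega> y * EI y)" and ?ct = "ess_inf l (\<lambda>y. \<eta>\<phi> y * GJ y)"
  note cb = ess_inf_mult[OF Linf(5,3) pos(5,3) Linf_mult[OF Linf(5,3)]]
    and ct = ess_inf_mult[OF Linf(6,4) pos(6,4) Linf_mult[OF Linf(6,4)]]
  define K where "K = Km l \<rho> EI Iw GJ"
  have K: "sqrt (ess_sup l \<rho>) \<le> K" "16 * l^4 * sqrt (ess_sup l \<rho>) / (pi^4 * ess_inf l EI) \<le> K"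
    "sqrt (ess_sup l Iw) \<le> K" "4 * l^2 * sqrt (ess_sup l Iw) / (pi^2 * ess_inf l GJ) \<le> K"
    unfolding K_def Km_def by (auto intro: Max_ge)
  have "0 < sqrt (ess_sup l \<rho>)" using sup_pos[OF Linf(1) pos(1)] by simp
  then have K0: "0 < K" using K(1) by linarith
  have small: "e * x < 1" if "e < 1 / K" "0 < e" "x \<le> K" for e x
  proof -
    have "e * x \<le> e * K" using that by (intro mult_left_mono) auto
    also have "\<dots> < 1" using that(1) K0 by (simp add: field_simps)
    finally show ?thesis .
  qed
  have e1: "\<epsilon>1 < 1 / K" "\<epsilon>1 < eps1_star l \<rho> \<eta>\<omega> EI" and e2: "\<epsilon>2 < 1 / K" "\<epsilon>2 < eps2_star l Iw \<eta>\<phi> GJ"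
    using eps by (simp_all add: K_def)
  interpret b: component l Vb "d2 l" Stb "16 * l^4 / pi^4" "L2.N (\<lambda>_. 1) * sqrt (4 * l^2 / pi^2)"
    by (rule bending)
  interpret b: damped_component l Vb "d2 l" Stb "16 * l^4 / pi^4" "L2.N (\<lambda>_. 1) * sqrt (4 * l^2 / pi^2)"
    EI \<rho> \<eta>\<omega> k1 \<epsilon>1 "ess_inf l EI" "ess_inf l \<rho>" "ess_sup l \<rho>" ?cb "ess_sup l \<eta>\<omega>"
  proof
    show "\<epsilon>1 * sqrt (ess_sup l \<rho>) < 1" by (rule small[OF e1(1) assms(16) K(1)])
    show "\<epsilon>1 * (16 * l^4 / pi^4 * sqrt (ess_sup l \<rho>)) < ess_inf l EI"
      using small[OF e1(1) assms(16) K(2)] pos(3) by (simp add: field_simps)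
    show "\<epsilon>1 * (4 * (16 * l^4 / pi^4) * ess_sup l \<rho> + ess_sup l \<eta>\<omega> * ?cb) \<le> 4 * ?cb"
      by (rule eps_bound[OF _ _ _ _ e1(2)[unfolded eps1_star_def]])
        (use sup_pos[OF Linf(1) pos(1)] sup_pos[OF Linf(5) pos(5)] cb(1) l_pos in "auto simp: field_simps")
  qed (use Linf pos assms(14,16) cb sup_pos[OF Linf(1) pos(1)] sup_pos[OF Linf(5) pos(5)] ess_inf(1) ess_sup(1) in auto)
  interpret t: component l Vt "d1 l" Stt "4 * l^2 / pi^2" "L2.N (\<lambda>_. 1)"
    by (rule torsion)
  interpret t: damped_component l Vt "d1 l" Stt "4 * l^2 / pi^2" "L2.N (\<lambda>_. 1)"
    GJ Iw \<eta>\<phi> k2 \<epsilon>2 "ess_inf l GJ" "ess_inf l Iw" "ess_sup l Iw" ?ct "ess_sup l \<eta>\<phi>"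
  proof
    show "\<epsilon>2 * sqrt (ess_sup l Iw) < 1" by (rule small[OF e2(1) assms(17) K(3)])
    show "\<epsilon>2 * (4 * l^2 / pi^2 * sqrt (ess_sup l Iw)) < ess_inf l GJ"
      using small[OF e2(1) assms(17) K(4)] pos(4) by (simp add: field_simps)
    show "\<epsilon>2 * (4 * (4 * l^2 / pi^2) * ess_sup l Iw + ess_sup l \<eta>\<phi> * ?ct) \<le> 4 * ?ct"
      by (rule eps_bound[OF _ _ _ _ e2(2)[unfolded eps2_star_def]])
        (use sup_pos[OF Linf(2) pos(2)] sup_pos[OF Linf(6) pos(6)] ct(1) l_pos in "auto simp: field_simps")
  qed (use Linf pos assms(15,17) ct sup_pos[OF Linf(2) pos(2)] sup_pos[OF Linf(6) pos(6)] ess_inf(1) ess_sup(1) in auto)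
  \<comment> \<open>\<open>p\<close> extracts the bending pair and \<open>q\<close> the torsion
    pair.\<close>
  define p where "p X = (fst X, fst (snd X))" for X :: st
  define q where "q X = snd (snd X)" for X :: st
  have lin: "linear p" "linear q" by (auto intro!: linearI simp: p_def q_def)
  have ex: "\<exists>X. p X = x \<and> q X = y" for x y
    by (rule exI[of _ "(fst x, snd x, y)"]) (simp add: p_def q_def)
  let ?G = "\<lambda>X Y. b.genrel (p X) (p Y) \<and> t.genrel (q X) (q Y)"
  have HH: "{X. p X \<in> b.phase \<and> q X \<in> t.phase} = HH l"
    by (auto simp: HH_def p_def q_def b.phase_def t.phase_def Vb_def Vt_def)
  then have HHi: "X \<in> HH l \<longleftrightarrow> p X \<in> b.phase \<and> q X \<in> t.phase" for X by blast
  have ip1_eq: "?ip1 X X = b.E0 (p X) + t.E0 (q X)"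
    and ip2_eq: "?ip2 X Y = b.E (p X) (p Y) + t.E (q X) (q Y)" if X: "X \<in> HH l" and Y: "Y \<in> HH l" for X Y
  proof -
    have ip1: "?ip1 X Y = W EI (d2 l (fst (p X))) (d2 l (fst (p Y))) + W \<rho> (snd (p X)) (snd (p Y))
        + W GJ (d1 l (fst (q X))) (d1 l (fst (q Y))) + W Iw (snd (q X)) (snd (q Y))" if X: "X \<in> HH l" and Y: "Y \<in> HH l" for X Y
    proof -
      have H: "p X \<in> b.phase" "q X \<in> t.phase" "p Y \<in> b.phase" "q Y \<in> t.phase" using X Y HH by auto
      note i = W_integrable[OF Linf(3) b.phase_D(4)[OF H(1)] b.phase_D(4)[OF H(3)]] W_integrable[OF Linf(1) b.phase_D(2)[OF H(1)] b.phase_D(2)[OF H(3)]]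
        W_integrable[OF Linf(4) t.phase_D(4)[OF H(2)] t.phase_D(4)[OF H(4)]] W_integrable[OF Linf(2) t.phase_D(2)[OF H(2)] t.phase_D(2)[OF H(4)]]
      then show ?thesis
        unfolding ip1_def W_def by (simp add: p_def q_def split_def)
    qed
    show "?ip1 X X = b.E0 (p X) + t.E0 (q X)"
      unfolding ip1[OF X X] b.E0_def t.E0_def by simp
    have H: "p X \<in> b.phase" "q X \<in> t.phase" "p Y \<in> b.phase" "q Y \<in> t.phase" using X Y HH by auto
    have cross: "LI (\<lambda>y. a y * (f y * g' y + g y * f' y)) = W a f g' + W a g f'"
      if "Linf l a" "L2 l f" "L2 l g" "L2 l f'" "L2 l g'" for a f g f' g'
      unfolding W_def using W_integrable[OF that(1,2,5)] W_integrable[OF that(1,3,4)]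
      by (simp add: distrib_left mult.assoc)
    show "?ip2 X Y = b.E (p X) (p Y) + t.E (q X) (q Y)"
      unfolding ip2_def ip1[OF X Y] b.E_def t.E_def
      using cross[OF Linf(1) b.phase_D(3,2)[OF H(1)] b.phase_D(3,2)[OF H(3)]] cross[OF Linf(2) t.phase_D(3,2)[OF H(2)] t.phase_D(3,2)[OF H(4)]]
      by (simp add: p_def q_def split_def)
  qed
  have diss: "m_dissipative (HH l) ?ip2 ?G"
    unfolding HH[symmetric] using b.B.m_dissipative_axioms t.B.m_dissipative_axioms lin ex
    by (rule m_dissipative_direct_sum) (intro ip2_eq, simp_all add: HHi)
  let ?wit = "DA1_wit l EI GJ \<eta>\<omega> \<eta>\<phi> k1 k2 \<epsilon>1 \<epsilon>2" and ?D = "DA1 l EI GJ \<eta>\<omega> \<eta>\<phi> k1 k2 \<epsilon>1 \<epsilon>2"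
    and ?A = "A1 l \<rho> Iw EI GJ \<eta>\<omega> \<eta>\<phi> k1 k2 \<epsilon>1 \<epsilon>2"
  let ?n = "\<lambda>S y. - d2 l S y / \<rho> y" and ?n' = "\<lambda>Q y. d1 l Q y / Iw y"
  have wit_G: "?G X (g', ?n S, z', ?n' Q)" if wit: "?wit X (g', z', S, Q)" for X g' z' S Q
  proof -
    obtain f g h z where X: "X = (f, g, h, z)" by (cases X)
    have w: "X \<in> HH l" "AE y in M. g' y = g y" "AE y in M. z' y = z y"
      "H2 l g'" "H1 l z'" "H2 l S" "H1 l Q"
      "AE y in M. S y = EI y * d2 l f y + \<eta>\<omega> y * EI y * d2 l g' y"
      "AE y in M. Q y = GJ y * d1 l h y + \<eta>\<phi> y * GJ y * d1 l z' y"
      "g' 0 = 0" "d1 l g' 0 = 0" "z' 0 = 0" "S l = 0" "d1 l S l = k1 * (g' l + \<epsilon>1 * f l)" "Q l = - k2 * (z' l + \<epsilon>2 * h l)"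
      using wit unfolding DA1_wit_def X by auto
    have H: "(f, g) \<in> b.phase" "(h, z) \<in> t.phase" using w(1) HHi[of X] by (simp_all add: X p_def q_def)
    note S = H2_wderivs[OF w(6)] and Q = H1_wderiv[OF w(7)]
    have ninv: "L2 l (?n S)" "L2 l (?n' Q)"
      using L2_Linf_mult[OF Linf_inverse[OF Linf(1) pos(1) ess_inf(1)[OF Linf(1)]] L2_minus[OF wderivD(1)[OF S(2)]]]
        L2_Linf_mult[OF Linf_inverse[OF Linf(2) pos(2) ess_inf(1)[OF Linf(2)]] wderivD(1)[OF Q]] by simp_all
    have "b.genrel (f, g) (g', ?n S)"
    proof (rule b.genrel_I[OF H(1)])
      show "(g', ?n S) \<in> b.phase" using w ninv by (simp add: b.phase_def Vb_def)
      show "AE y in M. snd (f, g) y = fst (g', ?n S) y" using w(2) by eventually_elim simp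
      \<comment> \<open>Multiplying back by \<rho> is legitimate only where \<rho> is nonzero, hence
        almost everywhere.\<close>
      have "AE y in M. d2 l S y = - (\<rho> y * (- d2 l S y / \<rho> y))"
        using ess_inf(1)[OF Linf(1)] by eventually_elim (use pos(1) in auto)
      then have "wderiv l (d1 l S) (\<lambda>y. - (\<rho> y * (- d2 l S y / \<rho> y)))" by (rule wderiv_cong[OF S(2) refl])
      then show "Stb S (\<lambda>y. \<rho> y * snd (g', ?n S) y) (k1 * (fst (g', ?n S) l + \<epsilon>1 * fst (f, g) l))"
        unfolding Stb_def using S(1) w(13,14) by (intro exI[of _ "d1 l S"]) simp
    qed (use w(8) in simp)
    moreover have "t.genrel (h, z) (z', ?n' Q)"
    proof (rule t.genrel_I[OF H(2)])
      show "(z', ?n' Q) \<in> t.phase" using w ninv by (simp add: t.phase_def Vt_def)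
      show "AE y in M. snd (h, z) y = fst (z', ?n' Q) y" using w(3) by eventually_elim simp
      have "AE y in M. d1 l Q y = Iw y * (d1 l Q y / Iw y)"
        using ess_inf(1)[OF Linf(2)] by eventually_elim (use pos(2) in auto)
      then have "wderiv l Q (\<lambda>y. Iw y * (d1 l Q y / Iw y))" by (rule wderiv_cong[OF Q refl])
      then show "Stt Q (\<lambda>y. Iw y * snd (z', ?n' Q) y) (k2 * (fst (z', ?n' Q) l + \<epsilon>2 * fst (h, z) l))"
        unfolding Stt_def using w(15) by simp
    qed (use w(9) in simp)
    ultimately show ?thesis by (simp add: X p_def q_def)
  qed
  \<comment> \<open>\<open>A1\<close> is built from an arbitrary witness, and \<open>wit_G\<close>
    holds for every one of them.\<close>
  have D_G: "?G X (?A X)" if "X \<in> ?D" for X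
  proof -
    have "?wit X (SOME W. ?wit X W)" using that unfolding DA1_def by (auto intro: someI_ex)
    then show ?thesis unfolding A1_def by (cases "SOME W. ?wit X W") (auto dest!: wit_G)
  qed
  have G_D: "X \<in> ?D" if G: "?G X Y" for X Y
  proof -
    obtain f g h z where X: "X = (f, g, h, z)" by (cases X)
    obtain F n F' n' where Y: "Y = (F, n, F', n')" by (cases Y)
    have Gb: "b.genrel (f, g) (F, n)" and Gt: "t.genrel (h, z) (F', n')" using G by (auto simp: X Y p_def q_def)
    obtain S where Hb: "(f, g) \<in> b.phase" "(F, n) \<in> b.phase" "AE y in M. g y = F y"
      "Stb S (\<lambda>y. \<rho> y * n y) (k1 * (F l + \<epsilon>1 * f l))" "AE y in M. S y = EI y * d2 l f y + \<eta>\<omega> y * EI y * d2 l F y"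
      using Gb unfolding b.genrel_def by auto
    obtain Q where Ht: "(h, z) \<in> t.phase" "(F', n') \<in> t.phase" "AE y in M. z y = F' y"
      "Stt Q (\<lambda>y. Iw y * n' y) (k2 * (F' l + \<epsilon>2 * h l))" "AE y in M. Q y = GJ y * d1 l h y + \<eta>\<phi> y * GJ y * d1 l F' y"
      using Gt unfolding t.genrel_def by auto
    obtain S1 where S1: "wderiv l S S1" "wderiv l S1 (\<lambda>y. - (\<rho> y * n y))" "S l = 0" "S1 l = k1 * (F l + \<epsilon>1 * f l)"
      using Hb(4) unfolding Stb_def by blast
    \<comment> \<open>Continuity of the shear force is what pins down \<open>d1 l S\<close> at the
      single point \<open>l\<close>.\<close>
    have "H1 l S1" using S1(2) H1_def by blast
    then have dS: "d1 l S l = S1 l" using d1_H1(2)[OF S1(1) _ zero_mem(2)] by blast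
    have "H1 l Q" "Q l = - k2 * (F' l + \<epsilon>2 * h l)" using Ht(4) unfolding Stt_def H1_def by auto
    moreover have "X \<in> HH l" using Hb(1) Ht(1) HHi[of X] by (simp add: X p_def q_def)
    moreover have "H2 l F" "F 0 = 0" "d1 l F 0 = 0" "H1 l F'" "F' 0 = 0"
      using Hb(2) Ht(2) by (auto simp: b.phase_def t.phase_def Vb_def Vt_def)
    moreover have "H2 l S" by (rule H2I[OF S1(1,2)])
    moreover have "AE y in M. F y = g y" "AE y in M. F' y = z y" using Hb(3) Ht(3) by (auto elim: eventually_mono)
    ultimately have "?wit X (F, F', S, Q)"
      unfolding DA1_wit_def X using Hb(5) Ht(5) S1(3,4) dS by simp
    then show ?thesis unfolding DA1_def by blast
  qed
  have gen: "generates_C0_contraction_semigroup (HH l) ?ip2 ?D ?A"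
    "dense_in_wrt ?D (HH l) ?ip2"
    by (rule m_dissipative_generates[OF diss]; (erule D_G | erule G_D))+
  moreover have "dense_in_wrt ?D (HH l) ?ip1"
  proof -
    obtain \<delta>b where \<delta>b: "\<delta>b > 0" "\<And>x. x \<in> b.phase \<Longrightarrow> \<delta>b * b.E0 x \<le> b.E x x" using b.E_lower by blast
    obtain \<delta>t where \<delta>t: "\<delta>t > 0" "\<And>x. x \<in> t.phase \<Longrightarrow> \<delta>t * t.E0 x \<le> t.E x x" using t.E_lower by blast
    \<comment> \<open>One constant for both components: the perturbed inner product then dominates
      \<delta> times the unperturbed one on the diagonal, and density transfers.\<close>
    define \<delta> where "\<delta> = min \<delta>b \<delta>t"
    have \<delta>: "0 < \<delta>" using \<delta>b(1) \<delta>t(1) by (simp add: \<delta>_def)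
    interpret m: m_dissipative "HH l" ?ip2 ?G by (rule diss)
    have le: "\<delta> * ?ip1 X X \<le> ?ip2 X X" if X: "X \<in> HH l" for X
    proof -
      have H: "p X \<in> b.phase" "q X \<in> t.phase" using X HH by auto
      have "\<delta> * b.E0 (p X) \<le> \<delta>b * b.E0 (p X)" "\<delta> * t.E0 (q X) \<le> \<delta>t * t.E0 (q X)"
        using b.E0_nonneg[OF H(1)] t.E0_nonneg[OF H(2)] by (auto simp: \<delta>_def intro!: mult_right_mono)
      then show ?thesis
        using \<delta>b(2)[OF H(1)] \<delta>t(2)[OF H(2)] unfolding ip1_eq[OF X X] ip2_eq[OF X X] distrib_left by linarith
    qed
    show ?thesis
      unfolding dense_in_wrt_def st_ops
    proof (intro conjI ballI allI impI)
      show "?D \<subseteq> HH l" using gen(2) unfolding dense_in_wrt_def by blast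
      fix X and e :: real assume X: "X \<in> HH l" and e: "e > 0"
      then have "0 < sqrt \<delta> * e" using \<delta> by simp
      then obtain Y where Y: "Y \<in> ?D" "sqrt (?ip2 (X - Y) (X - Y)) < sqrt \<delta> * e"
        using gen(2) X unfolding dense_in_wrt_def st_ops by blast
      have XY: "X - Y \<in> HH l" using X Y(1) \<open>?D \<subseteq> HH l\<close> by (intro m.H_diff) auto
      have "sqrt \<delta> * sqrt (?ip1 (X - Y) (X - Y)) \<le> sqrt (?ip2 (X - Y) (X - Y))"
        using le[OF XY] unfolding real_sqrt_mult[symmetric] by simp
      then have "sqrt \<delta> * sqrt (?ip1 (X - Y) (X - Y)) < sqrt \<delta> * e" using Y(2) by linarith
      then have "sqrt (?ip1 (X - Y) (X - Y)) < e" using \<delta> by simp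
      then show "\<exists>Y\<in>?D. sqrt (?ip1 (X - Y) (X - Y)) < e" using Y(1) by blast
    qed
  qed
  ultimately show ?thesis by blast
qed

end
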